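(* For every $\theta\in(0,1)$ and $\epsilon>0$ there exists $\delta\in(0,1)$, depending on $\theta$ and $\epsilon$ (and, in the two-sided corkscrew case, also on the two-sided corkscrew parameter), such that the following holds. Let $\Omega^+\subset\mathbb{R}^2$ be either a Jordan domain or a two-sided corkscrew open set, let $\Gamma=\partial\Omega^+$, and let $\mu$ be a measure with $1$-linear growth supported on $\Gamma$. Let $B$ be a ball centered at a point of $\Gamma$ such that $\mu(B)\ge\theta\,r(B)$. If $$\int_{7B}\int_0^{7r(B)}\big[\varepsilon(x,r)^2+\alpha^+(x,r)^2\big]\,\frac{dr}{r}\,d\mu(x)\le\delta\,\mu(7B),$$ then $\beta_{\infty,\Gamma}(B)\le\epsilon$.
   Context: $\mathcal{H}^1$ is one-dimensional Hausdorff measure. Balls are open; $r(B)$ is the radius of $B$, and $7B$ is the concentric ball of radius $7r(B)$. A measure means a non-negative locally finite Borel measure on $\mathbb{R}^2$; $\mu$ has $C_0$-linear growth if $\mu(B(x,r))\le C_0r$ for all $x\in\mathbb{R}^2$, $r>0$. Coefficients: for an open set $\Omega^+\subset\mathbb{R}^2$, put $\Omega^-=\mathbb{R}^2\setminus\overline{\Omega^+}$. Let $I^\pm(x,r)$ be the longest open arcs of $\partial B(x,r)$ contained in $\Omega^\pm$ (possibly empty), and $\varepsilon(x,r)=\frac1r\max\big(|\pi r-\mathcal{H}^1(I^+(x,r))|,\,|\pi r-\mathcal{H}^1(I^-(x,r))|\big)$, $\ \alpha^+(x,r)=\Big|\frac{\pi}{2}-\frac1{r^2}\int_{\Omega^+}e^{-|y-x|^2/r^2}\,dy\Big|$.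 Beta number: $\beta_{\infty,\Gamma}(B)=\frac1{r(B)}\inf_{L}\sup_{y\in\Gamma\cap B}\mathrm{dist}(y,L)$, the infimum being over all lines $L$ with $L\cap B\ne\varnothing$. Jordan domain: a connected open set whose boundary is a Jordan curve. Corkscrew condition: an open set $\Omega\subset\mathbb{R}^2$ satisfies the $c$-corkscrew condition if for all $x\in\partial\Omega$ and all $0<r<\mathrm{diam}(\Omega)$ there is a ball $B'\subset\Omega\cap\overline{B(x,r)}$ with $r(B')\ge cr$. A two-sided corkscrew open set (with parameter $c>0$) is an open set $\Omega$ such that both $\Omega$ and $\mathbb{R}^2\setminus\overline{\Omega}$ satisfy the $c$-corkscrew condition; it is a standing assumption that $\partial\Omega^-=\partial\Omega^+$. *)

theory Defs
  imports "HOL-Analysis.Analysis"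
begin

section \<open>One-dimensional Hausdorff measure\<close>

text \<open>
  The library function \<open>diameter\<close> is real-valued and uninformative on unbounded sets; this
  one takes the value \<open>\<infinity>\<close> there (and \<open>0\<close> on the empty set).
\<close>

definition ediameter :: "'a::metric_space set \<Rightarrow> ennreal" where
  "ediameter S = (SUP (x, y) \<in> S \<times> S. ennreal (dist x y))"

definition hausdorff1_content :: "ennreal \<Rightarrow> 'a::metric_space set \<Rightarrow> ennreal" where
  "hausdorff1_content d A =
     (INF U \<in> {U :: nat \<Rightarrow> 'a set. A \<subseteq> (\<Union>i. U i) \<and> (\<forall>i. ediameter (U i) \<le> d)}.
        \<Sum>i. ediameter (U i))"

text \<open>Normalised so that the measure of a rectifiable arc is its length.\<close>

definition hausdorff1 :: "'a::metric_space set \<Rightarrow> ennreal" where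
  "hausdorff1 A = (SUP d \<in> {0<..}. hausdorff1_content d A)"


section \<open>Square function coefficients\<close>

text \<open>
  Open arcs of a circle are its connected, relatively open subsets; this includes the empty set
  and the whole circle.
\<close>

definition open_arc_in :: "real^2 \<Rightarrow> real \<Rightarrow> (real^2) set \<Rightarrow> (real^2) set \<Rightarrow> bool" where
  "open_arc_in x r U A \<longleftrightarrow>
     openin (top_of_set (sphere x r)) A \<and> connected A \<and> A \<subseteq> U"

text \<open>
  The longest arc need not be unique; any choice has the same length, and only the length is
  used below.
\<close>

definition longest_arc :: "(real^2) set \<Rightarrow> real^2 \<Rightarrow> real \<Rightarrow> (real^2) set" where
  "longest_arc U x r = arg_max hausdorff1 (open_arc_in x r U)"

definition exterior :: "(real^2) set \<Rightarrow> (real^2) set" where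
  "exterior \<Omega> = - closure \<Omega>"

definition eps_coeff :: "(real^2) set \<Rightarrow> real^2 \<Rightarrow> real \<Rightarrow> real" where
  "eps_coeff \<Omega> x r =
     (1 / r) * max \<bar>pi * r - enn2real (hausdorff1 (longest_arc \<Omega> x r))\<bar>
                   \<bar>pi * r - enn2real (hausdorff1 (longest_arc (exterior \<Omega>) x r))\<bar>"

definition alpha_coeff :: "(real^2) set \<Rightarrow> real^2 \<Rightarrow> real \<Rightarrow> real" where
  "alpha_coeff \<Omega> x r =
     \<bar>pi / 2 - (1 / r\<^sup>2) * (LINT y:\<Omega>|lborel. exp (- (norm (y - x))\<^sup>2 / r\<^sup>2))\<bar>"


section \<open>Beta numbers\<close>

definition is_line :: "(real^2) set \<Rightarrow> bool" where
  "is_line L \<longleftrightarrow> affine L \<and> aff_dim L = 1"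

text \<open>
  The beta number of the ball \<open>ball z \<rho>\<close>. The real-valued supremum is meaningful only
  when \<open>\<Gamma>\<close> meets the ball, for instance when \<open>z \<in> \<Gamma>\<close> and \<open>\<rho> > 0\<close>.
\<close>

definition beta_infty :: "(real^2) set \<Rightarrow> real^2 \<Rightarrow> real \<Rightarrow> real" where
  "beta_infty \<Gamma> z \<rho> =
     (1 / \<rho>) * (INF L \<in> {L. is_line L \<and> L \<inter> ball z \<rho> \<noteq> {}}.
                    SUP y \<in> \<Gamma> \<inter> ball z \<rho>. infdist y L)"


section \<open>Domains\<close>

definition jordan_curve :: "(real^2) set \<Rightarrow> bool" where
  "jordan_curve \<Gamma> \<longleftrightarrow>
     (\<exists>g :: real \<Rightarrow> real^2. simple_path g \<and> pathfinish g = pathstart g \<and> path_image g = \<Gamma>)"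

definition jordan_domain :: "(real^2) set \<Rightarrow> bool" where
  "jordan_domain \<Omega> \<longleftrightarrow> open \<Omega> \<and> connected \<Omega> \<and> jordan_curve (frontier \<Omega>)"

definition corkscrew :: "real \<Rightarrow> (real^2) set \<Rightarrow> bool" where
  "corkscrew c \<Omega> \<longleftrightarrow>
     (\<forall>x \<in> frontier \<Omega>. \<forall>r > 0. ennreal r < ediameter \<Omega> \<longrightarrow>
        (\<exists>y s. 0 < s \<and> c * r \<le> s \<and> ball y s \<subseteq> \<Omega> \<inter> cball x r))"

text \<open>
  The equality of the two boundaries is a standing assumption for two-sided corkscrew sets. For
  Jordan domains it is automatic.
\<close>

definition two_sided_corkscrew :: "real \<Rightarrow> (real^2) set \<Rightarrow> bool" where
  "two_sided_corkscrew c \<Omega> \<longleftrightarrow>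
     open \<Omega> \<and> corkscrew c \<Omega> \<and> corkscrew c (exterior \<Omega>) \<and>
     frontier (exterior \<Omega>) = frontier \<Omega>"


section \<open>Measures\<close>

definition locally_finite_borel :: "(real^2) measure \<Rightarrow> bool" where
  "locally_finite_borel \<mu> \<longleftrightarrow>
     sets \<mu> = sets borel \<and> (\<forall>x. \<exists>r > 0. emeasure \<mu> (ball x r) < \<infinity>)"

definition linear_growth :: "real \<Rightarrow> (real^2) measure \<Rightarrow> bool" where
  "linear_growth C \<mu> \<longleftrightarrow> (\<forall>x. \<forall>r > 0. emeasure \<mu> (ball x r) \<le> ennreal (C * r))"

text \<open>For closed \<open>\<Gamma>\<close> this says that the topological support of \<open>\<mu>\<close> lies in \<open>\<Gamma>\<close>.\<close>

definition supported_on :: "(real^2) measure \<Rightarrow> (real^2) set \<Rightarrow> bool" where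
  "supported_on \<mu> \<Gamma> \<longleftrightarrow> emeasure \<mu> (- \<Gamma>) = 0"

end

theory Submission
  imports Defs
begin

text \<open>
  Only the coefficients \<open>\<epsilon>(x, r)\<close> matter. By Chebyshev most points \<open>x\<close> of the support have few
  bad radii: for all other \<open>r\<close> the circle \<open>\<partial>B(x, r)\<close> is split by \<open>\<Omega>\<close> and its exterior into nearly
  complementary half circles. By linear growth two such points \<open>x, x'\<close> can be chosen at a small but
  controlled distance \<open>d\<close>. Nearly every circle about \<open>x\<close> is split along a diameter close to the line
  \<open>xx'\<close>: reflecting a point in \<open>x\<close> or in \<open>x'\<close> exchanges \<open>\<Omega>\<close> and its exterior, so both sets are almost
  invariant under translation by \<open>2(x' - x)\<close>; if two circles of nearly equal radii about \<open>x\<close> had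
  half circles in \<open>\<Omega>\<close> tilted to the same side of \<open>x\<close>, such translations would carry a point of \<open>\<Omega>\<close> on
  one of them to a point of the exterior on the other. Hence away from the line \<open>xx'\<close> the boundary avoids
  a fine grid formed by circles about \<open>x\<close> and about \<open>x'\<close>. A boundary point there would be cut off from
  \<open>x\<close> by a cell of the grid, which is absurd when the boundary is connected, and the corkscrew balls
  near it would be joined through the grid without crossing the boundary.
\<close>

section \<open>Arcs and Hausdorff measure\<close>

text \<open>The obstacle is that a reflection loses information: a point known to lie in the open
  set may be within \<open>\<kappa>\<close> of the dividing diameter, and then nothing follows for
  its antipode. A chain of reflections must therefore gain something at every step. Circles through
  one common point give no gain; hence their squared radii are perturbed by a cubic, and consecutive
  circles meet at points that approach the axis by a definite amount. The number of steps grows like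
  the inverse of the distance of the centres, so this distance needs a lower bound
  \<open>d1\<close>, which linear growth supplies. This dictates the order of choices: the strip
  width \<open>t\<close> from \<open>\<epsilon>\<close>, \<open>d1\<close> from
  \<open>\<theta>\<close> and \<open>t\<close>, the mesh \<open>l\<close> of the grid from
  \<open>t\<close>, \<open>d1\<close> and the corkscrew parameter, then a window \<open>L\<close> of
  radii, the size \<open>c\<close> of the perturbation, \<open>\<kappa>\<close> and
  \<open>\<eta>\<close>, and \<open>\<delta>\<close> last. The chain excludes only two separated
  radii in one window with tilts to the same side. As there are two sides, three radii are tested,
  and one of them is not tilted.\<close>

lemma ediameter_le:
  assumes "\<And>p q. p \<in> S \<Longrightarrow> q \<in> S \<Longrightarrow> dist p q \<le> c"
  shows "ediameter S \<le> ennreal c"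
  unfolding ediameter_def using assms by (intro SUP_least) (auto intro: ennreal_leI)

lemma hausdorff1_mono:
  assumes "A \<subseteq> B" shows "hausdorff1 A \<le> hausdorff1 B"
proof -
  have "hausdorff1_content d A \<le> hausdorff1_content d B" for d
    unfolding hausdorff1_content_def by (intro INF_superset_mono) (use assms in auto)
  then show ?thesis unfolding hausdorff1_def by (intro SUP_mono) auto
qed

section \<open>Circles parametrised by angle\<close>

definition unit_dir :: "real \<Rightarrow> real^2" where
  "unit_dir t = vector [cos t, sin t]"

lemma unit_dir_nth [simp]: "unit_dir t $ 1 = cos t" "unit_dir t $ 2 = sin t"
  by (simp_all add: unit_dir_def)

lemma inner_unit_dir: "unit_dir s \<bullet> unit_dir t = cos (s - t)"
  by (simp add: inner_vec_def sum_2 cos_diff)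

lemma norm_unit_dir [simp]: "norm (unit_dir t) = 1"
  by (simp add: norm_eq_sqrt_inner inner_unit_dir)

lemma unit_dir_2pi: "unit_dir (t + 2 * pi) = unit_dir t"
  by (simp add: unit_dir_def)

lemma dist_unit_dir_le: "dist (unit_dir s) (unit_dir t) \<le> \<bar>s - t\<bar>"
proof -
  have "(dist (unit_dir s) (unit_dir t))\<^sup>2 = 2 - 2 * cos (s - t)"
    unfolding dist_norm power2_norm_eq_inner
    by (simp add: inner_diff_left inner_diff_right inner_unit_dir cos_diff mult.commute)
  also have "\<dots> = 4 * (sin ((s - t) / 2))\<^sup>2"
  proof -
    define z where "z = (s - t) / 2"
    have "s - t = 2 * z" by (simp add: z_def)
    then show ?thesis by (simp add: cos_double_sin)
  qed
  also have "\<dots> \<le> 4 * \<bar>(s - t) / 2\<bar>\<^sup>2"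
    using power_mono[OF abs_sin_x_le_abs_x abs_ge_zero, of "(s - t) / 2" 2] by simp
  also have "\<dots> = \<bar>s - t\<bar>\<^sup>2" by (simp add: power2_eq_square)
  finally show ?thesis by (rule power2_le_imp_le) simp
qed

lemma unit_dir_surj:
  assumes "norm w = 1"
  obtains t where "\<phi> \<le> t" "t < \<phi> + 2 * pi" "w = unit_dir t"
proof -
  have "(w $ 1)\<^sup>2 + (w $ 2)\<^sup>2 = 1"
    using assms by (simp add: norm_vec_def L2_set_def sum_2)
  then obtain s where s: "w $ 1 = cos s" "w $ 2 = sin s" by (metis sincos_total_2pi)
  define k where "k = \<lfloor>(s - \<phi>) / (2 * pi)\<rfloor>"
  define t where "t = s - 2 * pi * of_int k"
  have "w = unit_dir s" using s by (simp add: vec_eq_iff forall_2)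
  also have "\<dots> = unit_dir t"
    by (simp add: t_def vec_eq_iff forall_2 cos_diff sin_diff cos_int_2pin sin_int_2pin)
  finally have "w = unit_dir t" .
  moreover have "of_int k \<le> (s - \<phi>) / (2 * pi)" "(s - \<phi>) / (2 * pi) < of_int k + 1"
    by (auto simp: k_def)
  then have "\<phi> \<le> t" "t < \<phi> + 2 * pi" by (auto simp: t_def field_simps)
  ultimately show ?thesis using that by blast
qed

definition circle_pt :: "real^2 \<Rightarrow> real \<Rightarrow> real \<Rightarrow> real^2" where
  "circle_pt x r t = x + r *\<^sub>R unit_dir t"

lemma circle_pt_2pi: "circle_pt x r (t + 2 * pi) = circle_pt x r t"
  by (simp add: circle_pt_def unit_dir_2pi)

lemma dist_circle_pt_le:
  assumes "0 \<le> r" shows "dist (circle_pt x r s) (circle_pt x r t) \<le> r * \<bar>s - t\<bar>"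
  using mult_left_mono[OF dist_unit_dir_le assms, of s t] assms
  by (simp add: circle_pt_def dist_norm flip: scaleR_diff_right)

lemma circle_pt_surj:
  assumes "0 < r" "y \<in> sphere x r"
  obtains t where "\<phi> \<le> t" "t < \<phi> + 2 * pi" "y = circle_pt x r t"
proof -
  have "norm ((1 / r) *\<^sub>R (y - x)) = 1" using assms by (simp add: dist_norm norm_minus_commute)
  then obtain t where t: "\<phi> \<le> t" "t < \<phi> + 2 * pi" "(1 / r) *\<^sub>R (y - x) = unit_dir t"
    by (rule unit_dir_surj)
  have "r *\<^sub>R unit_dir t = y - x" unfolding t(3)[symmetric] using assms by simp
  then show ?thesis using that t by (simp add: circle_pt_def)
qed

lemma hausdorff1_arc_le:
  assumes A: "A \<subseteq> circle_pt x r ` {a..b}" and r: "0 \<le> r" and ab: "a \<le> b"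
  shows "hausdorff1 A \<le> ennreal (r * (b - a))"
  unfolding hausdorff1_def
proof (rule SUP_least)
  fix d :: ennreal assume "d \<in> {0<..}"
  then have "0 < d" by simp
  then obtain \<delta> where \<delta>: "0 < \<delta>" "ennreal \<delta> \<le> d"
    by (cases d) (auto intro: that[of 1])
  define N where "N = nat \<lceil>r * (b - a) / \<delta>\<rceil> + 1"
  define h where "h = (b - a) / N"
  have N: "0 < real N" "r * (b - a) / \<delta> \<le> N" by (auto simp: N_def) linarith
  have h0: "0 \<le> h" using ab N by (simp add: h_def)
  have rh: "r * h \<le> \<delta>" using N \<delta> by (simp add: h_def field_simps)
  define U where "U = (\<lambda>i::nat. if i < N then circle_pt x r ` {a + i * h .. a + (i + 1) * h} else {})"
  have diam: "ediameter (U i) \<le> ennreal (r * h)" if iN: "i < N" for i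
  proof (rule ediameter_le)
    fix p q assume "p \<in> U i" "q \<in> U i"
    then obtain s t where st: "p = circle_pt x r s" "q = circle_pt x r t"
      "s \<in> {a + i * h .. a + (i + 1) * h}" "t \<in> {a + i * h .. a + (i + 1) * h}"
      unfolding U_def if_P[OF iN] by blast
    then have "\<bar>s - t\<bar> \<le> h" by (auto simp: algebra_simps abs_le_iff)
    then show "dist p q \<le> r * h"
      using dist_circle_pt_le[OF r, of x s t] st mult_left_mono[of "\<bar>s - t\<bar>" h r] r by simp
  qed
  have U0: "ediameter (U i) = 0" if "\<not> i < N" for i
    using that by (simp add: U_def ediameter_def bot_ennreal)
  have cover: "A \<subseteq> (\<Union>i. U i)"
  proof
    fix y assume "y \<in> A"
    then have "y \<in> circle_pt x r ` {a..b}" using A by blast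
    then obtain t where t: "a \<le> t" "t \<le> b" "y = circle_pt x r t" by auto
    show "y \<in> (\<Union>i. U i)"
    proof (cases "t = b")
      case True
      \<comment> \<open>The floor formula below would give the right end point the index
        \<open>N\<close>; it goes to the last piece instead.\<close>
      have "a + (real (N - 1) + 1) * h = b" "a + real (N - 1) * h \<le> b"
        using N h0 ab by (auto simp: h_def of_nat_diff field_simps)
      then have "y \<in> U (N - 1)" using True t N by (auto simp: U_def add_ac)
      then show ?thesis by blast
    next
      case False
      then have tb: "t < b" "0 < h" using t N by (auto simp: h_def)
      define i where "i = nat \<lfloor>(t - a) / h\<rfloor>"
      have i: "real i \<le> (t - a) / h" "(t - a) / h < real i + 1" using t tb by (auto simp: i_def)
      have "(t - a) / h < N" using tb N by (simp add: h_def field_simps)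
      then have "i < N" using i by linarith
      then have "y \<in> U i" using i t tb by (auto simp: U_def field_simps)
      then show ?thesis by blast
    qed
  qed
  have "hausdorff1_content d A \<le> (\<Sum>i. ediameter (U i))"
    unfolding hausdorff1_content_def
  proof (rule INF_lower, safe)
    fix y assume "y \<in> A" then show "y \<in> (\<Union>i. U i)" using cover by blast
  next
    fix i show "ediameter (U i) \<le> d"
    proof (cases "i < N")
      case True
      have "ediameter (U i) \<le> ennreal (r * h)" by (rule diam[OF True])
      also have "\<dots> \<le> ennreal \<delta>" using rh by (rule ennreal_leI)
      finally show ?thesis using \<delta>(2) by simp
    qed (simp add: U0)
  qed
  also have "\<dots> = (\<Sum>i<N. ediameter (U i))" using U0 by (intro suminf_finite) auto
  also have "\<dots> \<le> (\<Sum>i<N. ennreal (r * h))" using diam by (intro sum_mono) auto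
  also have "\<dots> = ennreal (r * (b - a))"
    using N r h0 by (simp add: h_def ennreal_of_nat_eq_real_of_nat flip: ennreal_mult')
  finally show "hausdorff1_content d A \<le> ennreal (r * (b - a))" .
qed

text \<open>Geometrically: the line through the points of the circle at the angles
  \<open>\<phi>\<close> and \<open>m\<close> has normal direction \<open>(\<phi> + m) / 2\<close>
  and offset \<open>cos ((m - \<phi>) / 2)\<close>, and it separates the two open arcs between these
  points.\<close>

lemma cos_less_iff_arc:
  assumes "\<phi> < m" "m < \<phi> + 2 * pi"
  shows "\<phi> < t \<Longrightarrow> t < m \<Longrightarrow> cos ((m - \<phi>) / 2) < cos (t - (\<phi> + m) / 2)"
    and "m < t \<Longrightarrow> t < \<phi> + 2 * pi \<Longrightarrow> cos (t - (\<phi> + m) / 2) < cos ((m - \<phi>) / 2)"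
proof -
  assume t: "\<phi> < t" "t < m"
  have "\<bar>t - (\<phi> + m) / 2\<bar> < (m - \<phi>) / 2" using t by (auto simp: abs_less_iff field_simps)
  then have "cos ((m - \<phi>) / 2) < cos \<bar>t - (\<phi> + m) / 2\<bar>"
    using assms by (intro cos_monotone_0_pi) auto
  then show "cos ((m - \<phi>) / 2) < cos (t - (\<phi> + m) / 2)" by simp
next
  assume t: "m < t" "t < \<phi> + 2 * pi"
  define y where "y = t - (\<phi> + m) / 2"
  have "\<bar>pi - y\<bar> < pi - (m - \<phi>) / 2" using t by (auto simp: y_def abs_less_iff field_simps)
  then have "cos (pi - (m - \<phi>) / 2) < cos \<bar>pi - y\<bar>"
    using assms by (intro cos_monotone_0_pi) auto
  then show "cos (t - (\<phi> + m) / 2) < cos ((m - \<phi>) / 2)" by (simp add: y_def)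
qed

text \<open>If an angle \<open>m\<close> were missing between two angles of \<open>A\<close>, the
  line through the points at \<open>\<phi>\<close> and \<open>m\<close>, both outside
  \<open>A\<close>, would disconnect \<open>A\<close>. The end points may or may not belong to
  \<open>A\<close>, hence the closed interval on one side and the open one on the other.\<close>

lemma connected_arc_interval:
  assumes conn: "connected A" and A: "A \<subseteq> sphere x r" and r: "0 < r" and \<phi>: "circle_pt x r \<phi> \<notin> A"
  obtains a b where "\<phi> \<le> a" "a \<le> b" "b \<le> \<phi> + 2 * pi"
    "A \<subseteq> circle_pt x r ` {a..b}" "circle_pt x r ` {a<..<b} \<subseteq> A"
proof (cases "A = {}")
  case True then show ?thesis using that[of \<phi> \<phi>] by simp
next
  case False
  define T where "T = {t. \<phi> < t \<and> t < \<phi> + 2 * pi \<and> circle_pt x r t \<in> A}"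
  have AT: "\<exists>t\<in>T. y = circle_pt x r t" if yA: "y \<in> A" for y
  proof -
    have "y \<in> sphere x r" using yA A by blast
    then obtain t where t: "\<phi> \<le> t" "t < \<phi> + 2 * pi" "y = circle_pt x r t"
      by (rule circle_pt_surj[OF r])
    then have "t \<noteq> \<phi>" using \<phi> yA by auto
    then have "t \<in> T" using t yA by (simp add: T_def)
    then show ?thesis using t(3) by blast
  qed
  have T: "T \<noteq> {}" "bdd_below T" "bdd_above T"
    using False AT by (auto simp: T_def intro!: bdd_belowI[of _ \<phi>] bdd_aboveI[of _ "\<phi> + 2 * pi"])
  have between: "m \<in> T" if st: "s \<in> T" "t \<in> T" "s < m" "m < t" for s t m
  proof (rule ccontr)
    assume "m \<notin> T"
    then have mA: "circle_pt x r m \<notin> A" and m: "\<phi> < m" "m < \<phi> + 2 * pi"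
      using st by (auto simp: T_def)
    define n where "n = unit_dir ((\<phi> + m) / 2)"
    define c where "c = cos ((m - \<phi>) / 2)"
    define V where "V = {y. n \<bullet> y < n \<bullet> x + r * c}"
    define W where "W = {y. n \<bullet> x + r * c < n \<bullet> y}"
    have ip: "n \<bullet> circle_pt x r u = n \<bullet> x + r * cos (u - (\<phi> + m) / 2)" for u
      by (simp add: n_def circle_pt_def inner_add_right inner_unit_dir cos_minus[symmetric, of "u - _"] del: cos_minus)
    have inW: "circle_pt x r u \<in> W" if "\<phi> < u" "u < m" for u
      using cos_less_iff_arc(1)[OF m that] r by (simp add: W_def ip c_def)
    have inV: "circle_pt x r u \<in> V" if "m < u" "u < \<phi> + 2 * pi" for u
      using cos_less_iff_arc(2)[OF m that] r by (simp add: V_def ip c_def)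
    have "A \<subseteq> V \<union> W"
    proof
      fix y assume y: "y \<in> A"
      then obtain u where u: "u \<in> T" "y = circle_pt x r u" using AT by blast
      have "u \<noteq> m" using u y mA by auto
      then show "y \<in> V \<union> W" using u inV[of u] inW[of u] by (cases u m rule: linorder_cases) (auto simp: T_def)
    qed
    moreover have "open V" "open W" unfolding V_def W_def
      by (auto intro!: open_Collect_less continuous_intros)
    moreover have "V \<inter> W \<inter> A = {}" by (auto simp: V_def W_def)
    ultimately have "V \<inter> A = {} \<or> W \<inter> A = {}" using connectedD[OF conn] by blast
    moreover have "circle_pt x r s \<in> W \<inter> A" using st inW[of s] by (auto simp: T_def)
    moreover have "circle_pt x r t \<in> V \<inter> A" using st inV[of t] by (auto simp: T_def)
    ultimately show False by blast
  qed
  define a where "a = Inf T"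
  define b where "b = Sup T"
  have abT: "a \<le> t" "t \<le> b" if "t \<in> T" for t
    using that T by (auto simp: a_def b_def intro: cInf_lower cSup_upper)
  have "\<phi> \<le> a" unfolding a_def using T by (intro cInf_greatest) (auto simp: T_def)
  moreover have "b \<le> \<phi> + 2 * pi" unfolding b_def using T by (intro cSup_least) (auto simp: T_def)
  moreover have "a \<le> b" using T(1) abT by (meson all_not_in_conv order_trans)
  moreover have "A \<subseteq> circle_pt x r ` {a..b}"
  proof
    fix y assume "y \<in> A"
    then obtain t where "t \<in> T" "y = circle_pt x r t" using AT by blast
    then show "y \<in> circle_pt x r ` {a..b}" using abT by auto
  qed
  moreover have "circle_pt x r ` {a<..<b} \<subseteq> A"
  proof clarify
    fix m assume "m \<in> {a<..<b}"
    then have "\<exists>s\<in>T. s < m" "\<exists>t\<in>T. m < t"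
      using T by (auto simp: a_def b_def cInf_less_iff less_cSup_iff)
    then have "m \<in> T" using between by blast
    then show "circle_pt x r m \<in> A" by (simp add: T_def)
  qed
  ultimately show ?thesis using that by blast
qed

lemma hausdorff1_arc_off_grid:
  assumes conn: "connected A" and A: "A \<subseteq> sphere x r" and r: "0 < r" and N: "1 \<le> N"
    and off: "\<And>j. j < N \<Longrightarrow> circle_pt x r (2 * pi * real j / real N) \<notin> A"
  shows "hausdorff1 A \<le> ennreal (r * (2 * pi / real N))"
proof -
  have "circle_pt x r 0 \<notin> A" using off[of 0] N by simp
  then obtain a b where ab: "0 \<le> a" "a \<le> b" "b \<le> 0 + 2 * pi"
    "A \<subseteq> circle_pt x r ` {a..b}" "circle_pt x r ` {a<..<b} \<subseteq> A"
    using connected_arc_interval[OF conn A r] by metis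
  have "b - a \<le> 2 * pi / N"
  proof (rule ccontr)
    assume n: "\<not> b - a \<le> 2 * pi / N"
    define z where "z = a * N / (2 * pi)"
    \<comment> \<open>The first grid index strictly beyond \<open>a\<close>; its angle is at most
      one mesh width away.\<close>
    define j where "j = nat \<lfloor>z\<rfloor> + 1"
    have N0: "0 < real N" using N by simp
    have z0: "0 \<le> z" using ab by (simp add: z_def)
    have j: "z < j" "j \<le> z + 1" using z0 floor_correct[of z] by (simp_all add: j_def) linarith
    have az: "a = 2 * pi * z / N" using N0 by (simp add: z_def)
    have 1: "a < 2 * pi * j / N" unfolding az using j N0 by (simp add: divide_strict_right_mono)
    have "2 * pi * j / N \<le> 2 * pi * (z + 1) / N" using j N0 by (intro divide_right_mono mult_left_mono) auto
    also have "\<dots> = a + 2 * pi / N" unfolding az by (simp add: distrib_left add_divide_distrib)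
    finally have 2: "2 * pi * j / N < b" using n by simp
    then have "2 * pi * j / N < 2 * pi" using ab by simp
    then have "j < N" using N0 by (simp add: divide_less_eq)
    moreover have "circle_pt x r (2 * pi * j / N) \<in> A" using ab(5) 1 2 by auto
    ultimately show False using off by blast
  qed
  then have "r * (b - a) \<le> r * (2 * pi / N)" using r by (intro mult_left_mono) auto
  then show ?thesis
    using hausdorff1_arc_le[OF ab(4) _ ab(2)] r by (meson ennreal_leI less_imp_le order_trans)
qed

text \<open>\<open>arg_max\<close> is a choice and says nothing until the maximum is known to be
  attained. If some arc has measure above \<open>e > 0\<close>, every such arc contains one of
  finitely many equally spaced points. All arcs through a given point unite to a single arc, so the
  candidates are finitely many.\<close>

lemma longest_arc_is_arg_max:
  assumes r: "0 < r"
  shows "is_arg_max hausdorff1 (open_arc_in x r U) (longest_arc U x r)"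
proof -
  let ?P = "open_arc_in x r U"
  have P0: "?P {}" by (simp add: open_arc_in_def)
  have "\<exists>A. is_arg_max hausdorff1 ?P A"
  proof (cases "\<exists>B. ?P B \<and> 0 < hausdorff1 B")
    case False
    then show ?thesis using P0 by (intro exI[of _ "{}"]) (auto simp: is_arg_max_def not_less)
  next
    case True
    then obtain B where B: "?P B" "0 < hausdorff1 B" by blast
    obtain e where e: "0 < e" "ennreal e < hausdorff1 B"
    proof -
      obtain y where y: "0 < y" "y < hausdorff1 B" using dense[OF B(2)] by blast
      have "y < top" using y(2) top_greatest by (rule order.strict_trans2)
      then show ?thesis using that[of "enn2real y"] y by (simp add: enn2real_positive_iff)
    qed
    define N where "N = nat \<lceil>r * (2 * pi) / e\<rceil> + 1"
    have N: "1 \<le> N" "r * (2 * pi / N) \<le> e"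
    proof -
      show "1 \<le> N" by (simp add: N_def)
      have "r * (2 * pi) / e \<le> N" by (simp add: N_def) linarith
      then show "r * (2 * pi / N) \<le> e" using e by (simp add: N_def field_simps)
    qed
    define p where "p = (\<lambda>j. circle_pt x r (2 * pi * real j / real N))"
    define V where "V = (\<lambda>j. \<Union>{A. ?P A \<and> p j \<in> A})"
    have PV: "?P (V j)" for j
      unfolding open_arc_in_def V_def
      by (auto simp: open_arc_in_def intro!: openin_Union connected_Union)
    have meets: "\<exists>j<N. A \<subseteq> V j" if "?P A" "ennreal e < hausdorff1 A" for A
    proof -
      have A: "connected A" "A \<subseteq> sphere x r" using that by (auto simp: open_arc_in_def dest: openin_imp_subset)
      have "\<exists>j<N. p j \<in> A"
      proof (rule ccontr)
        assume "\<not> (\<exists>j<N. p j \<in> A)"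
        then have "hausdorff1 A \<le> ennreal (r * (2 * pi / real N))"
          using hausdorff1_arc_off_grid[OF A r N(1)] by (auto simp: p_def)
        also have "\<dots> \<le> ennreal e" using N by (intro ennreal_leI)
        finally show False using that by simp
      qed
      then show ?thesis using that by (auto simp: V_def)
    qed
    obtain j where j: "j < N" "\<And>i. i < N \<Longrightarrow> hausdorff1 (V i) \<le> hausdorff1 (V j)"
    proof -
      define S where "S = (\<lambda>i. hausdorff1 (V i)) ` {..<N}"
      have S: "finite S" "S \<noteq> {}" using N by (auto simp: S_def lessThan_empty_iff)
      obtain j where "j < N" "Max S = hausdorff1 (V j)" using Max_in[OF S] by (auto simp: S_def)
      then show ?thesis using that[of j] Max_ge[OF S(1)] by (auto simp: S_def)
    qed
    have big: "hausdorff1 A \<le> hausdorff1 (V j)" if "?P A" "ennreal e < hausdorff1 A" for A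
      using meets[OF that] j(2) hausdorff1_mono by (meson order_trans)
    have "hausdorff1 A \<le> hausdorff1 (V j)" if "?P A" for A
      using big[OF that] big[OF B(1) e(2)] e(2) by (cases "ennreal e < hausdorff1 A") (auto simp: not_less)
    then show ?thesis using PV by (intro exI[of _ "V j"]) (auto simp: is_arg_max_def not_less)
  qed
  then show ?thesis unfolding longest_arc_def arg_max_def by (rule someI_ex)
qed

section \<open>Circles split into half circles\<close>

text \<open>\<open>n\<close> points to the middle of the half circle in \<open>\<Omega>\<close>. The
  non-strict inequalities make both caps compact, so that by the tube lemma the condition is open in
  \<open>(x, r)\<close>.\<close>

definition half_split :: "(real^2) set \<Rightarrow> real \<Rightarrow> real^2 \<Rightarrow> real \<Rightarrow> bool" where
  "half_split \<Omega> \<kappa> x r \<longleftrightarrow> (\<exists>n. norm n = 1 \<and>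
     (\<forall>w. norm w = 1 \<longrightarrow> (\<kappa> \<le> n \<bullet> w \<longrightarrow> x + r *\<^sub>R w \<in> \<Omega>) \<and> (n \<bullet> w \<le> - \<kappa> \<longrightarrow> x + r *\<^sub>R w \<in> exterior \<Omega>)))"

lemma open_translated_compact_subset:
  fixes U :: "'a::real_normed_vector set"
  assumes "compact K" "open U"
  shows "open {p :: 'a \<times> real. \<forall>w\<in>K. fst p + snd p *\<^sub>R w \<in> U}"
proof (subst open_subopen, intro ballI)
  fix p :: "'a \<times> real" assume p: "p \<in> {p. \<forall>w\<in>K. fst p + snd p *\<^sub>R w \<in> U}"
  define W where "W = (\<lambda>q :: ('a \<times> real) \<times> 'a. fst (fst q) + snd (fst q) *\<^sub>R snd q) -` U"
  have "open W" unfolding W_def using assms(2) by (intro open_vimage continuous_intros)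
  moreover have "{p} \<times> K \<subseteq> W" using p by (auto simp: W_def)
  ultimately obtain X where X: "p \<in> X" "open X" "X \<times> K \<subseteq> W" using Elementary_Topology.tube_lemma[OF assms(1)] by metis
  have "X \<subseteq> {p. \<forall>w\<in>K. fst p + snd p *\<^sub>R w \<in> U}"
  proof
    fix q assume q: "q \<in> X"
    have "fst q + snd q *\<^sub>R w \<in> U" if "w \<in> K" for w
    proof -
      have "(q, w) \<in> W" using X(3) q that by blast
      then show ?thesis by (simp add: W_def)
    qed
    then show "q \<in> {p. \<forall>w\<in>K. fst p + snd p *\<^sub>R w \<in> U}" by blast
  qed
  then show "\<exists>T. open T \<and> p \<in> T \<and> T \<subseteq> {p. \<forall>w\<in>K. fst p + snd p *\<^sub>R w \<in> U}" using X by blast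
qed

lemma open_half_split:
  assumes "open \<Omega>"
  shows "open {p. half_split \<Omega> \<kappa> (fst p) (snd p)}"
proof -
  define K where "K = (\<lambda>n::real^2. sphere 0 1 \<inter> {w. \<kappa> \<le> n \<bullet> w})"
  define K' where "K' = (\<lambda>n::real^2. sphere 0 1 \<inter> {w. n \<bullet> w \<le> - \<kappa>})"
  have K: "compact (K n)" "compact (K' n)" for n
    unfolding K_def K'_def
    by (intro closed_Int_compact compact_Int_closed compact_sphere closed_Collect_le continuous_intros)+
  have ext: "open (exterior \<Omega>)" by (simp add: exterior_def open_Compl)
  have eq: "{p. half_split \<Omega> \<kappa> (fst p) (snd p)} =
    (\<Union>n\<in>sphere 0 1. {p. \<forall>w\<in>K n. fst p + snd p *\<^sub>R w \<in> \<Omega>} \<inter> {p. \<forall>w\<in>K' n. fst p + snd p *\<^sub>R w \<in> exterior \<Omega>})"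
    by (auto simp: half_split_def K_def K'_def)
  show ?thesis unfolding eq
    by (intro open_UN ballI open_Int open_translated_compact_subset K assms ext)
qed

text \<open>This is \<open>sin z \<le> z\<close> at
  \<open>z = pi / 2 - \<bar>y\<bar>\<close>.\<close>

lemma cos_ge_imp_abs_le:
  assumes "\<bar>y\<bar> \<le> pi" "0 < \<kappa>" "\<kappa> \<le> cos y"
  shows "\<bar>y\<bar> \<le> pi / 2 - \<kappa>"
proof (rule ccontr)
  assume n: "\<not> \<bar>y\<bar> \<le> pi / 2 - \<kappa>"
  have c: "cos y = sin (pi / 2 - \<bar>y\<bar>)" by (simp add: sin_diff)
  show False
  proof (cases "\<bar>y\<bar> \<le> pi / 2")
    case True
    then have "sin (pi / 2 - \<bar>y\<bar>) \<le> pi / 2 - \<bar>y\<bar>" by (intro sin_x_le_x) auto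
    then show False using c n assms by simp
  next
    case False
    have "0 \<le> sin (\<bar>y\<bar> - pi / 2)" using False assms by (intro sin_ge_zero) auto
    then have "sin (pi / 2 - \<bar>y\<bar>) \<le> 0" using sin_minus[of "\<bar>y\<bar> - pi / 2"] by simp
    then show False using c assms by simp
  qed
qed

text \<open>The two arcs are disjoint, so their midpoints are at least
  \<open>2 * q = pi - \<kappa> / 2\<close> apart in both directions around the circle, and
  \<open>m'\<close> differs from \<open>m + pi\<close> by at most \<open>\<kappa> / 2\<close>. The
  caps to be filled reach only \<open>pi / 2 - \<kappa>\<close> from \<open>m\<close> and
  \<open>m + pi\<close>, which leaves room for this shift and for the missing
  \<open>\<kappa> / 4\<close> of the arcs.\<close>

lemma half_split_if_opposite_arcs:
  assumes \<kappa>: "0 < \<kappa>" "\<kappa> \<le> 1"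
    and q: "q = pi / 2 - \<kappa> / 4"
    and U: "\<And>t. \<bar>t - m\<bar> < q \<Longrightarrow> circle_pt x r t \<in> \<Omega>"
    and V: "\<And>t. \<bar>t - m'\<bar> < q \<Longrightarrow> circle_pt x r t \<in> exterior \<Omega>"
    and m': "m \<le> m'" "m' < m + 2 * pi"
  shows "half_split \<Omega> \<kappa> x r"
proof -
  have disj: "\<Omega> \<inter> exterior \<Omega> = {}" using closure_subset[of \<Omega>] by (auto simp: exterior_def)
  have q0: "0 < q" using \<kappa> pi_gt3 by (simp add: q)
  have 1: "2 * q \<le> m' - m"
  proof (rule ccontr)
    assume "\<not> 2 * q \<le> m' - m"
    then have "\<bar>(m + m') / 2 - m\<bar> < q" "\<bar>(m + m') / 2 - m'\<bar> < q"
      using m' by (auto simp: abs_less_iff field_simps)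
    then show False using U V disj by blast
  qed
  have 2: "2 * q \<le> m + 2 * pi - m'"
  proof (rule ccontr)
    assume "\<not> 2 * q \<le> m + 2 * pi - m'"
    then have "\<bar>(m + 2 * pi + m') / 2 - 2 * pi - m\<bar> < q" "\<bar>(m + 2 * pi + m') / 2 - m'\<bar> < q"
      using m' by (auto simp: abs_less_iff field_simps)
    then show False
      using U V disj circle_pt_2pi[of x r "(m + 2 * pi + m') / 2 - 2 * pi"] by fastforce
  qed
  show ?thesis unfolding half_split_def
  proof (intro exI[of _ "unit_dir m"] conjI allI impI)
    fix w :: "real^2" assume w: "norm w = 1" and c: "\<kappa> \<le> unit_dir m \<bullet> w"
    obtain t where t: "m - pi \<le> t" "t < m - pi + 2 * pi" "w = unit_dir t" using w by (rule unit_dir_surj)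
    have "\<bar>m - t\<bar> \<le> pi / 2 - \<kappa>" using c t by (intro cos_ge_imp_abs_le) (auto simp: \<kappa> inner_unit_dir abs_le_iff)
    then have "\<bar>t - m\<bar> < q" using \<kappa> by (simp add: q abs_minus_commute)
    then show "x + r *\<^sub>R w \<in> \<Omega>" using U t by (simp add: circle_pt_def)
  next
    fix w :: "real^2" assume w: "norm w = 1" and c: "unit_dir m \<bullet> w \<le> - \<kappa>"
    obtain t where t: "m \<le> t" "t < m + 2 * pi" "w = unit_dir t" using w by (rule unit_dir_surj)
    have "cos (t - m - pi) = - cos (m - t)" by (simp add: cos_diff mult.commute)
    then have "\<bar>t - m - pi\<bar> \<le> pi / 2 - \<kappa>"
      using c t by (intro cos_ge_imp_abs_le) (auto simp: \<kappa> inner_unit_dir abs_le_iff)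
    then have "\<bar>t - m'\<bar> < q" using 1 2 \<kappa> by (simp add: q abs_less_iff abs_le_iff)
    then show "x + r *\<^sub>R w \<in> exterior \<Omega>" using V t by (simp add: circle_pt_def)
  qed simp
qed

text \<open>The upper bound for the measure of an arc suffices: large measure forces a long
  parameter interval, and \<open>m\<close> is its midpoint. The point \<open>y\<close> is where the
  circle is cut open.\<close>

lemma arc_of_large_hausdorff1:
  assumes A: "open_arc_in x r U A" and r: "0 < r" and y: "y \<in> sphere x r" "y \<notin> A"
    and big: "(pi - e) * r < enn2real (hausdorff1 A)" and e: "e < pi"
  obtains m where "\<And>t. \<bar>t - m\<bar> < (pi - e) / 2 \<Longrightarrow> circle_pt x r t \<in> U"
proof -
  have A': "connected A" "A \<subseteq> sphere x r" "A \<subseteq> U"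
    using A by (auto simp: open_arc_in_def dest: openin_imp_subset)
  obtain \<phi> where "circle_pt x r \<phi> = y" using circle_pt_surj[OF r y(1)] by metis
  then obtain a b where ab: "a \<le> b" "A \<subseteq> circle_pt x r ` {a..b}" "circle_pt x r ` {a<..<b} \<subseteq> A"
    using connected_arc_interval[OF A'(1,2) r] y(2) by metis
  have "hausdorff1 A \<le> ennreal (r * (b - a))" using hausdorff1_arc_le[OF ab(2) _ ab(1)] r by simp
  then have "enn2real (hausdorff1 A) \<le> r * (b - a)" using r ab(1) by (intro enn2real_leI) auto
  then have "(pi - e) * r < (b - a) * r" using big by (simp add: mult.commute)
  then have "pi - e < b - a" using r by simp
  then have "circle_pt x r t \<in> U" if "\<bar>t - (a + b) / 2\<bar> < (pi - e) / 2" for t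
    using that ab(3) A'(3) by (force simp: abs_less_iff field_simps)
  then show ?thesis using that by blast
qed

lemma eps_coeff_less_imp_half_split:
  assumes r: "0 < r" and \<kappa>: "0 < \<kappa>" "\<kappa> \<le> 1" and eps: "eps_coeff \<Omega> x r < \<kappa> / 2"
  shows "half_split \<Omega> \<kappa> x r"
proof -
  let ?I = "longest_arc \<Omega> x r" and ?J = "longest_arc (exterior \<Omega>) x r"
  let ?e = "\<kappa> / 2"
  have arcs: "open_arc_in x r \<Omega> ?I" "open_arc_in x r (exterior \<Omega>) ?J"
    using longest_arc_is_arg_max[OF r] by (auto simp: is_arg_max_def)
  have sub: "?I \<subseteq> sphere x r" "?J \<subseteq> sphere x r" "?I \<subseteq> \<Omega>" "?J \<subseteq> exterior \<Omega>"
    using arcs by (auto simp: open_arc_in_def dest: openin_imp_subset)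
  have disj: "\<Omega> \<inter> exterior \<Omega> = {}" using closure_subset[of \<Omega>] by (auto simp: exterior_def)
  have e: "?e < pi" "0 < pi - ?e" using \<kappa> pi_gt3 by auto
  have "max \<bar>pi * r - enn2real (hausdorff1 ?I)\<bar> \<bar>pi * r - enn2real (hausdorff1 ?J)\<bar> < ?e * r"
    using eps r by (simp add: eps_coeff_def field_simps)
  then have big: "(pi - ?e) * r < enn2real (hausdorff1 ?I)" "(pi - ?e) * r < enn2real (hausdorff1 ?J)"
    unfolding max_less_iff_conj left_diff_distrib by linarith+
  have ne: "A \<noteq> {}" if "(pi - ?e) * r < enn2real (hausdorff1 A)" for A :: "(real^2) set"
  proof
    assume "A = {}"
    moreover have "hausdorff1 ({} :: (real^2) set) \<le> ennreal (1 * (0 - 0))"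
      by (rule hausdorff1_arc_le) auto
    ultimately show False using that mult_pos_pos[OF e(2) r] by simp
  qed
  \<comment> \<open>Both arcs are nonempty and lie in disjoint sets, so each provides the point at
    which the circle is cut open for the other.\<close>
  obtain y where y: "y \<in> ?I" using ne[OF big(1)] by blast
  obtain y' where y': "y' \<in> ?J" using ne[OF big(2)] by blast
  obtain m where m: "\<And>t. \<bar>t - m\<bar> < (pi - ?e) / 2 \<Longrightarrow> circle_pt x r t \<in> \<Omega>"
    using arc_of_large_hausdorff1[OF arcs(1) r _ _ big(1) e(1), of y'] y' sub disj by blast
  obtain m0 where m0: "\<And>t. \<bar>t - m0\<bar> < (pi - ?e) / 2 \<Longrightarrow> circle_pt x r t \<in> exterior \<Omega>"
    using arc_of_large_hausdorff1[OF arcs(2) r _ _ big(2) e(1), of y] y sub disj by blast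
  obtain m' where m': "m \<le> m'" "m' < m + 2 * pi" "unit_dir m0 = unit_dir m'" using unit_dir_surj[of "unit_dir m0"] by (metis norm_unit_dir)
  have V: "circle_pt x r t \<in> exterior \<Omega>" if "\<bar>t - m'\<bar> < (pi - ?e) / 2" for t
  proof -
    have "cos m0 = cos m'" "sin m0 = sin m'" using m'(3) by (metis unit_dir_nth)+
    then have "unit_dir (s + m0) = unit_dir (s + m')" for s by (simp add: unit_dir_def cos_add sin_add)
    from this[of "t - m'"] have "circle_pt x r (t - m' + m0) = circle_pt x r t" by (simp add: circle_pt_def)
    then show ?thesis using m0[of "t - m' + m0"] that by simp
  qed
  show ?thesis
    by (rule half_split_if_opposite_arcs[OF \<kappa> refl _ _ m'(1,2)])
       (use m V in \<open>auto simp: field_simps\<close>)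
qed

section \<open>Centres with few bad radii\<close>

definition bad_radii :: "(real^2) set \<Rightarrow> real \<Rightarrow> real \<Rightarrow> real^2 \<Rightarrow> real set" where
  "bad_radii \<Omega> \<kappa> R x = {r \<in> {0<..<R}. \<not> half_split \<Omega> \<kappa> x r}"

lemma bad_radii_measurable:
  assumes "open \<Omega>"
  shows "bad_radii \<Omega> \<kappa> R x \<in> sets borel"
    and "(\<lambda>x. emeasure lborel (bad_radii \<Omega> \<kappa> R x)) \<in> borel_measurable borel"
proof -
  define Q where "Q = {p :: (real^2) \<times> real. \<not> half_split \<Omega> \<kappa> (fst p) (snd p)} \<inter> UNIV \<times> {0<..<R}"
  have "open {p. half_split \<Omega> \<kappa> (fst p) (snd p)}" by (rule open_half_split[OF assms])
  then have "Q \<in> sets borel" unfolding Q_def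
    by (intro sets.Int borel_closed borel_open open_Times) (simp_all add: closed_def Collect_neg_eq)
  then have Q: "Q \<in> sets (borel \<Otimes>\<^sub>M lborel)"
    by (metis borel_prod sets_lborel sets_pair_measure_cong)
  have eq: "Pair x -` Q = bad_radii \<Omega> \<kappa> R x" for x by (auto simp: Q_def bad_radii_def)
  show "bad_radii \<Omega> \<kappa> R x \<in> sets borel" using sets_Pair1[OF Q, of x] by (simp add: eq)
  show "(\<lambda>x. emeasure lborel (bad_radii \<Omega> \<kappa> R x)) \<in> borel_measurable borel"
    using sigma_finite_measure.measurable_emeasure_Pair[OF sigma_finite_lborel Q] by (simp add: eq)
qed

text \<open>
  The coefficient \<open>eps_coeff\<close> is not known to be measurable, but \<open>half_split\<close> is an open condition, and a
  lower bound on its Borel complement is all that is needed.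
\<close>

lemma bad_radii_le_integral:
  assumes \<Omega>: "open \<Omega>" and \<kappa>: "0 < \<kappa>" "\<kappa> \<le> 1" and R: "0 < R"
  shows "ennreal (\<kappa>\<^sup>2 / (4 * R)) * emeasure lborel (bad_radii \<Omega> \<kappa> R x)
    \<le> (\<integral>\<^sup>+r \<in> {0<..<R}. ennreal (((eps_coeff \<Omega> x r)\<^sup>2 + (alpha_coeff \<Omega> x r)\<^sup>2) / r) \<partial>lborel)"
proof -
  have "ennreal (\<kappa>\<^sup>2 / (4 * R)) * emeasure lborel (bad_radii \<Omega> \<kappa> R x)
      = (\<integral>\<^sup>+r. ennreal (\<kappa>\<^sup>2 / (4 * R)) * indicator (bad_radii \<Omega> \<kappa> R x) r \<partial>lborel)"
    using bad_radii_measurable(1)[OF \<Omega>] by (subst nn_integral_cmult_indicator) auto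
  also have "\<dots> \<le> (\<integral>\<^sup>+r \<in> {0<..<R}. ennreal (((eps_coeff \<Omega> x r)\<^sup>2 + (alpha_coeff \<Omega> x r)\<^sup>2) / r) \<partial>lborel)"
  proof (rule nn_integral_mono)
    fix r :: real
    show "ennreal (\<kappa>\<^sup>2 / (4 * R)) * indicator (bad_radii \<Omega> \<kappa> R x) r
      \<le> ennreal (((eps_coeff \<Omega> x r)\<^sup>2 + (alpha_coeff \<Omega> x r)\<^sup>2) / r) * indicator {0<..<R} r"
    proof (cases "r \<in> bad_radii \<Omega> \<kappa> R x")
      case True
      then have r: "0 < r" "r < R" and n: "\<not> half_split \<Omega> \<kappa> x r" by (auto simp: bad_radii_def)
      have "\<kappa> / 2 \<le> eps_coeff \<Omega> x r" using eps_coeff_less_imp_half_split[OF r(1) \<kappa>, of \<Omega> x] n by linarith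
      then have "(\<kappa> / 2)\<^sup>2 \<le> (eps_coeff \<Omega> x r)\<^sup>2" using \<kappa> by (intro power_mono) auto
      then have "\<kappa>\<^sup>2 / 4 \<le> (eps_coeff \<Omega> x r)\<^sup>2 + (alpha_coeff \<Omega> x r)\<^sup>2"
        by (simp add: power_divide add_increasing2)
      then have "\<kappa>\<^sup>2 / 4 / R \<le> ((eps_coeff \<Omega> x r)\<^sup>2 + (alpha_coeff \<Omega> x r)\<^sup>2) / r"
        using r by (intro frac_le) auto
      then show ?thesis using True r by (simp add: ennreal_leI)
    qed simp
  qed
  finally show ?thesis .
qed

text \<open>The Markov inequality is applied to the Borel function \<open>g\<close>; the
  coefficients enter only through monotonicity of the integral. Linear growth replaces the measure
  of the ball by \<open>R\<close>, and \<open>c = \<kappa>\<^sup>2 / (4 * R)\<close> contributes the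
  other factor \<open>R\<close>.\<close>

lemma emeasure_bad_centres_le:
  assumes \<Omega>: "open \<Omega>" and \<mu>: "sets \<mu> = sets borel" "linear_growth 1 \<mu>"
    and \<kappa>: "0 < \<kappa>" "\<kappa> \<le> 1" and R: "0 < R" and \<eta>: "0 < \<eta>" and \<delta>: "0 \<le> \<delta>"
    and small: "(\<integral>\<^sup>+x \<in> ball z R. (\<integral>\<^sup>+r \<in> {0<..<R}.
        ennreal (((eps_coeff \<Omega> x r)\<^sup>2 + (alpha_coeff \<Omega> x r)\<^sup>2) / r) \<partial>lborel) \<partial>\<mu>)
      \<le> ennreal \<delta> * emeasure \<mu> (ball z R)"
  shows "emeasure \<mu> {x \<in> ball z R. ennreal \<eta> \<le> emeasure lborel (bad_radii \<Omega> \<kappa> R x)}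
     \<le> ennreal (4 * \<delta> * R\<^sup>2 / (\<kappa>\<^sup>2 * \<eta>))"
proof -
  define g where "g = (\<lambda>x. emeasure lborel (bad_radii \<Omega> \<kappa> R x))"
  define c where "c = \<kappa>\<^sup>2 / (4 * R)"
  have c: "0 < c" using \<kappa> R by (simp add: c_def)
  have g: "g \<in> borel_measurable \<mu>"
    using bad_radii_measurable(2)[OF \<Omega>] measurable_cong_sets[OF \<mu>(1) refl] by (auto simp: g_def)
  have B: "ball z R \<in> sets \<mu>" by (simp add: \<mu>)
  have sp: "space \<mu> = UNIV" using sets_eq_imp_space_eq[OF \<mu>(1)] by simp
  have "{x \<in> ball z R. ennreal \<eta> \<le> g x} \<subseteq> {x \<in> ball z R. 1 \<le> ennreal (1 / (c * \<eta>)) * (ennreal c * g x)}"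
  proof safe
    fix x assume "ennreal \<eta> \<le> g x"
    then have "ennreal (1 / (c * \<eta>)) * (ennreal c * ennreal \<eta>) \<le> ennreal (1 / (c * \<eta>)) * (ennreal c * g x)"
      by (intro mult_left_mono) auto
    moreover have "ennreal (1 / (c * \<eta>)) * (ennreal c * ennreal \<eta>) = 1"
      using c \<eta> by (simp flip: ennreal_mult)
    ultimately show "1 \<le> ennreal (1 / (c * \<eta>)) * (ennreal c * g x)" by simp
  qed
  moreover have "{x \<in> ball z R. 1 \<le> ennreal (1 / (c * \<eta>)) * (ennreal c * g x)} \<in> sets \<mu>"
  proof -
    have "{x \<in> space \<mu>. 1 \<le> ennreal (1 / (c * \<eta>)) * (ennreal c * g x)} \<in> sets \<mu>" using g by measurable
    then have "ball z R \<inter> {x \<in> space \<mu>. 1 \<le> ennreal (1 / (c * \<eta>)) * (ennreal c * g x)} \<in> sets \<mu>"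
      using B by blast
    then show ?thesis by (simp add: sp Int_def)
  qed
  ultimately have "emeasure \<mu> {x \<in> ball z R. ennreal \<eta> \<le> g x}
      \<le> emeasure \<mu> {x \<in> ball z R. 1 \<le> ennreal (1 / (c * \<eta>)) * (ennreal c * g x)}"
    by (rule emeasure_mono)
  also have "\<dots> \<le> ennreal (1 / (c * \<eta>)) * (\<integral>\<^sup>+x \<in> ball z R. ennreal c * g x \<partial>\<mu>)"
    by (rule nn_integral_Markov_inequality) (use g B in auto)
  also have "\<dots> \<le> ennreal (1 / (c * \<eta>)) * (ennreal \<delta> * emeasure \<mu> (ball z R))"
  proof (intro mult_left_mono order_trans[OF _ small] nn_integral_mono mult_right_mono)
    fix x show "ennreal c * g x \<le> (\<integral>\<^sup>+r \<in> {0<..<R}.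
        ennreal (((eps_coeff \<Omega> x r)\<^sup>2 + (alpha_coeff \<Omega> x r)\<^sup>2) / r) \<partial>lborel)"
      unfolding c_def g_def by (rule bad_radii_le_integral[OF \<Omega> \<kappa> R])
  qed auto
  also have "\<dots> \<le> ennreal (1 / (c * \<eta>)) * (ennreal \<delta> * ennreal (1 * R))"
    using \<mu>(2) R by (intro mult_left_mono) (auto simp: linear_growth_def)
  also have "\<dots> = ennreal (4 * \<delta> * R\<^sup>2 / (\<kappa>\<^sup>2 * \<eta>))"
  proof -
    have "1 / (c * \<eta>) * (\<delta> * (1 * R)) = 4 * \<delta> * R\<^sup>2 / (\<kappa>\<^sup>2 * \<eta>)"
      using \<kappa> R \<eta> by (simp add: c_def field_simps power2_eq_square)
    moreover have "ennreal (1 / (c * \<eta>)) * (ennreal \<delta> * ennreal (1 * R)) = ennreal (1 / (c * \<eta>) * (\<delta> * (1 * R)))"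
    proof -
      have "ennreal \<delta> * ennreal (1 * R) = ennreal (\<delta> * (1 * R))"
        using \<delta> R by (intro ennreal_mult[symmetric]) auto
      moreover have "ennreal (1 / (c * \<eta>)) * ennreal (\<delta> * (1 * R)) = ennreal (1 / (c * \<eta>) * (\<delta> * (1 * R)))"
        using \<delta> R c \<eta> by (intro ennreal_mult[symmetric]) auto
      ultimately show ?thesis by (simp only:)
    qed
    ultimately show ?thesis by simp
  qed
  finally show ?thesis by (simp add: g_def)
qed

text \<open>Cover the ball by \<open>M\<close> balls of radius \<open>d0 * \<rho> / 2\<close>. Two
  points of \<open>E\<close> in one of them are at distance below \<open>d0 * \<rho>\<close>;
  without a pair as required they are then closer than \<open>d1 * \<rho>\<close>, and linear growth
  bounds each piece by \<open>d1 * \<rho>\<close>. The pieces add up to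
  \<open>\<theta> * \<rho> / 2\<close> by the choice of \<open>d1\<close>, too little for
  \<open>E\<close>.\<close>

lemma separated_pair_exists:
  fixes \<theta> d0 :: real
  assumes \<theta>: "0 < \<theta>" and d0: "0 < d0"
  obtains d1 where "0 < d1"
    "\<And>\<mu> (z :: real^2) \<rho> E. linear_growth 1 \<mu> \<Longrightarrow> sets \<mu> = sets borel \<Longrightarrow> E \<in> sets borel \<Longrightarrow>
       E \<subseteq> ball z \<rho> \<Longrightarrow> 0 < \<rho> \<Longrightarrow> ennreal (\<theta> * \<rho>) \<le> emeasure \<mu> E \<Longrightarrow>
       \<exists>x\<in>E. \<exists>x'\<in>E. d1 * \<rho> \<le> dist x x' \<and> dist x x' \<le> d0 * \<rho>"
proof -
  have "\<forall>e>0. \<exists>k. finite k \<and> cball (0 :: real^2) 1 \<subseteq> (\<Union>x\<in>k. ball x e)"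
    using compact_cball[of "0 :: real^2" 1] unfolding compact_eq_totally_bounded by (rule conjunct2)
  moreover have "0 < d0 / 2" using d0 by simp
  ultimately obtain F where F: "finite F" "cball (0 :: real^2) 1 \<subseteq> (\<Union>f\<in>F. ball f (d0 / 2))"
    by blast
  define M where "M = card F"
  have M: "0 < M" using F by (auto simp: M_def card_gt_0_iff)
  define d1 where "d1 = \<theta> / (2 * M)"
  have d1: "0 < d1" using \<theta> M by (simp add: d1_def)
  show ?thesis
  proof (rule that[OF d1], rule ccontr)
    fix \<mu> and z :: "real^2" and \<rho> E
    assume \<mu>: "linear_growth 1 \<mu>" "sets \<mu> = sets borel" and E: "E \<in> sets borel" "E \<subseteq> ball z \<rho>"
      and \<rho>: "0 < \<rho>" and big: "ennreal (\<theta> * \<rho>) \<le> emeasure \<mu> E"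
      and no: "\<not> (\<exists>x\<in>E. \<exists>x'\<in>E. d1 * \<rho> \<le> dist x x' \<and> dist x x' \<le> d0 * \<rho>)"
    define C where "C = (\<lambda>f. E \<inter> ball (z + \<rho> *\<^sub>R f) (\<rho> * (d0 / 2)))"
    have C: "C f \<in> sets \<mu>" for f unfolding C_def \<mu> using E by auto
    have EC: "E \<subseteq> (\<Union>f\<in>F. C f)"
    proof
      fix x assume x: "x \<in> E"
      define y where "y = (1 / \<rho>) *\<^sub>R (x - z)"
      have xy: "x = z + \<rho> *\<^sub>R y" using \<rho> by (simp add: y_def)
      have "norm y \<le> 1" using x E(2) \<rho> by (auto simp: y_def dist_norm norm_minus_commute divide_simps)
      then obtain f where f: "f \<in> F" "dist f y < d0 / 2" using F(2) by force
      have "dist (z + \<rho> *\<^sub>R f) x = \<rho> * dist f y"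
        using \<rho> unfolding xy by (simp add: dist_norm flip: scaleR_diff_right)
      then have "x \<in> C f" using f \<rho> x by (simp add: C_def)
      then show "x \<in> (\<Union>f\<in>F. C f)" using f by blast
    qed
    have le: "emeasure \<mu> (C f) \<le> ennreal (d1 * \<rho>)" for f
    proof (cases "C f = {}")
      case False
      then obtain x where x: "x \<in> C f" by blast
      have "C f \<subseteq> ball x (d1 * \<rho>)"
      proof
        fix y assume y: "y \<in> C f"
        have "dist x y \<le> dist (z + \<rho> *\<^sub>R f) x + dist (z + \<rho> *\<^sub>R f) y" by (rule dist_triangle3)
        then have "dist x y \<le> d0 * \<rho>" using x y by (simp add: C_def mult.commute)
        moreover have "x \<in> E" "y \<in> E" using x y by (auto simp: C_def)
        ultimately have "\<not> d1 * \<rho> \<le> dist x y" using no by blast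
        then show "y \<in> ball x (d1 * \<rho>)" by simp
      qed
      then have "emeasure \<mu> (C f) \<le> emeasure \<mu> (ball x (d1 * \<rho>))" by (intro emeasure_mono) (auto simp: \<mu>)
      also have "\<dots> \<le> ennreal (1 * (d1 * \<rho>))" using \<mu>(1) d1 \<rho> by (simp add: linear_growth_def)
      finally show ?thesis by simp
    qed simp
    have "ennreal (\<theta> * \<rho>) \<le> emeasure \<mu> (\<Union>f\<in>F. C f)"
      using big EC C F(1) by (elim order_trans) (intro emeasure_mono sets.finite_UN, auto)
    also have "\<dots> \<le> (\<Sum>f\<in>F. emeasure \<mu> (C f))" using F(1) C by (intro emeasure_subadditive_finite) auto
    also have "\<dots> \<le> (\<Sum>f\<in>F. ennreal (d1 * \<rho>))" using le by (intro sum_mono)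
    also have "\<dots> = ennreal (M * (d1 * \<rho>))"
      using d1 \<rho> by (simp add: M_def ennreal_of_nat_eq_real_of_nat flip: ennreal_mult')
    also have "M * (d1 * \<rho>) = \<theta> * \<rho> / 2" using M by (simp add: d1_def)
    finally show False using \<theta> \<rho> by (simp add: ennreal_le_iff)
  qed
qed

text \<open>The constant is \<open>392 = 2 * 4 * 7\<^sup>2\<close>: with
  \<open>R = 7 * \<rho>\<close> and threshold \<open>\<eta> * \<rho>\<close> the bad centres take at
  most half of the mass \<open>\<theta> * \<rho>\<close>.\<close>

lemma good_centres_measure:
  assumes \<Omega>: "open \<Omega>" and \<mu>: "sets \<mu> = sets borel" "linear_growth 1 \<mu>" "supported_on \<mu> (frontier \<Omega>)"
    and \<kappa>: "0 < \<kappa>" "\<kappa> \<le> 1" and \<rho>: "0 < \<rho>" and \<eta>: "0 < \<eta>" and \<theta>: "0 < \<theta>"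
    and \<delta>: "0 \<le> \<delta>" "392 * \<delta> \<le> \<theta> * \<kappa>\<^sup>2 * \<eta>"
    and big: "ennreal (\<theta> * \<rho>) \<le> emeasure \<mu> (ball z \<rho>)"
    and small: "(\<integral>\<^sup>+x \<in> ball z (7 * \<rho>). (\<integral>\<^sup>+r \<in> {0<..<7 * \<rho>}.
        ennreal (((eps_coeff \<Omega> x r)\<^sup>2 + (alpha_coeff \<Omega> x r)\<^sup>2) / r) \<partial>lborel) \<partial>\<mu>)
      \<le> ennreal \<delta> * emeasure \<mu> (ball z (7 * \<rho>))"
  defines "E \<equiv> {x \<in> ball z \<rho> \<inter> frontier \<Omega>. emeasure lborel (bad_radii \<Omega> \<kappa> (7 * \<rho>) x) < ennreal (\<eta> * \<rho>)}"
  shows "E \<in> sets borel" "ennreal (\<theta> / 2 * \<rho>) \<le> emeasure \<mu> E"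
proof -
  define g where "g = (\<lambda>x. emeasure lborel (bad_radii \<Omega> \<kappa> (7 * \<rho>) x))"
  have g: "g \<in> borel_measurable borel" unfolding g_def by (rule bad_radii_measurable(2)[OF \<Omega>])
  have "E = ball z \<rho> \<inter> frontier \<Omega> \<inter> {x \<in> space borel. g x < ennreal (\<eta> * \<rho>)}" by (auto simp: E_def g_def)
  moreover have "{x \<in> space borel. g x < ennreal (\<eta> * \<rho>)} \<in> sets borel" using g by measurable
  ultimately show E: "E \<in> sets borel" by auto
  define Bad where "Bad = {x \<in> ball z (7 * \<rho>). ennreal (\<eta> * \<rho>) \<le> g x}"
  have "Bad = ball z (7 * \<rho>) \<inter> {x \<in> space borel. ennreal (\<eta> * \<rho>) \<le> g x}" by (auto simp: Bad_def)
  moreover have "{x \<in> space borel. ennreal (\<eta> * \<rho>) \<le> g x} \<in> sets borel" using g by measurable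
  ultimately have Bad: "Bad \<in> sets borel" by auto
  have "emeasure \<mu> Bad \<le> ennreal (4 * \<delta> * (7 * \<rho>)\<^sup>2 / (\<kappa>\<^sup>2 * (\<eta> * \<rho>)))"
    unfolding Bad_def g_def
    by (rule emeasure_bad_centres_le[OF \<Omega> \<mu>(1,2) \<kappa> _ _ \<delta>(1) small]) (use \<rho> \<eta> in auto)
  also have "4 * \<delta> * (7 * \<rho>)\<^sup>2 / (\<kappa>\<^sup>2 * (\<eta> * \<rho>)) \<le> \<theta> / 2 * \<rho>"
  proof -
    have "4 * \<delta> * (7 * \<rho>)\<^sup>2 = (392 * \<delta>) * (\<rho>\<^sup>2 / 2)" by (simp add: power2_eq_square)
    also have "\<dots> \<le> (\<theta> * \<kappa>\<^sup>2 * \<eta>) * (\<rho>\<^sup>2 / 2)" using \<delta>(2) by (intro mult_right_mono) auto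
    also have "\<dots> = \<theta> / 2 * \<rho> * (\<kappa>\<^sup>2 * (\<eta> * \<rho>))" by (simp add: power2_eq_square)
    finally show ?thesis using \<kappa> \<eta> \<rho> by (simp add: pos_divide_le_eq)
  qed
  finally have bad: "emeasure \<mu> Bad \<le> ennreal (\<theta> / 2 * \<rho>)" by (simp add: ennreal_leI)
  have "ball z \<rho> \<subseteq> E \<union> (Bad \<union> - frontier \<Omega>)"
    using \<rho> by (auto simp: E_def Bad_def g_def not_less)
  then have "emeasure \<mu> (ball z \<rho>) \<le> emeasure \<mu> (E \<union> (Bad \<union> - frontier \<Omega>))"
    using E Bad by (intro emeasure_mono) (auto simp: \<mu>)
  also have "\<dots> \<le> emeasure \<mu> E + emeasure \<mu> (Bad \<union> - frontier \<Omega>)"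
    using E Bad by (intro emeasure_subadditive) (auto simp: \<mu>)
  also have "emeasure \<mu> (Bad \<union> - frontier \<Omega>) \<le> emeasure \<mu> Bad + emeasure \<mu> (- frontier \<Omega>)"
    using Bad by (intro emeasure_subadditive) (auto simp: \<mu>)
  also have "\<dots> \<le> ennreal (\<theta> / 2 * \<rho>)" using bad \<mu>(3) by (simp add: supported_on_def)
  finally have le: "ennreal (\<theta> * \<rho>) \<le> emeasure \<mu> E + ennreal (\<theta> / 2 * \<rho>)"
    using big by (simp add: add_left_mono)
  show "ennreal (\<theta> / 2 * \<rho>) \<le> emeasure \<mu> E"
  proof (cases "emeasure \<mu> E")
    case (real m)
    have "emeasure \<mu> E + ennreal (\<theta> / 2 * \<rho>) = ennreal (m + \<theta> / 2 * \<rho>)"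
      unfolding real(2) by (rule ennreal_plus[symmetric]) (use real(1) \<theta> \<rho> in auto)
    then have "ennreal (\<theta> * \<rho>) \<le> ennreal (m + \<theta> / 2 * \<rho>)" using le by simp
    then have "\<theta> * \<rho> \<le> m + \<theta> / 2 * \<rho>" using real \<theta> \<rho> by (subst (asm) ennreal_le_iff) auto
    then show ?thesis unfolding real(2) by (intro ennreal_leI) linarith
  qed simp
qed

section \<open>Circles about two nearby centres\<close>

text \<open>The set and its exterior appear as predicates \<open>A\<close>, \<open>D\<close> on
  coordinates, so that reflected and translated copies are again of this form. Here
  \<open>\<kappa>\<close> is a distance from the diameter, not relative to the radius as in
  \<open>half_split\<close>.\<close>

definition split_circle :: "(real \<Rightarrow> real \<Rightarrow> bool) \<Rightarrow> (real \<Rightarrow> real \<Rightarrow> bool) \<Rightarrow> real \<Rightarrow> real \<Rightarrow> bool" where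
  "split_circle A D \<kappa> r \<longleftrightarrow> (\<exists>a b. a\<^sup>2 + b\<^sup>2 = 1 \<and>
     (\<forall>u v. u\<^sup>2 + v\<^sup>2 = r\<^sup>2 \<longrightarrow> (\<kappa> < a * u + b * v \<longrightarrow> A u v) \<and> (a * u + b * v < - \<kappa> \<longrightarrow> D u v)))"

text \<open>The mirror pair gives \<open>- \<kappa> \<le> a * u - \<bar>b\<bar> * H\<close>. This
  forces \<open>0 \<le> a\<close>, since otherwise
  \<open>(\<bar>a\<bar> + \<bar>b\<bar>) * m \<le> \<kappa>\<close> although
  \<open>1 \<le> \<bar>a\<bar> + \<bar>b\<bar>\<close>. Moving by \<open>m\<close> outwards and by
  \<open>m\<close> towards the axis then adds at least
  \<open>(a + \<bar>b\<bar>) * m \<ge> m > 2 * \<kappa>\<close>, which carries the pair across the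
  whole uncertain band.\<close>

lemma cap_pair_shrink_pos:
  fixes a b u H u' H' \<kappa> m :: real
  assumes unit: "a\<^sup>2 + b\<^sup>2 = 1" and \<kappa>: "0 \<le> \<kappa>" "2 * \<kappa> < m"
    and u: "m \<le> u" "u + m \<le> u'" and H: "m \<le> H" "H' + m \<le> H" "0 \<le> H'"
    and pm: "- \<kappa> \<le> a * u + b * H" "- \<kappa> \<le> a * u - b * H"
  shows "\<kappa> < a * u' + b * H'" "\<kappa> < a * u' - b * H'"
proof -
  have m0: "0 < m" using \<kappa> by linarith
  have pm': "\<bar>b\<bar> * H - \<kappa> \<le> a * u" using pm by (cases "b \<ge> 0") auto
  have one: "1 \<le> \<bar>a\<bar> + \<bar>b\<bar>"
  proof -
    have "1 \<le> (\<bar>a\<bar> + \<bar>b\<bar>)\<^sup>2" using unit by (simp add: power2_sum)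
    then show ?thesis
      by (metis abs_ge_zero abs_le_square_iff abs_of_nonneg abs_one add_nonneg_nonneg one_power2)
  qed
  have a0: "0 \<le> a"
  proof (rule ccontr)
    assume n: "\<not> 0 \<le> a"
    have "\<bar>b\<bar> * H + \<bar>a\<bar> * u \<le> \<kappa>" using pm' n by simp
    moreover have "\<bar>b\<bar> * m \<le> \<bar>b\<bar> * H" "\<bar>a\<bar> * m \<le> \<bar>a\<bar> * u"
      using u H by (auto intro!: mult_left_mono)
    moreover have "1 * m \<le> (\<bar>a\<bar> + \<bar>b\<bar>) * m" using one m0 by (intro mult_right_mono) auto
    ultimately show False using \<kappa> by (simp add: algebra_simps)
  qed
  have "a * u + a * m \<le> a * u'"
    using mult_left_mono[OF u(2) a0] by (simp add: algebra_simps)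
  moreover have "\<bar>b\<bar> * H' + \<bar>b\<bar> * m \<le> \<bar>b\<bar> * H"
    using mult_left_mono[OF H(2), of "\<bar>b\<bar>"] by (simp add: algebra_simps)
  moreover have "1 * m \<le> (a + \<bar>b\<bar>) * m" using one m0 a0 by (intro mult_right_mono) auto
  ultimately have "\<kappa> < a * u' - \<bar>b\<bar> * H'"
    using pm' \<kappa> by (simp add: algebra_simps)
  moreover have "\<bar>b\<bar> * H' \<ge> b * H'" "\<bar>b\<bar> * H' \<ge> - b * H'"
    using H(3) mult_right_mono[of b "\<bar>b\<bar>" H'] mult_right_mono[of "- b" "\<bar>b\<bar>" H'] by auto
  ultimately show "\<kappa> < a * u' + b * H'" "\<kappa> < a * u' - b * H'" by auto
qed

text \<open>Points of \<open>A\<close> are not in the cap belonging to \<open>D\<close>. After the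
  move both points of the pair are strictly inside the cap of \<open>A\<close>, so their antipodes
  are in the cap of \<open>D\<close>.\<close>

lemma split_circle_reflect:
  assumes sc: "split_circle A D \<kappa> r" and disj: "\<And>u v. \<not> (A u v \<and> D u v)"
    and \<kappa>: "0 \<le> \<kappa>" "2 * \<kappa> < m"
    and H: "m \<le> H" "H' + m \<le> H" "0 \<le> H'"
    and uu: "m \<le> u \<and> u + m \<le> u' \<or> u \<le> - m \<and> u' + m \<le> u"
    and r: "u\<^sup>2 + H\<^sup>2 = r\<^sup>2" "u'\<^sup>2 + H'\<^sup>2 = r\<^sup>2"
    and A: "A u H" "A u (- H)"
  shows "D (- u') H'" "D (- u') (- H')"
proof -
  obtain a b where ab: "a\<^sup>2 + b\<^sup>2 = 1"
    "\<And>u v. u\<^sup>2 + v\<^sup>2 = r\<^sup>2 \<Longrightarrow> \<kappa> < a * u + b * v \<Longrightarrow> A u v"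
    "\<And>u v. u\<^sup>2 + v\<^sup>2 = r\<^sup>2 \<Longrightarrow> a * u + b * v < - \<kappa> \<Longrightarrow> D u v"
    using sc unfolding split_circle_def by blast
  have pm: "- \<kappa> \<le> a * u + b * H" "- \<kappa> \<le> a * u - b * H"
    using ab(3)[of u H] ab(3)[of u "-H"] disj A r by force+
  have "\<kappa> < a * u' + b * H' \<and> \<kappa> < a * u' - b * H'"
    using uu
  proof
    assume "m \<le> u \<and> u + m \<le> u'"
    then show ?thesis using cap_pair_shrink_pos[OF ab(1) \<kappa> _ _ H pm] by auto
  next
    assume "u \<le> - m \<and> u' + m \<le> u"
    then show ?thesis
      using cap_pair_shrink_pos[of "-a" b \<kappa> m "-u" "-u'" H H'] ab(1) \<kappa> H pm by auto
  qed
  then show "D (- u') H'" "D (- u') (- H')"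
    using ab(3)[of "-u'" H'] ab(3)[of "-u'" "-H'"] r by auto
qed

text \<open>
  The reflections in the two centres are unfolded: the \<open>i\<close>-th circle is centred at \<open>(i d, 0)\<close>, and
  passing from it to the next one is a reflection in its centre, which is why \<open>A\<close> and \<open>D\<close> depend
  on \<open>i\<close>. On each circle the point is moved towards the axis by at least \<open>m\<close>, which absorbs the
  uncertainty \<open>\<kappa>\<close> in the position of the half circles. Points are handled in mirror pairs \<open>\<plusminus>H\<close>
  because two points of a half circle control the arc between them.
\<close>

lemma chain_propagation:
  fixes A D :: "nat \<Rightarrow> real \<Rightarrow> real \<Rightarrow> bool" and X H \<rho> :: "nat \<Rightarrow> real"
  assumes disj: "\<And>i u v. \<not> (A i u v \<and> D i u v)"
    and tr: "\<And>i u v. D i (- u) (- v) \<Longrightarrow> A (Suc i) (u - d) v"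
    and \<kappa>: "0 \<le> \<kappa>" "2 * \<kappa> < m"
    and split: "\<And>i. 1 \<le> i \<Longrightarrow> i < n \<Longrightarrow> split_circle (A i) (D i) \<kappa> (\<rho> i)"
    and on1: "\<And>i. 1 \<le> i \<Longrightarrow> i < n \<Longrightarrow> (X i - i * d)\<^sup>2 + (H i)\<^sup>2 = (\<rho> i)\<^sup>2"
    and on2: "\<And>i. 1 \<le> i \<Longrightarrow> i < n \<Longrightarrow> (X (Suc i) - i * d)\<^sup>2 + (H (Suc i))\<^sup>2 = (\<rho> i)\<^sup>2"
    and H: "\<And>i. 1 \<le> i \<Longrightarrow> i \<le> n \<Longrightarrow> m \<le> H i"
           "\<And>i. 1 \<le> i \<Longrightarrow> i < n \<Longrightarrow> H (Suc i) + m \<le> H i"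
    and X: "\<And>i. 1 \<le> i \<Longrightarrow> i < n \<Longrightarrow> m \<le> X i - i * d \<and> X i + m \<le> X (Suc i) \<or>
                                 X i - i * d \<le> - m \<and> X (Suc i) + m \<le> X i"
    and start: "A 1 (X 1 - d) (H 1)" "A 1 (X 1 - d) (- H 1)"
    and i: "1 \<le> i" "i \<le> n"
  shows "A i (X i - i * d) (H i) \<and> A i (X i - i * d) (- H i)"
  using i
proof (induction i rule: dec_induct)
  case base
  then show ?case using start by simp
next
  case (step i)
  have i: "1 \<le> i" "i < n" using step by auto
  have A: "A i (X i - i * d) (H i)" "A i (X i - i * d) (- H i)" using step by auto
  have m0: "0 < m" using \<kappa> by linarith
  have H0: "0 \<le> H (Suc i)" using H(1)[of "Suc i"] i m0 by auto
  have "m \<le> X i - i * d \<and> X i - i * d + m \<le> X (Suc i) - i * d \<or>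
        X i - i * d \<le> - m \<and> X (Suc i) - i * d + m \<le> X i - i * d"
    using X[OF i] by auto
  from split_circle_reflect[OF split[OF i] disj \<kappa> H(1)[OF i(1)] H(2)[OF i] H0 this on1[OF i] on2[OF i] A]
  have "D i (- (X (Suc i) - i * d)) (H (Suc i))" "D i (- (X (Suc i) - i * d)) (- H (Suc i))"
    using i by auto
  then have "A (Suc i) (X (Suc i) - i * d - d) (- H (Suc i))"
    "A (Suc i) (X (Suc i) - i * d - d) (H (Suc i))"
    using tr[of i "X (Suc i) - i * d" "- H (Suc i)"] tr[of i "X (Suc i) - i * d" "H (Suc i)"] by auto
  then show ?case by (simp add: algebra_simps)
qed

lemma cubic_second_difference:
  fixes T \<beta> x :: real
  defines "g \<equiv> \<lambda>x. - ((x - T) ^ 3) - T ^ 3 + \<beta> * x"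
  shows "g (x + 1) + g (x - 1) - 2 * g x = - 6 * (x - T)"
  unfolding g_def by (simp add: power3_eq_cube algebra_simps)

lemma abs_power3_le:
  fixes x T :: real
  assumes "\<bar>x\<bar> \<le> T"
  shows "\<bar>x ^ 3\<bar> \<le> T ^ 3"
  using power_mono[of "\<bar>x\<bar>" T 3] assms by (simp add: power_abs)

text \<open>
  The perturbation of the squared radii in the chain. The sign of its second difference must change
  where the unfolded centre passes the point, so that the intersections always move away from the
  current centre.
\<close>

lemma interpolating_cubic:
  fixes k :: nat
  assumes k: "1 \<le> k"
  obtains g :: "nat \<Rightarrow> real" where "g 0 = 0" "g (2 * k) = 0"
    "\<And>i. i \<le> 2 * k \<Longrightarrow> \<bar>g i\<bar> \<le> 4 * (real k + 1) ^ 3"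
    "\<And>i. 1 \<le> i \<Longrightarrow> i \<le> k \<Longrightarrow> 3 \<le> g (Suc i) + g (i - 1) - 2 * g i"
    "\<And>i. k < i \<Longrightarrow> g (Suc i) + g (i - 1) - 2 * g i \<le> - 3"
proof -
  \<comment> \<open>A half-integer, so that \<open>6 * \<bar>i - T\<bar> \<ge> 3\<close> at every
    integer and the sign changes between \<open>k\<close> and \<open>k + 1\<close>.\<close>
  define T :: real where "T = k + 1 / 2"
  \<comment> \<open>The slope that makes the cubic vanish at \<open>2 * k\<close>; an affine term
    does not affect second differences.\<close>
  define \<beta> where "\<beta> = (T ^ 3 + (T - 1) ^ 3) / (2 * k)"
  define G where "G = (\<lambda>x. - ((x - T) ^ 3) - T ^ 3 + \<beta> * x)"
  define g where "g = (\<lambda>i::nat. G (real i))"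
  have kT: "real k = T - 1 / 2" "1 \<le> real k" using k by (auto simp: T_def)
  have \<beta>k: "\<beta> * (2 * k) = T ^ 3 + (T - 1) ^ 3" using k by (simp add: \<beta>_def)
  have T13: "0 \<le> (T - 1) ^ 3" "(T - 1) ^ 3 \<le> T ^ 3"
    using kT by (auto intro!: power_mono zero_le_power)
  have g0: "g 0 = 0" by (simp add: g_def G_def power3_eq_cube)
  have g2k: "g (2 * k) = 0"
  proof -
    have e: "real (2 * k) - T = T - 1" using kT by simp
    have "G (real (2 * k)) = - ((T - 1) ^ 3) - T ^ 3 + \<beta> * (2 * k)"
      unfolding G_def e by simp
    then show ?thesis using \<beta>k by (simp add: g_def)
  qed
  have bd: "\<bar>g i\<bar> \<le> 4 * (real k + 1) ^ 3" if i: "i \<le> 2 * k" for i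
  proof -
    have ii: "real i \<le> 2 * k" using i by linarith
    have "\<bar>real i - T\<bar> \<le> T" using ii kT by (auto simp: abs_le_iff)
    then have 1: "\<bar>(real i - T) ^ 3\<bar> \<le> T ^ 3" by (rule abs_power3_le)
    have b0: "0 \<le> \<beta>" unfolding \<beta>_def using T13 kT by (auto intro!: divide_nonneg_nonneg)
    have "\<beta> * i \<le> \<beta> * (2 * k)" using ii b0 by (intro mult_left_mono) auto
    then have 2: "\<bar>\<beta> * i\<bar> \<le> 2 * T ^ 3"
      unfolding abs_of_nonneg[OF mult_nonneg_nonneg[OF b0 of_nat_0_le_iff]] using \<beta>k T13 by linarith
    have 3: "T ^ 3 \<le> (real k + 1) ^ 3" using kT by (intro power_mono) auto
    have "\<bar>g i\<bar> \<le> 4 * T ^ 3"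
      unfolding g_def G_def using 1 2 T13 by (auto simp: abs_le_iff)
    then show ?thesis using 3 by simp
  qed
  have sd: "g (Suc i) + g (i - 1) - 2 * g i = - 6 * (real i - T)" if "1 \<le> i" for i
  proof -
    have e: "real (Suc i) = real i + 1" "real (i - 1) = real i - 1" using that by auto
    show ?thesis unfolding g_def G_def e by (rule cubic_second_difference)
  qed
  show ?thesis
  proof (rule that[of g])
    fix i assume "1 \<le> i" "i \<le> k"
    then show "3 \<le> g (Suc i) + g (i - 1) - 2 * g i" using sd[of i] kT by simp
  next
    fix i assume "k < i"
    then have "1 \<le> i" "real i \<ge> real k + 1" by auto
    then show "g (Suc i) + g (i - 1) - 2 * g i \<le> - 3" using sd[of i] kT by simp
  qed (use g0 g2k bd in auto)
qed

lemma split_circle_minus: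
  assumes "split_circle A D \<kappa> r"
  shows "split_circle (\<lambda>u v. D (- u) (- v)) (\<lambda>u v. A (- u) (- v)) \<kappa> r"
proof -
  obtain a b where ab: "a\<^sup>2 + b\<^sup>2 = 1"
    "\<And>u v. u\<^sup>2 + v\<^sup>2 = r\<^sup>2 \<Longrightarrow> \<kappa> < a * u + b * v \<Longrightarrow> A u v"
    "\<And>u v. u\<^sup>2 + v\<^sup>2 = r\<^sup>2 \<Longrightarrow> a * u + b * v < - \<kappa> \<Longrightarrow> D u v"
    using assms unfolding split_circle_def by blast
  show ?thesis unfolding split_circle_def
    using ab(1) ab(2)[of "- _" "- _"] ab(3)[of "- _" "- _"]
    by (intro exI[of _ a] exI[of _ b]) (auto simp: algebra_simps)
qed

section \<open>Two circles tilted to the same side\<close>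

text \<open>A \<open>split_circle\<close> whose normal has component at least \<open>\<tau>\<close>
  along the axis: the half circle in \<open>A\<close> leans to the right. Exchanging
  \<open>A\<close> and \<open>D\<close> expresses leaning to the left.\<close>

definition tilted_split where
  "tilted_split A D \<kappa> \<tau> r \<longleftrightarrow> (\<exists>a b :: real. a\<^sup>2 + b\<^sup>2 = 1 \<and> \<tau> \<le> a \<and>
     (\<forall>u v :: real. u\<^sup>2 + v\<^sup>2 = r\<^sup>2 \<longrightarrow> (\<kappa> < a * u + b * v \<longrightarrow> A u v) \<and> (a * u + b * v < - \<kappa> \<longrightarrow> D u v)))"

lemma tilted_split_right:
  assumes "tilted_split A D \<kappa> \<tau> r" "u\<^sup>2 + v\<^sup>2 = r\<^sup>2" "\<kappa> + \<bar>v\<bar> < \<tau> * u" "0 \<le> u"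
  shows "A u v" "D (- u) v"
proof -
  obtain a b where ab: "a\<^sup>2 + b\<^sup>2 = 1" "\<tau> \<le> a"
    "\<And>u v. u\<^sup>2 + v\<^sup>2 = r\<^sup>2 \<Longrightarrow> \<kappa> < a * u + b * v \<Longrightarrow> A u v"
    "\<And>u v. u\<^sup>2 + v\<^sup>2 = r\<^sup>2 \<Longrightarrow> a * u + b * v < - \<kappa> \<Longrightarrow> D u v"
    using assms(1) unfolding tilted_split_def by blast
  have "b\<^sup>2 \<le> 1" using ab(1) zero_le_power2[of a] by linarith
  then have "\<bar>b\<bar> \<le> 1" by (simp add: abs_square_le_1)
  then have "\<bar>b\<bar> * \<bar>v\<bar> \<le> 1 * \<bar>v\<bar>" by (intro mult_right_mono) auto
  then have "\<bar>b * v\<bar> \<le> \<bar>v\<bar>" by (simp add: abs_mult)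
  moreover have "\<tau> * u \<le> a * u" using ab assms(4) by (intro mult_right_mono)
  ultimately have "\<kappa> < a * u + b * v" "a * (- u) + b * v < - \<kappa>" using assms(3) by auto
  then show "A u v" "D (- u) v" using ab(3,4)[of _ v] assms(2) by auto
qed

text \<open>
  Without perturbation all unfolded circles would pass through the point \<open>(s, h)\<close>, which lies on
  the right half of the first circle and, after \<open>2 k\<close> steps, on the left half of the last one.
\<close>

lemma tilted_pair_contradiction:
  fixes A D :: "real \<Rightarrow> real \<Rightarrow> bool" and k :: nat and c d h s \<sigma> \<Delta> \<kappa> \<tau> r0 r1 :: real
  assumes disj: "\<And>u v. \<not> (A u v \<and> D u v)"
    and dense0: "\<And>lo hi. 0 < lo \<Longrightarrow> hi \<le> 16 \<Longrightarrow> lo + c / 2 \<le> hi \<Longrightarrow>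
       \<exists>r. lo \<le> r\<^sup>2 \<and> r\<^sup>2 \<le> hi \<and> split_circle A D \<kappa> r"
    and dense1: "\<And>lo hi. 0 < lo \<Longrightarrow> hi \<le> 16 \<Longrightarrow> lo + c / 2 \<le> hi \<Longrightarrow>
       \<exists>r. lo \<le> r\<^sup>2 \<and> r\<^sup>2 \<le> hi \<and> split_circle (\<lambda>u. A (d + u)) (\<lambda>u. D (d + u)) \<kappa> r"
    and tilt0: "tilted_split A D \<kappa> \<tau> r0" and tilt1: "tilted_split A D \<kappa> \<tau> r1"
    and d: "0 < d" "d \<le> 1" and k: "1 \<le> k" and s: "s = k * d + \<sigma>"
    and r0: "r0\<^sup>2 = s\<^sup>2 + h\<^sup>2" "r0\<^sup>2 \<le> 9" and r1: "r1\<^sup>2 = (s - 2 * k * d)\<^sup>2 + h\<^sup>2"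
    and h: "0 < h" and \<sigma>: "0 < \<sigma>" "\<sigma> \<le> d / 2" and c: "0 < c" "c \<le> 1"
    and \<Delta>: "c * (4 * (real k + 1) ^ 3 + 1) \<le> \<Delta>" "\<Delta> / d \<le> \<sigma> / 2" "8 * (\<Delta> / d) \<le> h\<^sup>2 / 4"
    and \<kappa>: "0 \<le> \<kappa>" "2 * \<kappa> < \<sigma> * c / 8" "\<sigma> * c / 8 \<le> h / 2"
    and \<tau>: "0 < \<tau>" "\<kappa> + 6 / 5 * h < \<tau> * (k * d - 2 * \<sigma>)"
  shows False
proof -
  \<comment> \<open>Coordinates are relative to the \<open>i\<close>-th unfolded centre. Even
    indices show the first centre after a half turn, with \<open>A\<close> and \<open>D\<close>
    exchanged; odd indices show the second centre. Thus \<open>Df i (- u) (- v)\<close> and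
    \<open>Af (Suc i) (u - d) v\<close> express the same condition.\<close>
  define Af where "Af = (\<lambda>i::nat. if even i then (\<lambda>u v. D (- u) (- v)) else (\<lambda>u v. A (d + u) v))"
  define Df where "Df = (\<lambda>i::nat. if even i then (\<lambda>u v. A (- u) (- v)) else (\<lambda>u v. D (d + u) v))"
  define n where "n = 2 * k"
  define N where "N = (\<lambda>i::nat. (s - i * d)\<^sup>2 + h\<^sup>2)"
  obtain g :: "nat \<Rightarrow> real" where g: "g 0 = 0" "g (2 * k) = 0"
    "\<And>i. i \<le> 2 * k \<Longrightarrow> \<bar>g i\<bar> \<le> 4 * (real k + 1) ^ 3"
    "\<And>i. 1 \<le> i \<Longrightarrow> i \<le> k \<Longrightarrow> 3 \<le> g (Suc i) + g (i - 1) - 2 * g i"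
    "\<And>i. k < i \<Longrightarrow> g (Suc i) + g (i - 1) - 2 * g i \<le> - 3"
    using interpolating_cubic[OF k] by metis
  have \<Delta>0: "0 < \<Delta>"
  proof -
    have "0 < c * (4 * (real k + 1) ^ 3 + 1)" using c by (intro mult_pos_pos add_nonneg_pos) auto
    then show ?thesis using \<Delta>(1) by simp
  qed
  have \<Delta>d: "\<Delta> \<le> \<Delta> / d" using d \<Delta>0 by (simp add: field_simps)
  have kd: "d \<le> k * d" using k d by simp
  have si: "\<bar>s - i * d\<bar> \<le> s" "N i \<le> 9" "h\<^sup>2 \<le> N i" if "i \<le> n" for i
  proof -
    have "i * d \<le> 2 * k * d" using that d by (intro mult_right_mono) (auto simp: n_def)
    then have "i * d \<le> 2 * (k * d)" "0 \<le> i * d" using d by (auto simp: mult.assoc)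
    then show 1: "\<bar>s - i * d\<bar> \<le> s" using s \<sigma> unfolding abs_le_iff by linarith
    have "(s - i * d)\<^sup>2 \<le> s\<^sup>2" using 1 s \<sigma> kd d by (intro power2_le_iff_abs_le[THEN iffD2]) auto
    then show "N i \<le> 9" "h\<^sup>2 \<le> N i" using r0 by (auto simp: N_def)
  qed
  have cg: "\<bar>c * g i\<bar> + c \<le> \<Delta>" if "i \<le> n" for i
  proof -
    have "c * \<bar>g i\<bar> \<le> c * (4 * (real k + 1) ^ 3)" using g(3)[of i] that c by (intro mult_left_mono) (auto simp: n_def)
    moreover have "\<bar>c * g i\<bar> = c * \<bar>g i\<bar>" using c by (simp add: abs_mult)
    moreover have "c * (4 * (real k + 1) ^ 3 + 1) = c * (4 * (real k + 1) ^ 3) + c" by (simp add: algebra_simps)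
    ultimately show ?thesis using \<Delta>(1) by linarith
  qed
  have h2: "8 * \<Delta> \<le> h\<^sup>2 / 4" using \<Delta>(3) \<Delta>d by linarith
  \<comment> \<open>Errors in \<open>[0, c / 2]\<close> change a second difference by at most
    \<open>c\<close>, so that of the perturbation still exceeds \<open>3 * c - c\<close> in size.
    The end radii are prescribed, which is possible because \<open>g\<close> vanishes at both
    ends.\<close>
  have ex: "\<exists>r. c * g i \<le> N i - r\<^sup>2 \<and> N i - r\<^sup>2 \<le> c * g i + c / 2 \<and>
      (1 \<le> i \<and> i < n \<longrightarrow> split_circle (Af i) (Df i) \<kappa> r) \<and> (i = 0 \<longrightarrow> r = r0) \<and> (i = n \<longrightarrow> r = r1)"
    if i: "i \<le> n" for i
  proof -
    consider "i = 0" | "i = n" | "1 \<le> i" "i < n" using i by linarith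
    then show ?thesis
    proof cases
      case 1 then show ?thesis using g(1) c r0 k by (intro exI[of _ r0]) (auto simp: N_def n_def)
    next
      case 2 then show ?thesis using g(2) c r1 k by (intro exI[of _ r1]) (auto simp: N_def n_def mult_ac)
    next
      case 3
      have lo: "0 < N i - c * g i - c / 2" "N i - c * g i \<le> 16"
        using si[OF i] cg[OF i] h2 \<Delta>0 c \<Delta>(2,3) \<sigma> d by (auto simp: abs_le_iff)
      have "\<exists>r. N i - c * g i - c / 2 \<le> r\<^sup>2 \<and> r\<^sup>2 \<le> N i - c * g i \<and> split_circle (Af i) (Df i) \<kappa> r"
      proof (cases "even i")
        case True
        then show ?thesis using dense0[OF lo] split_circle_minus[of A D \<kappa>] unfolding Af_def Df_def by auto
      next
        case False
        then show ?thesis using dense1[OF lo] unfolding Af_def Df_def by auto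
      qed
      then show ?thesis using 3 by (force simp: algebra_simps)
    qed
  qed
  then obtain \<rho> where \<rho>: "\<And>i. i \<le> n \<Longrightarrow> c * g i \<le> N i - (\<rho> i)\<^sup>2 \<and> N i - (\<rho> i)\<^sup>2 \<le> c * g i + c / 2 \<and>
      (1 \<le> i \<and> i < n \<longrightarrow> split_circle (Af i) (Df i) \<kappa> (\<rho> i)) \<and> (i = 0 \<longrightarrow> \<rho> i = r0) \<and> (i = n \<longrightarrow> \<rho> i = r1)"
    by metis
  define \<delta> where "\<delta> = (\<lambda>i. N i - (\<rho> i)\<^sup>2)"
  \<comment> \<open>The upper intersection of the circles \<open>i - 1\<close> and \<open>i\<close>
    is \<open>(X i, H i)\<close>: the difference of the two circle equations is linear in the
    abscissa.\<close>
  define X where "X = (\<lambda>i. s + (\<delta> i - \<delta> (i - 1)) / (2 * d))"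
  define H where "H = (\<lambda>i. sqrt ((\<rho> i)\<^sup>2 - (X i - i * d)\<^sup>2))"
  have \<delta>: "c * g i \<le> \<delta> i" "\<delta> i \<le> c * g i + c / 2" "\<bar>\<delta> i\<bar> \<le> \<Delta>" if "i \<le> n" for i
    using \<rho>[OF that] cg[OF that] c by (auto simp: \<delta>_def abs_le_iff)
  have Y: "\<bar>X i - s\<bar> \<le> \<Delta> / d" if "i \<le> n" for i
  proof -
    have "\<bar>\<delta> i - \<delta> (i - 1)\<bar> \<le> 2 * \<Delta>" using \<delta>(3)[of i] \<delta>(3)[of "i - 1"] that by linarith
    then have "\<bar>\<delta> i - \<delta> (i - 1)\<bar> / (2 * d) \<le> 2 * \<Delta> / (2 * d)" using d by (intro divide_right_mono) auto
    then show ?thesis using d by (simp add: X_def)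
  qed
  have eqs: "(\<rho> (i - 1))\<^sup>2 - (X i - real (i - 1) * d)\<^sup>2 = (\<rho> i)\<^sup>2 - (X i - i * d)\<^sup>2" if i: "1 \<le> i" for i
  proof -
    have "2 * d * (X i - s) = \<delta> i - \<delta> (i - 1)" using d by (simp add: X_def)
    moreover have "(\<rho> i)\<^sup>2 = N i - \<delta> i" "(\<rho> (i - 1))\<^sup>2 = N (i - 1) - \<delta> (i - 1)" by (auto simp: \<delta>_def)
    moreover have "real (i - 1) = real i - 1" using i by simp
    ultimately show ?thesis by (simp add: N_def power2_eq_square algebra_simps)
  qed
  have H2: "\<bar>(\<rho> i)\<^sup>2 - (X i - i * d)\<^sup>2 - h\<^sup>2\<bar> \<le> h\<^sup>2 / 4" if i: "i \<le> n" for i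
  proof -
    \<comment> \<open>With \<open>\<bar>s - i * d\<bar> \<le> 3\<close> and
      \<open>\<bar>y\<bar> \<le> \<Delta> / d \<le> 1\<close> the three terms below contribute 6, 1
      and 1 times \<open>\<Delta> / d\<close>.\<close>
    define y where "y = X i - s"
    have "(\<rho> i)\<^sup>2 - (X i - i * d)\<^sup>2 - h\<^sup>2 = - 2 * ((s - i * d) * y) - y * y - \<delta> i"
      by (simp add: \<delta>_def N_def y_def power2_eq_square algebra_simps)
    moreover have "\<bar>(s - i * d) * y\<bar> \<le> 3 * (\<Delta> / d)"
    proof -
      have "s\<^sup>2 \<le> 3\<^sup>2" using r0 by (auto intro: order_trans[of _ "r0\<^sup>2"])
      then have "s \<le> 3" by (rule power2_le_imp_le) simp
      then show ?thesis unfolding abs_mult using Y[OF i] si(1)[OF i]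
        by (intro mult_mono) (auto simp: y_def)
    qed
    moreover have "\<bar>y * y\<bar> \<le> 1 * (\<Delta> / d)"
      unfolding abs_mult using Y[OF i] \<Delta> \<sigma> d by (intro mult_mono) (auto simp: y_def)
    ultimately have "\<bar>(\<rho> i)\<^sup>2 - (X i - i * d)\<^sup>2 - h\<^sup>2\<bar> \<le> 8 * (\<Delta> / d)"
      using \<delta>(3)[OF i] \<Delta>d \<Delta>0 by linarith
    then show ?thesis using \<Delta>(3) by linarith
  qed
  have Hsq: "(H i)\<^sup>2 = (\<rho> i)\<^sup>2 - (X i - i * d)\<^sup>2" if "i \<le> n" for i
  proof -
    have "0 \<le> (\<rho> i)\<^sup>2 - (X i - i * d)\<^sup>2" using H2[OF that] zero_le_power2[of h]
      unfolding abs_le_iff by linarith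
    then show ?thesis by (simp add: H_def)
  qed
  have Hbd: "h / 2 \<le> H i" "H i \<le> 6 / 5 * h" "H i \<le> 3.6" if i: "i \<le> n" for i
  proof -
    have b: "3 / 4 * h\<^sup>2 \<le> (H i)\<^sup>2" "(H i)\<^sup>2 \<le> 5 / 4 * h\<^sup>2"
      using H2[OF i] unfolding Hsq[OF i] abs_le_iff by linarith+
    have H0: "0 \<le> H i"
      using Hsq[OF i] zero_le_power2[of "H i"] by (simp add: H_def)
    have "(h / 2)\<^sup>2 = h\<^sup>2 / 4" by (simp add: power_divide)
    then have "(h / 2)\<^sup>2 \<le> (H i)\<^sup>2" using b(1) zero_le_power2[of h] by linarith
    then show "h / 2 \<le> H i" using H0 by (rule power2_le_imp_le)
    have "(6 / 5 * h)\<^sup>2 = 36 / 25 * h\<^sup>2" by (simp add: power2_eq_square)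
    then have "(H i)\<^sup>2 \<le> (6 / 5 * h)\<^sup>2" using b(2) zero_le_power2[of h] by linarith
    then show 1: "H i \<le> 6 / 5 * h" by (rule power2_le_imp_le) (use h in simp)
    have "h\<^sup>2 \<le> 3\<^sup>2" using si(2,3)[of 0] by simp
    then have "h \<le> 3" by (rule power2_le_imp_le) simp
    then show "H i \<le> 3.6" using 1 by simp
  qed
  \<comment> \<open>The heights satisfy
    \<open>(H i - H (Suc i)) * (H i + H (Suc i)) \<ge> c * \<sigma>\<close> and have sum at most 8,
    so each step descends by at least this much.\<close>
  define m where "m = \<sigma> * c / 8"
  have m: "m \<le> \<sigma> / 2" "m \<le> c" "0 < m"
  proof -
    have "\<sigma> * c \<le> \<sigma> * 1" "\<sigma> * c \<le> 1 * c" using c \<sigma> d by (intro mult_mono; simp)+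
    then show "m \<le> \<sigma> / 2" "m \<le> c" "0 < m" using c \<sigma> by (auto simp: m_def)
  qed
  have dX: "1 \<le> i \<Longrightarrow> i \<le> k \<Longrightarrow> X i + c \<le> X (Suc i)" "k < i \<Longrightarrow> X (Suc i) + c \<le> X i" if i: "i < n" for i
  proof -
    \<comment> \<open>The move along the axis is a second difference of the perturbation; this is
      why the cubic is chosen by its second differences.\<close>
    have e: "X (Suc i) - X i = (\<delta> (Suc i) + \<delta> (i - 1) - 2 * \<delta> i) / (2 * d)"
      using d by (simp add: X_def field_simps)
    have cc: "c \<le> 2 * c / (2 * d)" using c d by (simp add: field_simps)
    have ds: "c * (g (Suc i) + g (i - 1) - 2 * g i) - c \<le> \<delta> (Suc i) + \<delta> (i - 1) - 2 * \<delta> i"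
         "\<delta> (Suc i) + \<delta> (i - 1) - 2 * \<delta> i \<le> c * (g (Suc i) + g (i - 1) - 2 * g i) + c"
    proof -
      have "i \<le> n" "Suc i \<le> n" "i - 1 \<le> n" using i by auto
      note b = \<delta>(1,2)[OF this(1)] \<delta>(1,2)[OF this(2)] \<delta>(1,2)[OF this(3)]
      have "c * (g (Suc i) + g (i - 1) - 2 * g i) = c * g (Suc i) + c * g (i - 1) - 2 * (c * g i)"
        by (simp add: algebra_simps)
      then show "c * (g (Suc i) + g (i - 1) - 2 * g i) - c \<le> \<delta> (Suc i) + \<delta> (i - 1) - 2 * \<delta> i"
         "\<delta> (Suc i) + \<delta> (i - 1) - 2 * \<delta> i \<le> c * (g (Suc i) + g (i - 1) - 2 * g i) + c"
        using b by linarith+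
    qed
    {
      assume "1 \<le> i" "i \<le> k"
      then have "c * 3 \<le> c * (g (Suc i) + g (i - 1) - 2 * g i)" using g(4)[of i] c by (intro mult_left_mono) auto
      then have "2 * c / (2 * d) \<le> X (Suc i) - X i" unfolding e using ds d by (intro divide_right_mono) auto
      then show "X i + c \<le> X (Suc i)" using cc by linarith
    }
    {
      assume "k < i"
      then have "c * (g (Suc i) + g (i - 1) - 2 * g i) \<le> c * (- 3)" using g(5)[of i] c by (intro mult_left_mono) auto
      then have "X (Suc i) - X i \<le> (- 2 * c) / (2 * d)" unfolding e using ds d by (intro divide_right_mono) auto
      then show "X (Suc i) + c \<le> X i" using cc by simp
    }
  qed
  have Y\<sigma>: "X i - s \<le> \<sigma> / 2 \<and> s - X i \<le> \<sigma> / 2" if "i \<le> n" for i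
    using Y[OF that] \<Delta>(2) by linarith
  have posX: "\<sigma> / 2 \<le> X i - i * d" if "1 \<le> i" "i \<le> k" for i
  proof -
    have "i * d \<le> k * d" using that d by (intro mult_right_mono) auto
    moreover have "i \<le> n" using that by (simp add: n_def)
    ultimately show ?thesis using Y\<sigma>[of i] s by linarith
  qed
  have negX: "X i - i * d \<le> - (\<sigma> / 2)" if "k < i" "i \<le> n" for i
  proof -
    have "(real k + 1) * d \<le> i * d" using that d by (intro mult_right_mono) auto
    then have "k * d + d \<le> i * d" by (simp add: algebra_simps)
    then show ?thesis using Y\<sigma>[OF that(2)] s \<sigma> by linarith
  qed
  have Xstep: "m \<le> X i - i * d \<and> X i + m \<le> X (Suc i) \<or> X i - i * d \<le> - m \<and> X (Suc i) + m \<le> X i"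
    if "1 \<le> i" "i < n" for i
    using posX[of i] negX[of i] dX[of i] m that by (cases "i \<le> k") auto
  have on2: "(X (Suc i) - i * d)\<^sup>2 + (H (Suc i))\<^sup>2 = (\<rho> i)\<^sup>2" if "i < n" for i
    using eqs[of "Suc i"] Hsq[of "Suc i"] that by simp
  have dH: "H (Suc i) + m \<le> H i" if i: "1 \<le> i" "i < n" for i
  proof -
    define x where "x = \<bar>X i - i * d\<bar>"
    define x' where "x' = \<bar>X (Suc i) - i * d\<bar>"
    have x: "\<sigma> / 2 \<le> x" "x + c \<le> x'"
      using posX[of i] negX[of i] dX[of i] \<sigma> c i by (cases "i \<le> k"; auto simp: x_def x'_def)+
    have "(H i)\<^sup>2 - (H (Suc i))\<^sup>2 = x'\<^sup>2 - x\<^sup>2"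
      using on2[of i] Hsq[of i] i by (simp add: x_def x'_def)
    then have e: "(H i - H (Suc i)) * (H i + H (Suc i)) = (x' - x) * (x' + x)"
      by (simp add: power2_eq_square algebra_simps)
    have ge: "c * \<sigma> \<le> (x' - x) * (x' + x)" using x c \<sigma> by (intro mult_mono) auto
    have Hs: "0 < H i + H (Suc i)" "H i + H (Suc i) \<le> 8"
      using Hbd[of i] Hbd[of "Suc i"] i h by auto
    have "0 \<le> H i - H (Suc i)"
      using e ge Hs(1) mult_pos_pos[OF c(1) \<sigma>(1)] by (metis less_le_not_le linorder_not_le mult_neg_pos order.trans)
    then have "(H i - H (Suc i)) * (H i + H (Suc i)) \<le> (H i - H (Suc i)) * 8"
      using Hs by (intro mult_left_mono) auto
    then show ?thesis using e ge by (simp add: m_def mult_ac)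
  qed
  have tr: "Df i (- u) (- v) \<Longrightarrow> Af (Suc i) (u - d) v" for i u v
    by (auto simp: Af_def Df_def)
  have "0 \<le> s" using s \<sigma> kd d by simp
  have X1: "(X 1)\<^sup>2 + (H 1)\<^sup>2 = r0\<^sup>2" using on2[of 0] \<rho>[of 0] k by (auto simp: n_def)
  have tX: "\<kappa> + H i < \<tau> * x" if "i \<le> n" "k * d - 2 * \<sigma> \<le> x" for i x
  proof -
    have "\<tau> * (k * d - 2 * \<sigma>) \<le> \<tau> * x" using that \<tau> by (intro mult_left_mono) auto
    then show ?thesis using Hbd(2)[OF that(1)] \<tau>(2) by linarith
  qed
  have n1: "1 \<le> n" using k by (simp add: n_def)
  have Xlow: "k * d - 2 * \<sigma> \<le> X 1" "k * d - 2 * \<sigma> \<le> 2 * k * d - X n"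
    using Y\<sigma>[OF n1] Y\<sigma>[OF order_refl] s \<sigma> by linarith+
  have nn: "0 \<le> k * d - 2 * \<sigma>" using kd \<sigma> by linarith
  have Hn0: "0 \<le> H i" if "i \<le> n" for i using Hbd(1)[OF that] h by linarith
  have start: "A (X 1) (H 1)" "A (X 1) (- H 1)"
    using tilted_split_right(1)[OF tilt0, of "X 1" "H 1"] tilted_split_right(1)[OF tilt0, of "X 1" "- H 1"]
      X1 tX[OF n1 Xlow(1)] Hn0[OF n1] Xlow nn by auto
  have last: "Af n (X n - n * d) (H n) \<and> Af n (X n - n * d) (- H n)"
  proof (rule chain_propagation[of Af Df d \<kappa> m n \<rho> X H])
    show "\<not> (Af i u v \<and> Df i u v)" for i u v using disj by (auto simp: Af_def Df_def)
    show "m \<le> H i" if "1 \<le> i" "i \<le> n" for i using Hbd(1)[OF that(2)] \<kappa>(3) by (simp add: m_def)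
    show "(X i - real i * d)\<^sup>2 + (H i)\<^sup>2 = (\<rho> i)\<^sup>2" if "1 \<le> i" "i < n" for i
      using Hsq[of i] that by simp
  qed (use tr \<kappa> \<rho> on2 dH Xstep start n1 in \<open>auto simp: Af_def m_def\<close>)
  \<comment> \<open>The index \<open>n\<close> is even, so the lower point of the last mirror pair
    says \<open>D z (H n)\<close> in the original coordinates, whereas the tilt of the circle of
    radius \<open>r1\<close> says \<open>A z (H n)\<close>.\<close>
  define z where "z = 2 * k * d - X n"
  have "z\<^sup>2 + (H n)\<^sup>2 = r1\<^sup>2"
    using Hsq[of n] \<rho>[of n] by (simp add: z_def n_def power2_commute)
  then have "A z (H n)"
    using tilted_split_right(1)[OF tilt1, of z "H n"] tX[of n z] Xlow(2) nn Hn0[of n]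
    by (auto simp: z_def)
  moreover have "D z (H n)"
    using last by (simp add: Af_def n_def z_def)
  ultimately show False using disj by blast
qed

section \<open>Existence of circles that the boundary meets only near the axis\<close>

lemma split_circle_swap: "split_circle A D \<kappa> r \<longleftrightarrow> split_circle D A \<kappa> r"
proof -
  have "split_circle D A \<kappa> r" if sc: "split_circle A D \<kappa> r" for A D
  proof -
    obtain a b where ab: "a\<^sup>2 + b\<^sup>2 = 1"
      "\<And>u v. u\<^sup>2 + v\<^sup>2 = r\<^sup>2 \<Longrightarrow> \<kappa> < a * u + b * v \<Longrightarrow> A u v"
      "\<And>u v. u\<^sup>2 + v\<^sup>2 = r\<^sup>2 \<Longrightarrow> a * u + b * v < - \<kappa> \<Longrightarrow> D u v"
      using sc unfolding split_circle_def by blast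
    then show ?thesis unfolding split_circle_def
      by (intro exI[of _ "- a"] exI[of _ "- b"]) auto
  qed
  then show ?thesis by blast
qed

definition flat_circle :: "(real \<Rightarrow> real \<Rightarrow> bool) \<Rightarrow> (real \<Rightarrow> real \<Rightarrow> bool) \<Rightarrow> real \<Rightarrow> real \<Rightarrow> bool" where
  "flat_circle A D t r \<longleftrightarrow> (\<forall>u v. u\<^sup>2 + v\<^sup>2 = r\<^sup>2 \<longrightarrow> t \<le> \<bar>v\<bar> \<longrightarrow> A u v \<or> D u v)"

text \<open>If the normal is nearly vertical, \<open>\<bar>a * u\<bar> \<le> t / 4\<close> because
  \<open>\<bar>u\<bar> \<le> 3\<close>, while \<open>\<bar>b * v\<bar> \<ge> t / 2\<close> off the
  strip. The remaining \<open>t / 4\<close> exceeds \<open>\<kappa>\<close>; this is the origin of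
  the threshold \<open>t / 12\<close>.\<close>

lemma split_circle_cases:
  assumes sc: "split_circle A D \<kappa> r" and r: "0 \<le> r" "r \<le> 3" and t: "0 < t" "t \<le> 1" and \<kappa>: "\<kappa> < t / 4"
  obtains "tilted_split A D \<kappa> (t / 12) r" | "tilted_split D A \<kappa> (t / 12) r" | "flat_circle A D t r"
proof -
  obtain a b where ab: "a\<^sup>2 + b\<^sup>2 = 1"
    "\<And>u v. u\<^sup>2 + v\<^sup>2 = r\<^sup>2 \<Longrightarrow> \<kappa> < a * u + b * v \<Longrightarrow> A u v"
    "\<And>u v. u\<^sup>2 + v\<^sup>2 = r\<^sup>2 \<Longrightarrow> a * u + b * v < - \<kappa> \<Longrightarrow> D u v"
    using sc unfolding split_circle_def by blast
  consider "t / 12 \<le> a" | "t / 12 \<le> - a" | "\<bar>a\<bar> \<le> t / 12" by linarith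
  then show ?thesis
  proof cases
    case 1
    then have "tilted_split A D \<kappa> (t / 12) r" using ab unfolding tilted_split_def by blast
    then show ?thesis by (rule that)
  next
    case 2
    then have "tilted_split D A \<kappa> (t / 12) r" unfolding tilted_split_def
      using ab by (intro exI[of _ "- a"] exI[of _ "- b"]) auto
    then show ?thesis by (rule that)
  next
    case 3
    have "a\<^sup>2 \<le> (1 / 12)\<^sup>2" using 3 t abs_le_square_iff[of a "1 / 12"] by auto
    then have "(1 / 2)\<^sup>2 \<le> \<bar>b\<bar>\<^sup>2" using ab(1) by (simp add: power2_eq_square)
    then have b: "1 / 2 \<le> \<bar>b\<bar>" by (rule power2_le_imp_le) simp
    have "flat_circle A D t r" unfolding flat_circle_def
    proof (intro allI impI)
      fix u v :: real assume uv: "u\<^sup>2 + v\<^sup>2 = r\<^sup>2" "t \<le> \<bar>v\<bar>"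
      have "\<bar>u\<bar>\<^sup>2 \<le> r\<^sup>2" unfolding power2_abs using uv zero_le_power2[of v] by linarith
      then have "\<bar>u\<bar> \<le> r" by (rule power2_le_imp_le) (rule r)
      then have "\<bar>a\<bar> * \<bar>u\<bar> \<le> t / 12 * 3" using 3 r t by (intro mult_mono) auto
      moreover have "1 / 2 * t \<le> \<bar>b\<bar> * \<bar>v\<bar>" using b uv t by (intro mult_mono) auto
      ultimately have "\<bar>a * u\<bar> + \<kappa> < \<bar>b * v\<bar>" using \<kappa> by (simp add: abs_mult)
      then have "\<kappa> < a * u + b * v \<or> a * u + b * v < - \<kappa>" by linarith
      then show "A u v \<or> D u v" using ab uv by blast
    qed
    then show ?thesis by (rule that)
  qed
qed

lemma squares_meet_of_dense:
  fixes \<eta> :: real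
  assumes "\<And>a. 0 \<le> a \<Longrightarrow> a + \<eta> \<le> 5 \<Longrightarrow> \<exists>r. a \<le> r \<and> r \<le> a + \<eta> \<and> P r"
    and \<eta>: "0 < \<eta>" "\<eta> \<le> 1" and lh: "0 < lo" "hi \<le> 16" "lo + 8 * \<eta> \<le> hi"
  shows "\<exists>r. lo \<le> r\<^sup>2 \<and> r\<^sup>2 \<le> hi \<and> P r"
proof -
  define a where "a = sqrt lo"
  have a2: "a\<^sup>2 = lo" "0 \<le> a" using lh by (auto simp: a_def)
  have "(4 - \<eta>)\<^sup>2 = 16 - 8 * \<eta> + \<eta>\<^sup>2" by (simp add: power2_diff)
  then have "a\<^sup>2 \<le> (4 - \<eta>)\<^sup>2" using lh zero_le_power2[of \<eta>] a2 by linarith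
  then have a4: "a \<le> 4 - \<eta>" by (rule power2_le_imp_le) (use \<eta> in simp)
  obtain r where r: "a \<le> r" "r \<le> a + \<eta>" "P r" using assms(1)[of a] a2 a4 by auto
  have "r\<^sup>2 \<le> (a + \<eta>)\<^sup>2" using r a2 by (intro power_mono) auto
  also have "\<dots> = lo + (2 * a + \<eta>) * \<eta>" using a2 by (simp add: power2_eq_square algebra_simps)
  also have "\<dots> \<le> lo + 8 * \<eta>" using a4 \<eta> by (intro add_left_mono mult_right_mono) auto
  finally have "r\<^sup>2 \<le> hi" using lh by simp
  moreover have "lo \<le> r\<^sup>2" using r a2 power_mono[of a r 2] by auto
  ultimately show ?thesis using r by blast
qed

text \<open>The chain is built from the two radii: with \<open>q = k * d\<close>, the point
  \<open>(q + \<sigma>, h)\<close> is at distance \<open>r0\<close> from the origin and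
  \<open>r1\<close> from \<open>(2 * q, 0)\<close>. Taking \<open>q\<close> slightly below
  \<open>r1\<close> keeps \<open>h\<close> so small against \<open>\<tau> * r1\<close> that the tilt
  decides on which side the end points lie, yet large enough that the perturbation cannot bring them
  to the axis.\<close>

lemma tilted_radii_unique:
  fixes A D :: "real \<Rightarrow> real \<Rightarrow> bool" and c d t L d1 \<kappa> \<tau> r0 r1 C :: real
  assumes disj: "\<And>u v. \<not> (A u v \<and> D u v)"
    and dense0: "\<And>lo hi. 0 < lo \<Longrightarrow> hi \<le> 16 \<Longrightarrow> lo + c / 2 \<le> hi \<Longrightarrow>
       \<exists>r. lo \<le> r\<^sup>2 \<and> r\<^sup>2 \<le> hi \<and> split_circle A D \<kappa> r"
    and dense1: "\<And>lo hi. 0 < lo \<Longrightarrow> hi \<le> 16 \<Longrightarrow> lo + c / 2 \<le> hi \<Longrightarrow>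
       \<exists>r. lo \<le> r\<^sup>2 \<and> r\<^sup>2 \<le> hi \<and> split_circle (\<lambda>u. A (d + u)) (\<lambda>u. D (d + u)) \<kappa> r"
    and tilt0: "tilted_split A D \<kappa> \<tau> r0" and tilt1: "tilted_split A D \<kappa> \<tau> r1"
    and t: "0 < t" "t \<le> 1" and \<tau>: "\<tau> = t / 12"
    and d: "0 < d1" "d1 \<le> d" "d \<le> t * \<tau>\<^sup>2 / 32"
    and r: "t \<le> r1" "r1 + L / 4 \<le> r0" "r0 \<le> r1 + L" "r0 \<le> 3"
    and L: "0 < L" "L \<le> t * d1 / 6" "L \<le> t\<^sup>2 * \<tau>\<^sup>2 / 192"
    and C: "C = 4 * (3 / d1 + 1) ^ 3 + 1"
    and c: "0 < c" "c \<le> 1" "c * C / d1 \<le> t * L / 48" "8 * (c * C / d1) \<le> t\<^sup>2 * \<tau>\<^sup>2 / 128"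
    and \<kappa>: "0 \<le> \<kappa>" "\<kappa> < t * L * c / 400" "\<kappa> < 2 / 5 * (t * \<tau>)"
  shows False
proof -
  define x where "x = \<tau>\<^sup>2 / 32"
  have \<tau>1: "0 < \<tau>" "\<tau> \<le> 1 / 12" using t by (auto simp: \<tau>)
  have "\<tau>\<^sup>2 \<le> (1 / 12)\<^sup>2" using \<tau>1 by (intro power_mono) auto
  then have x: "0 < x" "x \<le> 1 / 1000" using \<tau>1 by (auto simp: x_def power2_eq_square)
  have d0: "0 < d" using d by linarith
  have r1: "0 < r1" "r1 \<le> 3" using r t L(1) by linarith+
  have dr: "d \<le> r1 * x" using d r x by (auto simp: x_def intro: order_trans[OF _ mult_right_mono])
  \<comment> \<open>Since \<open>d \<le> r1 * x\<close>, some multiple of \<open>d\<close> lies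
    between \<open>r1 * (1 - 2 * x)\<close> and \<open>r1 * (1 - x)\<close>.\<close>
  define k where "k = nat \<lfloor>r1 * (1 - x) / d\<rfloor>"
  define q where "q = k * d"
  have q: "q \<le> r1 * (1 - x)" "r1 * (1 - 2 * x) \<le> q"
  proof -
    have pos: "0 \<le> r1 * (1 - x) / d" using r1 x d0 by auto
    then have "real k \<le> r1 * (1 - x) / d" by (simp add: k_def)
    then show "q \<le> r1 * (1 - x)" using d0 by (simp add: q_def field_simps)
    have "r1 * (1 - x) / d < real k + 1" using pos by (simp add: k_def)
    then have "r1 * (1 - x) < q + d" using d0 by (simp add: q_def field_simps)
    then show "r1 * (1 - 2 * x) \<le> q" using dr by (simp add: algebra_simps)
  qed
  have rx: "r1 * x \<le> r1 * (1 / 1000)" using x r1 by (intro mult_left_mono) auto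
  have q2: "r1 / 2 \<le> q" "q \<le> r1" "0 < q"   proof -
    define y where "y = r1 * x"
    have "q \<le> r1 - y" "r1 - 2 * y \<le> q" "0 < y" "y \<le> r1 / 1000"
      using q(1) apply (simp add: y_def right_diff_distrib)
      using q(2) apply (simp add: y_def right_diff_distrib)
      using x r1 apply (simp add: y_def)
      using rx apply (simp add: y_def)
      done
    then show "r1 / 2 \<le> q" "q \<le> r1" "0 < q" using r1 by linarith+
  qed
  have k1: "1 \<le> k" using q2(3) by (cases k) (auto simp: q_def)
  \<comment> \<open>Obtained by subtracting
    \<open>(q - \<sigma>)\<^sup>2 + h\<^sup>2 = r1\<^sup>2\<close> from
    \<open>(q + \<sigma>)\<^sup>2 + h\<^sup>2 = r0\<^sup>2\<close>; the second of these equations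
    then defines \<open>h\<close>.\<close>
  define \<sigma> where "\<sigma> = (r0\<^sup>2 - r1\<^sup>2) / (4 * q)"
  have qs: "4 * q * \<sigma> = r0\<^sup>2 - r1\<^sup>2" using q2 by (simp add: \<sigma>_def)
  have df: "r0\<^sup>2 - r1\<^sup>2 = (r0 - r1) * (r0 + r1)" by (simp add: power2_eq_square algebra_simps)
  have df_up: "r0\<^sup>2 - r1\<^sup>2 \<le> L * 6" unfolding df using r r1 L(1) by (intro mult_mono; linarith)
  have df_lo: "L / 4 * (2 * t) \<le> r0\<^sup>2 - r1\<^sup>2" unfolding df using r r1 L(1) t by (intro mult_mono; linarith)
  have \<sigma>_up: "\<sigma> \<le> 3 * L / t"
  proof -
    have "\<sigma> \<le> L * 6 / (4 * q)" unfolding \<sigma>_def using df_up q2 by (intro divide_right_mono) auto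
    also have "\<dots> \<le> L * 6 / (4 * (t / 2))" using q2 r(1) t L(1) by (intro divide_left_mono) auto
    finally show ?thesis by (simp add: field_simps)
  qed
  have \<sigma>_lo: "t * L / 24 \<le> \<sigma>"
  proof -
    have "t * L / 24 = L / 4 * (2 * t) / (4 * 3)" by simp
    also have "\<dots> \<le> L / 4 * (2 * t) / (4 * q)" using q2 r1 L(1) t by (intro divide_left_mono) auto
    also have "\<dots> \<le> \<sigma>" unfolding \<sigma>_def using df_lo q2 by (intro divide_right_mono) auto
    finally show ?thesis .
  qed
  have \<sigma>0: "0 < \<sigma>" using \<sigma>_lo mult_pos_pos[OF t(1) L(1)] by linarith
  have \<sigma>d: "\<sigma> \<le> d / 2"
  proof -
    have "3 * L / t \<le> d1 / 2" using L(2) t by (simp add: field_simps)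
    then show ?thesis using \<sigma>_up d by linarith
  qed
  have \<sigma>\<tau>: "\<sigma> \<le> t * \<tau>\<^sup>2 / 64"
  proof -
    have "3 * L / t \<le> t * \<tau>\<^sup>2 / 64" using L(3) t by (simp add: field_simps power2_eq_square)
    then show ?thesis using \<sigma>_up by linarith
  qed
  have \<sigma>x: "\<sigma> \<le> r1 * x / 2"
  proof -
    have "t * x \<le> r1 * x" using r x by (intro mult_right_mono) auto
    then show ?thesis using \<sigma>\<tau> by (simp add: x_def)
  qed
  have \<sigma>q: "\<sigma> \<le> q" using \<sigma>x q2 rx r1 by linarith
  define h where "h = sqrt (r1\<^sup>2 - (q - \<sigma>)\<^sup>2)"
  have lo: "r1\<^sup>2 * x \<le> r1\<^sup>2 - (q - \<sigma>)\<^sup>2"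
  proof -
    have "(q - \<sigma>)\<^sup>2 \<le> (r1 * (1 - x))\<^sup>2" using q(1) \<sigma>q \<sigma>0 by (intro power_mono; linarith)
    also have "\<dots> = r1\<^sup>2 * (1 - x)\<^sup>2" by (simp add: power_mult_distrib)
    also have "\<dots> \<le> r1\<^sup>2 * (1 - x)" using x by (intro mult_left_mono) (auto simp: power2_eq_square mult_left_le)
    finally show ?thesis by (simp add: algebra_simps)
  qed
  have up: "r1\<^sup>2 - (q - \<sigma>)\<^sup>2 \<le> r1\<^sup>2 * (5 * x)"
  proof -
    have "r1 * (1 - 5 / 2 * x) \<le> q - \<sigma>" using q \<sigma>x by (simp add: algebra_simps)
    moreover have "0 \<le> r1 * (1 - 5 / 2 * x)" using r1(1) x(2) by (intro mult_nonneg_nonneg; linarith)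
    ultimately have "(r1 * (1 - 5 / 2 * x))\<^sup>2 \<le> (q - \<sigma>)\<^sup>2" by (rule power_mono)
    moreover have "(r1 * (1 - 5 / 2 * x))\<^sup>2 = r1\<^sup>2 * (1 - 5 * x + (5 / 2 * x)\<^sup>2)"
      by (simp add: power_mult_distrib power2_diff)
    moreover have "r1\<^sup>2 * (1 - 5 * x) \<le> r1\<^sup>2 * (1 - 5 * x + (5 / 2 * x)\<^sup>2)"
      by (intro mult_left_mono) auto
    ultimately have "r1\<^sup>2 * (1 - 5 * x) \<le> (q - \<sigma>)\<^sup>2" by (metis order_trans)
    then show ?thesis by (simp add: right_diff_distrib)
  qed
  have h2: "h\<^sup>2 = r1\<^sup>2 - (q - \<sigma>)\<^sup>2" "0 < h"
  proof -
    have "0 < r1\<^sup>2 * x" using r1 x by simp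
    then show "h\<^sup>2 = r1\<^sup>2 - (q - \<sigma>)\<^sup>2" "0 < h" using lo by (auto simp: h_def)
  qed
  have h_lo: "t\<^sup>2 * \<tau>\<^sup>2 / 32 \<le> h\<^sup>2"
  proof -
    have "t\<^sup>2 * x \<le> r1\<^sup>2 * x" using r t x by (intro mult_right_mono power_mono) auto
    then show ?thesis using lo h2 by (simp add: x_def)
  qed
  \<comment> \<open>The chain needs \<open>6 / 5 * h\<close>, that is 12/25 of
    \<open>r1 * \<tau>\<close>; together with \<open>\<kappa> < 2 / 5 * (t * \<tau>)\<close> this
    stays below the available \<open>9 / 10 * (r1 * \<tau>)\<close>.\<close>
  have h_up: "h \<le> 2 / 5 * (r1 * \<tau>)"
  proof (rule power2_le_imp_le)
    have "h\<^sup>2 \<le> 5 / 32 * (r1 * \<tau>)\<^sup>2" using up h2 by (simp add: x_def power_mult_distrib)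
    also have "\<dots> \<le> 4 / 25 * (r1 * \<tau>)\<^sup>2" by (intro mult_right_mono) auto
    finally show "h\<^sup>2 \<le> (2 / 5 * (r1 * \<tau>))\<^sup>2" by (simp add: power_mult_distrib power2_eq_square)
  qed (use r1 \<tau>1 in auto)
  have h_lo1: "t * \<tau> / 6 \<le> h"
  proof (rule power2_le_imp_le)
    have "(t * \<tau> / 6)\<^sup>2 \<le> t\<^sup>2 * \<tau>\<^sup>2 / 32" by (simp add: power_mult_distrib power_divide)
    then show "(t * \<tau> / 6)\<^sup>2 \<le> h\<^sup>2" using h_lo by linarith
  qed (use h2 in auto)
  \<comment> \<open>Bounds the chain length by \<open>d1\<close> alone, and explains
    \<open>3 / d1\<close> in \<open>C\<close>.\<close>
  have kd3: "real k \<le> 3 / d1"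
  proof -
    have "k * d1 \<le> k * d" using d by (intro mult_left_mono) auto
    then have "k * d1 \<le> 3" using q2 r1 by (simp add: q_def)
    then show ?thesis using d by (simp add: field_simps)
  qed
  have C1: "1 \<le> C" unfolding C using d by simp
  have cd: "c * C / d \<le> c * C / d1" using c C1 d by (intro divide_left_mono) auto
  have \<sigma>c: "\<sigma> * c \<le> \<sigma>" "t * L / 24 * c \<le> \<sigma> * c" using c \<sigma>0 \<sigma>_lo by (auto intro: mult_right_mono)
  show False
  proof (rule tilted_pair_contradiction[OF disj dense0 dense1 tilt0 tilt1,
        where k = k and s = "q + \<sigma>" and \<sigma> = \<sigma> and h = h and \<Delta> = "c * C"])
    show "c * (4 * (real k + 1) ^ 3 + 1) \<le> c * C"
      unfolding C using c kd3 by (intro mult_left_mono add_mono power_mono) auto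
    show "d \<le> 1" using dr rx r1 by linarith
    show "r0\<^sup>2 = (q + \<sigma>)\<^sup>2 + h\<^sup>2" using qs h2 by (simp add: power2_eq_square algebra_simps)
    show "r0\<^sup>2 \<le> 9" using power_mono[OF r(4), of 2] r(2) r1 L(1) by simp
    have e: "q + \<sigma> - real (2 * k) * d = - (q - \<sigma>)" by (simp add: q_def)
    show "r1\<^sup>2 = (q + \<sigma> - real (2 * k) * d)\<^sup>2 + h\<^sup>2"
      unfolding e power2_minus using h2(1) by simp
    show "c * C / d \<le> \<sigma> / 2" using cd c(3) \<sigma>_lo by linarith
    show "8 * (c * C / d) \<le> h\<^sup>2 / 4" using cd c(4) h_lo by linarith
    show "2 * \<kappa> < \<sigma> * c / 8"
    proof -
      have "t * L * c / 384 = t * L / 24 * c / 16" by simp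
      then have "t * L * c / 384 \<le> \<sigma> * c / 16" using \<sigma>c(2) by linarith
      moreover have "0 < t * L * c" using t(1) L(1) c(1) by simp
      ultimately show ?thesis using \<kappa>(2) by linarith
    qed
    show "\<sigma> * c / 8 \<le> h / 2"
    proof -
      have "t * \<tau>\<^sup>2 \<le> t * (\<tau> * 1)" using \<tau>1 t by (auto intro!: mult_left_mono simp: power2_eq_square)
      then show ?thesis using \<sigma>\<tau> \<sigma>c h_lo1 \<sigma>0 by linarith
    qed
    have "r1 * (1 - 2 * x) = r1 - 2 * (r1 * x)" by (simp add: algebra_simps)
    then have "r1 * (9 / 10) \<le> q - 2 * \<sigma>" using q(2) \<sigma>x rx r1 by linarith
    then have "\<tau> * (r1 * (9 / 10)) \<le> \<tau> * (q - 2 * \<sigma>)"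
      using \<tau>1 by (intro mult_left_mono) auto
    moreover have "t * \<tau> \<le> r1 * \<tau>" using r \<tau>1 by (intro mult_right_mono) auto
    ultimately show "\<kappa> + 6 / 5 * h < \<tau> * (real k * d - 2 * \<sigma>)"
      using \<kappa>(3) h_up mult_pos_pos[OF r1(1) \<tau>1(1)] by (simp add: q_def algebra_simps)
  qed (use d0 k1 h2(2) \<sigma>0 \<sigma>d c(1,2) \<kappa>(1) \<tau>1 in \<open>auto simp: q_def\<close>)
qed

text \<open>A pigeonhole argument: of three well separated split circles in a window of length
  \<open>L\<close>, at most one is tilted to the right and at most one to the left, so one is flat.
  The constants depend on \<open>d1\<close> only, to serve all \<open>d \<ge> d1\<close>.\<close>

lemma flat_circle_exists:
  fixes t d1 l :: real
  assumes t: "0 < t" "t \<le> 1" and d1: "0 < d1" and l: "0 < l"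
  obtains \<kappa> \<eta> :: real where "0 < \<kappa>" "0 < \<eta>"
    "\<And>d A D a. d1 \<le> d \<Longrightarrow> d \<le> t ^ 3 / 5000 \<Longrightarrow> (\<And>u v. \<not> (A u v \<and> D u v)) \<Longrightarrow>
      (\<And>a. 0 \<le> a \<Longrightarrow> a + \<eta> \<le> 5 \<Longrightarrow> \<exists>r. a \<le> r \<and> r \<le> a + \<eta> \<and> split_circle A D \<kappa> r) \<Longrightarrow>
      (\<And>a. 0 \<le> a \<Longrightarrow> a + \<eta> \<le> 5 \<Longrightarrow> \<exists>r. a \<le> r \<and> r \<le> a + \<eta> \<and>
         split_circle (\<lambda>u. A (d + u)) (\<lambda>u. D (d + u)) \<kappa> r) \<Longrightarrow>
      t \<le> a \<Longrightarrow> a + l \<le> 3 \<Longrightarrow> \<exists>r. a \<le> r \<and> r \<le> a + l \<and> flat_circle A D t r"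
proof -
  define \<tau> where "\<tau> = t / 12"
  define L where "L = Min {l, t * d1 / 6, t\<^sup>2 * \<tau>\<^sup>2 / 192}"
  define C where "C = 4 * (3 / d1 + 1) ^ 3 + 1"
  define c where "c = Min {1, t * L / 48 * d1 / C, t\<^sup>2 * \<tau>\<^sup>2 / 1024 * d1 / C, L}"
  define \<kappa> where "\<kappa> = Min {t * L * c / 800, t * \<tau> / 5, t / 8}"
  define \<eta> where "\<eta> = c / 16"
  have \<tau>0: "0 < \<tau>" using t by (simp add: \<tau>_def)
  have L: "0 < L" "L \<le> l" "L \<le> t * d1 / 6" "L \<le> t\<^sup>2 * \<tau>\<^sup>2 / 192"
    unfolding L_def using t d1 l \<tau>0 by (subst Min_gr_iff; auto) (intro Min_le; simp)+
  have C: "0 < C" using d1 unfolding C_def by (intro add_nonneg_pos) auto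
  have c: "0 < c" "c \<le> 1" "c \<le> t * L / 48 * d1 / C" "c \<le> t\<^sup>2 * \<tau>\<^sup>2 / 1024 * d1 / C" "c \<le> L"
    unfolding c_def using t d1 L \<tau>0 C by (subst Min_gr_iff; auto) (intro Min_le; simp)+
  have c': "c * C / d1 \<le> t * L / 48" "8 * (c * C / d1) \<le> t\<^sup>2 * \<tau>\<^sup>2 / 128"
  proof -
    have "c * C / d1 \<le> y" if "c \<le> y * d1 / C" for y using that C d1 by (simp add: field_simps)
    from this[OF c(3)] this[OF c(4)]
    show "c * C / d1 \<le> t * L / 48" "8 * (c * C / d1) \<le> t\<^sup>2 * \<tau>\<^sup>2 / 128" by linarith+
  qed
  have \<kappa>: "0 < \<kappa>" "\<kappa> < t * L * c / 400" "\<kappa> < 2 / 5 * (t * \<tau>)" "\<kappa> < t / 4"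
  proof -
    have p: "0 < t * L * c" "0 < t * \<tau>" using t L c \<tau>0 by auto
    have "\<kappa> \<le> t * L * c / 800" "\<kappa> \<le> t * \<tau> / 5" "\<kappa> \<le> t / 8"
      unfolding \<kappa>_def by (intro Min_le; simp)+
    then show "\<kappa> < t * L * c / 400" "\<kappa> < 2 / 5 * (t * \<tau>)" "\<kappa> < t / 4" using p t by linarith+
    show "0 < \<kappa>" unfolding \<kappa>_def using p t by (subst Min_gr_iff) auto
  qed
  have \<eta>: "0 < \<eta>" "\<eta> \<le> 1" "8 * \<eta> = c / 2" "\<eta> \<le> L / 8" using c by (auto simp: \<eta>_def)
  show ?thesis
  proof (rule that[OF \<kappa>(1) \<eta>(1)])
    fix d a :: real and A D :: "real \<Rightarrow> real \<Rightarrow> bool"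
    assume d: "d1 \<le> d" "d \<le> t ^ 3 / 5000" and disj: "\<And>u v. \<not> (A u v \<and> D u v)"
      and d0: "\<And>a. 0 \<le> a \<Longrightarrow> a + \<eta> \<le> 5 \<Longrightarrow> \<exists>r. a \<le> r \<and> r \<le> a + \<eta> \<and> split_circle A D \<kappa> r"
      and dd: "\<And>a. 0 \<le> a \<Longrightarrow> a + \<eta> \<le> 5 \<Longrightarrow> \<exists>r. a \<le> r \<and> r \<le> a + \<eta> \<and>
         split_circle (\<lambda>u. A (d + u)) (\<lambda>u. D (d + u)) \<kappa> r"
      and a: "t \<le> a" "a + l \<le> 3"
    have dt: "d \<le> t * \<tau>\<^sup>2 / 32"
    proof -
      \<comment> \<open>\<open>4608 = 32 * 12\<^sup>2\<close>, rounded up to 5000 in the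
        statement.\<close>
      have "t * \<tau>\<^sup>2 / 32 = t ^ 3 / 4608" by (simp add: \<tau>_def power2_eq_square power3_eq_cube)
      moreover have "0 \<le> t ^ 3" using t by simp
      ultimately show ?thesis using d(2) by linarith
    qed
    note sq0 = squares_meet_of_dense[of \<eta>, OF d0 \<eta>(1,2), unfolded \<eta>(3)]
    note sq1 = squares_meet_of_dense[of \<eta>, OF dd \<eta>(1,2), unfolded \<eta>(3)]
    have uniq: False if "tilted_split A D \<kappa> \<tau> r0" "tilted_split A D \<kappa> \<tau> r1"
      "a \<le> r1" "r1 + L / 4 \<le> r0" "r0 \<le> a + L" for r0 r1
      by (rule tilted_radii_unique[OF disj sq0 sq1 that(1,2) t \<tau>_def d1 d(1) dt _ that(4) _ _ L(1,3,4) C_def c(1,2) c'])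
         (use that a L \<kappa> in auto)
    have uniq': False if "tilted_split D A \<kappa> \<tau> r0" "tilted_split D A \<kappa> \<tau> r1"
      "a \<le> r1" "r1 + L / 4 \<le> r0" "r0 \<le> a + L" for r0 r1
      by (rule tilted_radii_unique[OF _ sq0[unfolded split_circle_swap[of A D]]
            sq1[unfolded split_circle_swap[of "\<lambda>u. A (d + u)"]] that(1,2) t \<tau>_def d1 d(1) dt _ that(4) _ _ L(1,3,4) C_def c(1,2) c'])
         (use that a L \<kappa> disj in auto)
    \<comment> \<open>Targets \<open>3 * L / 8\<close> apart with error at most \<open>L / 8\<close>
      leave gaps of at least \<open>L / 4\<close>.\<close>
    obtain x where x: "a \<le> x" "x \<le> a + \<eta>" "split_circle A D \<kappa> x"
      using d0[of a] a t L \<eta> by auto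
    obtain y where y: "a + 3 * L / 8 \<le> y" "y \<le> a + 3 * L / 8 + \<eta>" "split_circle A D \<kappa> y"
      using d0[of "a + 3 * L / 8"] a t L \<eta> by auto
    obtain z where z: "a + 6 * L / 8 \<le> z" "z \<le> a + 6 * L / 8 + \<eta>" "split_circle A D \<kappa> z"
      using d0[of "a + 6 * L / 8"] a t L \<eta> by auto
    have cases: "tilted_split A D \<kappa> \<tau> r \<or> tilted_split D A \<kappa> \<tau> r \<or> flat_circle A D t r"
      if "split_circle A D \<kappa> r" "a \<le> r" "r \<le> a + L" for r
      by (rule split_circle_cases[OF that(1) _ _ t \<kappa>(4)]) (use that a t L \<tau>_def in auto)
    have sep: "x + L / 4 \<le> y" "y + L / 4 \<le> z" "x + L / 4 \<le> z" "a \<le> y" "a \<le> z" "z \<le> a + L" "y \<le> a + L" "x \<le> a + L"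
      using x y z \<eta> L by auto
    have "flat_circle A D t x \<or> flat_circle A D t y \<or> flat_circle A D t z"
      using cases[OF x(3)] cases[OF y(3)] cases[OF z(3)] sep x(1)
        uniq[of y x] uniq[of z x] uniq[of z y] uniq'[of y x] uniq'[of z x] uniq'[of z y] by blast
    then show "\<exists>r. a \<le> r \<and> r \<le> a + l \<and> flat_circle A D t r"
      using sep x(1) L(2) by (meson add_left_mono order_trans)
  qed
qed

section \<open>Boundary points away from the line\<close>

definition frame :: "real^2 \<Rightarrow> real^2 \<Rightarrow> bool" where
  "frame e f \<longleftrightarrow> e \<bullet> e = 1 \<and> f \<bullet> f = 1 \<and> e \<bullet> f = 0 \<and> (\<forall>p. p = (p \<bullet> e) *\<^sub>R e + (p \<bullet> f) *\<^sub>R f)"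

text \<open>The free sign of \<open>f\<close> allows the boundary point under consideration to be
  put above the axis, so that only upper arcs have to be treated later.\<close>

lemma frame_exists:
  fixes e q :: "real^2"
  assumes "norm e = 1"
  obtains f where "frame e f" "0 \<le> q \<bullet> f"
proof -
  define f where "f = (vector [- (e $ 2), e $ 1] :: real^2)"
  have f: "f $ 1 = - (e $ 2)" "f $ 2 = e $ 1" by (simp_all add: f_def)
  have e: "e $ 1 * e $ 1 + e $ 2 * e $ 2 = 1"
    using assms by (simp add: norm_eq_1 inner_vec_def sum_2)
  have exp: "p = (p \<bullet> e) *\<^sub>R e + (p \<bullet> f) *\<^sub>R f" for p
  proof -
    have "(p \<bullet> e) * e $ 1 + (p \<bullet> f) * f $ 1 = p $ 1 * (e $ 1 * e $ 1 + e $ 2 * e $ 2)"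
      "(p \<bullet> e) * e $ 2 + (p \<bullet> f) * f $ 2 = p $ 2 * (e $ 1 * e $ 1 + e $ 2 * e $ 2)"
      by (simp_all add: inner_vec_def sum_2 f algebra_simps)
    then show ?thesis by (simp add: vec_eq_iff forall_2 e)
  qed
  have fr: "frame e f"
    unfolding frame_def using e exp by (simp add: inner_vec_def sum_2 f add.commute)
  then have "frame e (- f)" unfolding frame_def by simp
  then show ?thesis using that[of f] that[of "- f"] fr by (cases "0 \<le> q \<bullet> f") auto
qed

definition plane_pt :: "real^2 \<Rightarrow> real \<Rightarrow> real^2 \<Rightarrow> real^2 \<Rightarrow> real \<Rightarrow> real \<Rightarrow> real^2" where
  "plane_pt x \<rho> e f u v = x + \<rho> *\<^sub>R (u *\<^sub>R e + v *\<^sub>R f)"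

lemma plane_pt_coords:
  assumes "frame e f" "0 < \<rho>"
  shows "plane_pt x \<rho> e f ((p - x) \<bullet> e / \<rho>) ((p - x) \<bullet> f / \<rho>) = p"
proof -
  have "(p - x) = ((p - x) \<bullet> e) *\<^sub>R e + ((p - x) \<bullet> f) *\<^sub>R f" using assms(1) by (simp add: frame_def)
  then show ?thesis using assms(2) by (simp add: plane_pt_def scaleR_add_right)
qed

lemma inner_plane_pt:
  assumes "frame e f" "0 < \<rho>"
  shows "(plane_pt x \<rho> e f u v - x) \<bullet> e / \<rho> = u" "(plane_pt x \<rho> e f u v - x) \<bullet> f / \<rho> = v"
  using assms by (simp_all add: plane_pt_def frame_def inner_add_left inner_commute[of f e])

lemma dist_plane_pt:
  assumes "frame e f" "0 < \<rho>"
  shows "dist (plane_pt x \<rho> e f u v) (plane_pt x \<rho> e f u' v') = \<rho> * sqrt ((u - u')\<^sup>2 + (v - v')\<^sup>2)"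
proof -
  have "plane_pt x \<rho> e f u v - plane_pt x \<rho> e f u' v' = \<rho> *\<^sub>R ((u - u') *\<^sub>R e + (v - v') *\<^sub>R f)"
    by (simp add: plane_pt_def algebra_simps)
  then have "dist (plane_pt x \<rho> e f u v) (plane_pt x \<rho> e f u' v') = \<rho> * norm ((u - u') *\<^sub>R e + (v - v') *\<^sub>R f)"
    using assms(2) by (simp add: dist_norm)
  also have "norm ((u - u') *\<^sub>R e + (v - v') *\<^sub>R f) = sqrt ((u - u')\<^sup>2 + (v - v')\<^sup>2)"
    using assms(1) unfolding norm_eq_sqrt_inner frame_def
    by (simp add: inner_add_left inner_add_right inner_commute[of f e] power2_eq_square)
  finally show ?thesis .
qed

text \<open>The factor 7 converts the relative tolerance into an absolute one for radii up to
  7.\<close>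

lemma half_split_imp_split_circle:
  assumes fr: "frame e f" and \<rho>: "0 < \<rho>" and r: "0 < r" "r \<le> 7" and \<kappa>: "0 < \<kappa>"
    and hs: "half_split \<Omega> \<kappa> (plane_pt x \<rho> e f c 0) (\<rho> * r)"
  shows "split_circle (\<lambda>u v. plane_pt x \<rho> e f (c + u) v \<in> \<Omega>)
    (\<lambda>u v. plane_pt x \<rho> e f (c + u) v \<in> exterior \<Omega>) (7 * \<kappa>) r"
proof -
  obtain n where n: "norm n = 1"
    "\<And>w. norm w = 1 \<Longrightarrow> \<kappa> \<le> n \<bullet> w \<Longrightarrow> plane_pt x \<rho> e f c 0 + (\<rho> * r) *\<^sub>R w \<in> \<Omega>"
    "\<And>w. norm w = 1 \<Longrightarrow> n \<bullet> w \<le> - \<kappa> \<Longrightarrow> plane_pt x \<rho> e f c 0 + (\<rho> * r) *\<^sub>R w \<in> exterior \<Omega>"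
    using hs unfolding half_split_def by blast
  have unit: "(n \<bullet> e)\<^sup>2 + (n \<bullet> f)\<^sup>2 = 1"
  proof -
    have "n = (n \<bullet> e) *\<^sub>R e + (n \<bullet> f) *\<^sub>R f" using fr unfolding frame_def by blast
    then have "n \<bullet> n = ((n \<bullet> e) *\<^sub>R e + (n \<bullet> f) *\<^sub>R f) \<bullet> n" by (rule arg_cong)
    also have "\<dots> = (n \<bullet> e)\<^sup>2 + (n \<bullet> f)\<^sup>2"
      by (simp add: inner_add_left inner_commute[of e n] inner_commute[of f n] power2_eq_square)
    finally show ?thesis using n(1) by (simp add: norm_eq_1)
  qed
  have pt: "plane_pt x \<rho> e f (c + u) v = plane_pt x \<rho> e f c 0 + (\<rho> * r) *\<^sub>R w"
    "norm w = 1" "n \<bullet> w = ((n \<bullet> e) * u + (n \<bullet> f) * v) / r"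
    if uv: "u\<^sup>2 + v\<^sup>2 = r\<^sup>2" and w: "w = (1 / r) *\<^sub>R (u *\<^sub>R e + v *\<^sub>R f)" for u v w
  proof -
    show "plane_pt x \<rho> e f (c + u) v = plane_pt x \<rho> e f c 0 + (\<rho> * r) *\<^sub>R w"
      using r by (simp add: plane_pt_def w algebra_simps)
    have "norm (u *\<^sub>R e + v *\<^sub>R f) = sqrt (u\<^sup>2 + v\<^sup>2)"
      using fr unfolding norm_eq_sqrt_inner frame_def
      by (simp add: inner_add_left inner_add_right inner_commute[of f e] power2_eq_square)
    then show "norm w = 1" using uv r by (simp add: w)
    show "n \<bullet> w = ((n \<bullet> e) * u + (n \<bullet> f) * v) / r"
      by (simp add: w inner_add_right algebra_simps add_divide_distrib)
  qed
  have \<kappa>r: "\<kappa> * r \<le> 7 * \<kappa>" using r \<kappa> by simp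
  show ?thesis unfolding split_circle_def
  proof (rule exI[of _ "n \<bullet> e"], rule exI[of _ "n \<bullet> f"], intro conjI unit allI impI)
    fix u v :: real assume uv: "u\<^sup>2 + v\<^sup>2 = r\<^sup>2" and "7 * \<kappa> < (n \<bullet> e) * u + (n \<bullet> f) * v"
    then have "\<kappa> \<le> ((n \<bullet> e) * u + (n \<bullet> f) * v) / r" using \<kappa>r r by (simp add: pos_le_divide_eq)
    then show "plane_pt x \<rho> e f (c + u) v \<in> \<Omega>"
      using n(2)[OF pt(2)[OF uv refl]] unfolding pt(3)[OF uv refl] pt(1)[OF uv refl] by blast
  next
    fix u v :: real assume uv: "u\<^sup>2 + v\<^sup>2 = r\<^sup>2" and "(n \<bullet> e) * u + (n \<bullet> f) * v < - (7 * \<kappa>)"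
    then have "((n \<bullet> e) * u + (n \<bullet> f) * v) / r \<le> - \<kappa>" using \<kappa>r r by (simp add: pos_divide_le_eq)
    then show "plane_pt x \<rho> e f (c + u) v \<in> exterior \<Omega>"
      using n(3)[OF pt(2)[OF uv refl]] unfolding pt(3)[OF uv refl] pt(1)[OF uv refl] by blast
  qed
qed

section \<open>Cells between circles about both centres\<close>

text \<open>Subtracting the two estimates locates the abscissa within \<open>\<beta> / d\<close>,
  and either one then controls the squared height. It is called \<open>w\<close> because for two
  given circles it is not known beforehand that they intersect, that is, that \<open>w\<close> is
  nonnegative.\<close>

lemma bipolar_height:
  fixes u w Y V d \<beta> :: real
  assumes d: "0 < d" "d \<le> 1" and \<beta>: "0 \<le> \<beta>" "\<beta> \<le> d" and Y: "\<bar>Y\<bar> \<le> 2"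
    and 1: "\<bar>u\<^sup>2 + w - (Y\<^sup>2 + V\<^sup>2)\<bar> \<le> \<beta>" and 2: "\<bar>(u - d)\<^sup>2 + w - ((Y - d)\<^sup>2 + V\<^sup>2)\<bar> \<le> \<beta>"
  shows "V\<^sup>2 - 6 * (\<beta> / d) \<le> w"
proof -
  have "u\<^sup>2 + w - (Y\<^sup>2 + V\<^sup>2) - ((u - d)\<^sup>2 + w - ((Y - d)\<^sup>2 + V\<^sup>2)) = 2 * d * (u - Y)"
    by (simp add: power2_eq_square algebra_simps)
  then have "\<bar>2 * d * (u - Y)\<bar> \<le> 2 * \<beta>" using 1 2 by linarith
  then have uY: "\<bar>u - Y\<bar> \<le> \<beta> / d" using d by (simp add: abs_mult pos_le_divide_eq mult.commute)
  have bd: "\<beta> \<le> \<beta> / d" "\<beta> / d \<le> 1" using \<beta> d by (simp_all add: pos_le_divide_eq mult_left_le)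
  have "\<bar>u + Y\<bar> \<le> 5" using uY bd Y by linarith
  then have "\<bar>u - Y\<bar> * \<bar>u + Y\<bar> \<le> \<beta> / d * 5" using uY by (intro mult_mono) auto
  moreover have "u\<^sup>2 - Y\<^sup>2 = (u - Y) * (u + Y)" by (simp add: power2_eq_square algebra_simps)
  ultimately have "\<bar>u\<^sup>2 - Y\<^sup>2\<bar> \<le> \<beta> / d * 5" by (simp add: abs_mult)
  then show ?thesis using 1 bd by linarith
qed

lemma exterior_disjoint: "\<Omega> \<inter> exterior \<Omega> = {}" "frontier \<Omega> \<inter> exterior \<Omega> = {}"
  using closure_subset[of \<Omega>] frontier_subset_closed[of "closure \<Omega>"]
  by (auto simp: exterior_def frontier_def)

text \<open>The part of the circle at height at least \<open>t\<close> is a connected graph over an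
  interval and avoids the boundary, so it cannot meet both sides.\<close>

lemma flat_arc_one_side:
  assumes \<Omega>: "open \<Omega>" and t: "0 < t"
    and flat: "flat_circle (\<lambda>u v. plane_pt x \<rho> e f (c + u) v \<in> \<Omega>)
      (\<lambda>u v. plane_pt x \<rho> e f (c + u) v \<in> exterior \<Omega>) t r"
    and q: "u\<^sup>2 + v\<^sup>2 = r\<^sup>2" "t \<le> v" "plane_pt x \<rho> e f (c + u) v \<in> \<Omega>"
    and q': "u'\<^sup>2 + v'\<^sup>2 = r\<^sup>2" "t \<le> v'" "plane_pt x \<rho> e f (c + u') v' \<in> exterior \<Omega>"
  shows False
proof -
  define k where "k = sqrt (r\<^sup>2 - t\<^sup>2)"
  define S where "S = (\<lambda>u. plane_pt x \<rho> e f (c + u) (sqrt (r\<^sup>2 - u\<^sup>2))) ` {- k..k}"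
  have k2: "k\<^sup>2 = r\<^sup>2 - t\<^sup>2" "0 \<le> k"
  proof -
    have "t\<^sup>2 \<le> v\<^sup>2" using q t by (intro power_mono) auto
    then have "0 \<le> r\<^sup>2 - t\<^sup>2" using q zero_le_power2[of u] by linarith
    then show "k\<^sup>2 = r\<^sup>2 - t\<^sup>2" "0 \<le> k" by (auto simp: k_def)
  qed
  have "connected S" unfolding S_def plane_pt_def
    by (intro connected_continuous_image continuous_intros connected_Icc)
  have inS: "plane_pt x \<rho> e f (c + a) b \<in> S" if ab: "a\<^sup>2 + b\<^sup>2 = r\<^sup>2" "t \<le> b" for a b
  proof -
    have "t\<^sup>2 \<le> b\<^sup>2" using ab t by (intro power_mono) auto
    then have "\<bar>a\<bar>\<^sup>2 \<le> k\<^sup>2" using ab k2 by simp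
    then have "\<bar>a\<bar> \<le> k" by (rule power2_le_imp_le) (rule k2)
    moreover have "sqrt (r\<^sup>2 - a\<^sup>2) = b" using ab t by (simp flip: ab(1))
    ultimately show ?thesis by (force simp: S_def abs_le_iff)
  qed
  have "S \<inter> frontier \<Omega> = {}"
  proof -
    have "p \<notin> frontier \<Omega>" if pS: "p \<in> S" for p
    proof -
      obtain a where a: "- k \<le> a" "a \<le> k" "p = plane_pt x \<rho> e f (c + a) (sqrt (r\<^sup>2 - a\<^sup>2))"
        using pS by (auto simp: S_def)
      have "\<bar>a\<bar>\<^sup>2 \<le> k\<^sup>2" using a by (intro power_mono) auto
      then have a2: "t\<^sup>2 \<le> r\<^sup>2 - a\<^sup>2" using k2 by simp
      then have "t \<le> sqrt (r\<^sup>2 - a\<^sup>2)" using real_le_rsqrt by blast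
      moreover have "0 \<le> r\<^sup>2 - a\<^sup>2" using a2 zero_le_power2[of t] by linarith
      then have "a\<^sup>2 + (sqrt (r\<^sup>2 - a\<^sup>2))\<^sup>2 = r\<^sup>2" by simp
      ultimately have "p \<in> \<Omega> \<or> p \<in> exterior \<Omega>"
        using flat a(3) unfolding flat_circle_def by (metis abs_ge_self order_trans)
      moreover have "frontier \<Omega> \<inter> \<Omega> = {}" using \<Omega> by (auto simp: frontier_def interior_open)
      ultimately show ?thesis using exterior_disjoint(2) by blast
    qed
    then show ?thesis by blast
  qed
  moreover have "S \<inter> \<Omega> \<noteq> {}" using inS[OF q(1,2)] q(3) by blast
  moreover have "S - \<Omega> \<noteq> {}" using inS[OF q'(1,2)] q'(3) exterior_disjoint(1) by blast
  ultimately show False using connected_Int_frontier[OF \<open>connected S\<close>] by blast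
qed

lemma less_ediameter:
  assumes "x \<in> closure S" "x' \<in> closure S" "0 \<le> r" "r < dist x x'"
  shows "ennreal r < ediameter S"
proof -
  define \<gamma> where "\<gamma> = (dist x x' - r) / 2"
  have \<gamma>: "0 < \<gamma>" using assms by (simp add: \<gamma>_def)
  obtain a where a: "a \<in> S" "dist a x < \<gamma>" using assms(1) \<gamma> unfolding closure_approachable by blast
  obtain b where b: "b \<in> S" "dist b x' < \<gamma>" using assms(2) \<gamma> unfolding closure_approachable by blast
  have "dist x x' \<le> dist a x + dist a b + dist b x'"
    using dist_triangle[of x x' a] dist_triangle[of a x' b] by (simp add: dist_commute)
  then have "r < dist a b" using a b by (simp add: \<gamma>_def)
  then have "ennreal r < ennreal (dist a b)" using assms(3) by (simp add: ennreal_less_iff)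
  also have "\<dots> \<le> ediameter S" unfolding ediameter_def using a b by (intro SUP_upper2[of "(a, b)"]) auto
  finally show ?thesis .
qed

lemma abs_diff_squares_le:
  fixes r s m :: real
  assumes "\<bar>r - s\<bar> \<le> m" "0 \<le> r" "r \<le> 3" "0 \<le> s" "s \<le> 2"
  shows "\<bar>r\<^sup>2 - s\<^sup>2\<bar> \<le> 5 * m"
proof -
  have "\<bar>r\<^sup>2 - s\<^sup>2\<bar> = \<bar>r - s\<bar> * \<bar>r + s\<bar>" by (simp add: power2_eq_square algebra_simps flip: abs_mult)
  also have "\<dots> \<le> m * 5" using assms by (intro mult_mono) auto
  finally show ?thesis by simp
qed

text \<open>\<open>P\<close> is the coordinate map and \<open>c\<close> the abscissa of the common
  centre; every interval of length \<open>l\<close> in \<open>[t, 3]\<close> contains a flat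
  radius.\<close>

definition flat_dense :: "(real^2) set \<Rightarrow> (real \<Rightarrow> real \<Rightarrow> real^2) \<Rightarrow> real \<Rightarrow> real \<Rightarrow> real \<Rightarrow> bool" where
  "flat_dense \<Omega> P t l c \<longleftrightarrow> (\<forall>a. t \<le> a \<longrightarrow> a + l \<le> 3 \<longrightarrow>
     (\<exists>r. a \<le> r \<and> r \<le> a + l \<and> flat_circle (\<lambda>u v. P (c + u) v \<in> \<Omega>) (\<lambda>u v. P (c + u) v \<in> exterior \<Omega>) t r))"

lemma flat_denseD:
  assumes "flat_dense \<Omega> P t l c" "t \<le> a" "a + l \<le> 3"
  obtains r where "a \<le> r" "r \<le> a + l"
    "flat_circle (\<lambda>u v. P (c + u) v \<in> \<Omega>) (\<lambda>u v. P (c + u) v \<in> exterior \<Omega>) t r"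
  using assms unfolding flat_dense_def by blast

lemma flat_circle_not_frontier:
  assumes \<Omega>: "open \<Omega>"
    and flat: "flat_circle (\<lambda>u v. P (c + u) v \<in> \<Omega>) (\<lambda>u v. P (c + u) v \<in> exterior \<Omega>) t r"
    and uv: "(u - c)\<^sup>2 + v\<^sup>2 = r\<^sup>2" "t \<le> v"
  shows "P u v \<notin> frontier \<Omega>"
proof -
  have "P (c + (u - c)) v \<in> \<Omega> \<or> P (c + (u - c)) v \<in> exterior \<Omega>"
    using flat uv unfolding flat_circle_def by (metis abs_ge_self order_trans)
  moreover have "frontier \<Omega> \<inter> \<Omega> = {}" using \<Omega> by (auto simp: frontier_def interior_open)
  ultimately show ?thesis using exterior_disjoint(2) by auto
qed

text \<open>Flat circles just inside and just outside the point, about both centres, bound a cell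
  \<open>Q\<close> in the upper half plane. By \<open>bipolar_height\<close> even the closed cell
  has height at least \<open>t\<close>, where these circles miss the boundary. Hence the boundary
  meets \<open>Q\<close> in a relatively clopen set, which contains the high point but not the
  centre.\<close>

lemma connected_frontier_near_line:
  fixes Y V t l d :: real
  assumes \<Omega>: "open \<Omega>" and conn: "connected (frontier \<Omega>)"
    and fr: "frame e f" and \<rho>: "0 < \<rho>"
    and flat0: "flat_dense \<Omega> (plane_pt x \<rho> e f) t l 0" and flat1: "flat_dense \<Omega> (plane_pt x \<rho> e f) t l d"
    and t: "0 < t" and d: "0 < d" "d \<le> 1" and l: "0 < l" "2 * l \<le> t" "20 * (l / d) \<le> t\<^sup>2" "10 * l \<le> d"
    and x: "plane_pt x \<rho> e f 0 0 \<in> frontier \<Omega>"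
    and y: "plane_pt x \<rho> e f Y V \<in> frontier \<Omega>" "Y\<^sup>2 + V\<^sup>2 \<le> 2\<^sup>2" "(Y - d)\<^sup>2 + V\<^sup>2 \<le> 2\<^sup>2"
    and V: "2 * t \<le> V"
  shows False
proof -
  let ?P = "plane_pt x \<rho> e f"
  define N where "N = (\<lambda>c. sqrt ((Y - c)\<^sup>2 + V\<^sup>2))"
  have N2: "(N c)\<^sup>2 = (Y - c)\<^sup>2 + V\<^sup>2" for c by (simp add: N_def)
  have NV: "2 * t \<le> N c" for c
  proof -
    have "V \<le> N c" unfolding N_def by (rule real_le_rsqrt) simp
    then show ?thesis using V by linarith
  qed
  have N0: "N 0 \<le> 2" "N d \<le> 2" using y by (auto simp: N_def intro!: real_le_lsqrt)
  have radii: "\<exists>a b. N c - 2 * l \<le> a \<and> a < N c \<and> N c < b \<and> b \<le> N c + 2 * l \<and>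
      flat_circle (\<lambda>u v. ?P (c + u) v \<in> \<Omega>) (\<lambda>u v. ?P (c + u) v \<in> exterior \<Omega>) t a \<and>
      flat_circle (\<lambda>u v. ?P (c + u) v \<in> \<Omega>) (\<lambda>u v. ?P (c + u) v \<in> exterior \<Omega>) t b"
    if c: "flat_dense \<Omega> ?P t l c" "N c \<le> 2" for c
  proof -
    have "t \<le> N c - 2 * l" "N c - 2 * l + l \<le> 3" "t \<le> N c + l / 2" "N c + l / 2 + l \<le> 3"
      using NV[of c] l c(2) t d by auto
    then obtain a b where "N c - 2 * l \<le> a" "a \<le> N c - 2 * l + l" "N c + l / 2 \<le> b" "b \<le> N c + l / 2 + l"
      "flat_circle (\<lambda>u v. ?P (c + u) v \<in> \<Omega>) (\<lambda>u v. ?P (c + u) v \<in> exterior \<Omega>) t a"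
      "flat_circle (\<lambda>u v. ?P (c + u) v \<in> \<Omega>) (\<lambda>u v. ?P (c + u) v \<in> exterior \<Omega>) t b"
      using c(1) by (metis flat_denseD)
    then show ?thesis using l by (intro exI[of _ a] exI[of _ b]) auto
  qed
  obtain a0 b0 where r0: "N 0 - 2 * l \<le> a0" "a0 < N 0" "N 0 < b0" "b0 \<le> N 0 + 2 * l"
    "flat_circle (\<lambda>u v. ?P (0 + u) v \<in> \<Omega>) (\<lambda>u v. ?P (0 + u) v \<in> exterior \<Omega>) t a0"
    "flat_circle (\<lambda>u v. ?P (0 + u) v \<in> \<Omega>) (\<lambda>u v. ?P (0 + u) v \<in> exterior \<Omega>) t b0"
    using radii[OF flat0 N0(1)] by blast
  obtain a1 b1 where r1: "N d - 2 * l \<le> a1" "a1 < N d" "N d < b1" "b1 \<le> N d + 2 * l"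
    "flat_circle (\<lambda>u v. ?P (d + u) v \<in> \<Omega>) (\<lambda>u v. ?P (d + u) v \<in> exterior \<Omega>) t a1"
    "flat_circle (\<lambda>u v. ?P (d + u) v \<in> \<Omega>) (\<lambda>u v. ?P (d + u) v \<in> exterior \<Omega>) t b1"
    using radii[OF flat1 N0(2)] by blast
  have pos: "0 < a0" "0 < a1" using r0(1) r1(1) NV[of 0] NV[of d] l t by linarith+
  have sq: "\<bar>a0\<^sup>2 - (N 0)\<^sup>2\<bar> \<le> 10 * l" "\<bar>b0\<^sup>2 - (N 0)\<^sup>2\<bar> \<le> 10 * l"
    "\<bar>a1\<^sup>2 - (N d)\<^sup>2\<bar> \<le> 10 * l" "\<bar>b1\<^sup>2 - (N d)\<^sup>2\<bar> \<le> 10 * l"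
    using abs_diff_squares_le[of a0 "N 0" "2 * l"] abs_diff_squares_le[of b0 "N 0" "2 * l"]
      abs_diff_squares_le[of a1 "N d" "2 * l"] abs_diff_squares_le[of b1 "N d" "2 * l"] r0(1-4) r1(1-4) N0 l pos d
    by (simp_all add: abs_le_iff)
  define u where "u = (\<lambda>p. (p - x) \<bullet> e / \<rho>)"
  define v where "v = (\<lambda>p. (p - x) \<bullet> f / \<rho>)"
  have cont: "continuous_on UNIV u" "continuous_on UNIV v"
    unfolding u_def v_def by (intro continuous_intros; use \<rho> in simp)+
  have Pp: "?P (u p) (v p) = p" for p unfolding u_def v_def by (rule plane_pt_coords[OF fr \<rho>])
  have uv: "u (?P a b) = a" "v (?P a b) = b" for a b unfolding u_def v_def by (rule inner_plane_pt[OF fr \<rho>])+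
  define Q where "Q = {p. a0\<^sup>2 < (u p)\<^sup>2 + (v p)\<^sup>2} \<inter> {p. (u p)\<^sup>2 + (v p)\<^sup>2 < b0\<^sup>2} \<inter>
     {p. a1\<^sup>2 < (u p - d)\<^sup>2 + (v p)\<^sup>2} \<inter> {p. (u p - d)\<^sup>2 + (v p)\<^sup>2 < b1\<^sup>2} \<inter> {p. 0 < v p}"
  define Q' where "Q' = {p. a0\<^sup>2 \<le> (u p)\<^sup>2 + (v p)\<^sup>2} \<inter> {p. (u p)\<^sup>2 + (v p)\<^sup>2 \<le> b0\<^sup>2} \<inter>
     {p. a1\<^sup>2 \<le> (u p - d)\<^sup>2 + (v p)\<^sup>2} \<inter> {p. (u p - d)\<^sup>2 + (v p)\<^sup>2 \<le> b1\<^sup>2} \<inter> {p. 0 \<le> v p}"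
  have "open Q" unfolding Q_def by (intro open_Int open_Collect_less continuous_intros cont)
  moreover have "closed Q'" unfolding Q'_def by (intro closed_Int closed_Collect_le continuous_intros cont)
  moreover have eq: "frontier \<Omega> \<inter> Q' = frontier \<Omega> \<inter> Q"
  proof
    show "frontier \<Omega> \<inter> Q \<subseteq> frontier \<Omega> \<inter> Q'" by (auto simp: Q_def Q'_def)
    show "frontier \<Omega> \<inter> Q' \<subseteq> frontier \<Omega> \<inter> Q"
    proof safe
      fix p assume p: "p \<in> frontier \<Omega>" "p \<in> Q'"
      have b: "a0\<^sup>2 \<le> (u p)\<^sup>2 + (v p)\<^sup>2" "(u p)\<^sup>2 + (v p)\<^sup>2 \<le> b0\<^sup>2" "0 \<le> v p"
        "a1\<^sup>2 \<le> (u p - d)\<^sup>2 + (v p)\<^sup>2" "(u p - d)\<^sup>2 + (v p)\<^sup>2 \<le> b1\<^sup>2"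
        using p(2) by (auto simp: Q'_def)
      \<comment> \<open>Radii within \<open>2 * l\<close> have squares within \<open>10 * l\<close>;
        as \<open>V\<^sup>2 \<ge> 4 * t\<^sup>2\<close>, the assumption
        \<open>20 * (l / d) \<le> t\<^sup>2\<close> leaves \<open>t\<^sup>2\<close>.\<close>
      have "V\<^sup>2 - 6 * (10 * l / d) \<le> (v p)\<^sup>2"
      proof (rule bipolar_height[OF d, of "10 * l" Y "u p"])
        have "\<bar>Y\<bar>\<^sup>2 \<le> 2\<^sup>2" using y(2) zero_le_power2[of V] unfolding power2_abs by linarith
        then show "\<bar>Y\<bar> \<le> 2" by (rule power2_le_imp_le) simp
        show "\<bar>(u p)\<^sup>2 + (v p)\<^sup>2 - (Y\<^sup>2 + V\<^sup>2)\<bar> \<le> 10 * l"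
          using b(1,2) sq(1,2) N2[of 0] unfolding abs_le_iff by simp
        show "\<bar>(u p - d)\<^sup>2 + (v p)\<^sup>2 - ((Y - d)\<^sup>2 + V\<^sup>2)\<bar> \<le> 10 * l"
          using b(4,5) sq(3,4) N2[of d] unfolding abs_le_iff by simp
      qed (use l in auto)
      moreover have "(2 * t)\<^sup>2 \<le> V\<^sup>2" using V t by (intro power_mono) auto
      ultimately have "t\<^sup>2 \<le> (v p)\<^sup>2" using l(3) by (simp add: power_mult_distrib)
      then have vt: "t \<le> v p" by (rule power2_le_imp_le) (rule b(3))
      have nf: "(u p - c)\<^sup>2 + (v p)\<^sup>2 \<noteq> r\<^sup>2"
        if "flat_circle (\<lambda>u v. ?P (c + u) v \<in> \<Omega>) (\<lambda>u v. ?P (c + u) v \<in> exterior \<Omega>) t r" for c r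
        using flat_circle_not_frontier[OF \<Omega> that _ vt, of "u p"] p(1) Pp by auto
      show "p \<in> Q"
        using b vt t nf[OF r0(5)] nf[OF r0(6)] nf[OF r1(5)] nf[OF r1(6)] by (auto simp: Q_def)
    qed
  qed
  ultimately have "frontier \<Omega> \<inter> Q = {} \<or> frontier \<Omega> \<inter> Q = frontier \<Omega>"
    using conn unfolding connected_clopen
    by (metis closedin_closed_Int openin_open_Int)
  moreover have "?P Y V \<in> frontier \<Omega> \<inter> Q"
  proof -
    have "a0\<^sup>2 < (N 0)\<^sup>2" "(N 0)\<^sup>2 < b0\<^sup>2" "a1\<^sup>2 < (N d)\<^sup>2" "(N d)\<^sup>2 < b1\<^sup>2"
      using r0 r1 pos NV[of 0] NV[of d] t by (auto intro!: power_strict_mono)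
    then show ?thesis using y(1) V t by (simp add: Q_def uv N2)
  qed
  moreover have "?P 0 0 \<notin> Q" by (simp add: Q_def uv)
  ultimately show False using x by blast
qed

text \<open>Near the high point, an upper flat arc about the first centre meets
  \<open>\<Omega>\<close>, and one about the second centre meets the exterior. Each arc lies on one
  side only, but the two arcs cross at height at least \<open>t\<close>, so the crossing point would
  be on both sides.\<close>

lemma two_sided_corkscrew_near_line:
  fixes Y V t l d c \<sigma> :: real
  assumes \<Omega>: "two_sided_corkscrew c \<Omega>" and c: "0 < c"
    and fr: "frame e f" and \<rho>: "0 < \<rho>"
    and flat0: "flat_dense \<Omega> (plane_pt x \<rho> e f) t l 0" and flat1: "flat_dense \<Omega> (plane_pt x \<rho> e f) t l d"
    and t: "0 < t" and d: "0 < d" "d \<le> 1"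
    and \<sigma>: "0 < \<sigma>" "\<sigma> < d" "\<sigma> \<le> t / 2" "20 * (\<sigma> / d) \<le> t\<^sup>2" "10 * \<sigma> \<le> d"
    and l: "0 < l" "l < c * \<sigma>" "l \<le> \<sigma>"
    and x: "plane_pt x \<rho> e f 0 0 \<in> frontier \<Omega>" "plane_pt x \<rho> e f d 0 \<in> frontier \<Omega>"
    and y: "plane_pt x \<rho> e f Y V \<in> frontier \<Omega>" "Y\<^sup>2 + V\<^sup>2 \<le> 2\<^sup>2" "(Y - d)\<^sup>2 + V\<^sup>2 \<le> 2\<^sup>2"
    and V: "2 * t \<le> V"
  shows False
proof -
  let ?P = "plane_pt x \<rho> e f"
  have op: "open \<Omega>" and cs: "corkscrew c \<Omega>" "corkscrew c (exterior \<Omega>)"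
    and fe: "frontier (exterior \<Omega>) = frontier \<Omega>"
    using \<Omega> by (auto simp: two_sided_corkscrew_def)
  have dist_xx: "\<sigma> * \<rho> < dist (?P 0 0) (?P d 0)"
    using \<sigma> \<rho> d by (simp add: dist_plane_pt[OF fr \<rho>] mult.commute)
  have pick: "\<exists>r u v. \<bar>r - sqrt ((Y - k)\<^sup>2 + V\<^sup>2)\<bar> \<le> 2 * \<sigma> \<and> 0 \<le> r \<and> r \<le> 3 \<and> u\<^sup>2 + v\<^sup>2 = r\<^sup>2 \<and> t \<le> v \<and> ?P (k + u) v \<in> S \<and>
      flat_circle (\<lambda>u v. ?P (k + u) v \<in> \<Omega>) (\<lambda>u v. ?P (k + u) v \<in> exterior \<Omega>) t r"
    if cs: "corkscrew c S" and fS: "frontier S = frontier \<Omega>"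
      and flat: "flat_dense \<Omega> ?P t l k" and Yk: "(Y - k)\<^sup>2 + V\<^sup>2 \<le> 2\<^sup>2" for S k
  proof -
    have "ennreal (\<sigma> * \<rho>) < ediameter S"
      using less_ediameter[OF _ _ _ dist_xx, of S] x fS \<sigma> \<rho> by (auto simp: frontier_def)
    moreover have "?P Y V \<in> frontier S" "0 < \<sigma> * \<rho>" using y(1) fS \<sigma> \<rho> by auto
    ultimately obtain p s where ps: "0 < s" "c * (\<sigma> * \<rho>) \<le> s" "ball p s \<subseteq> S \<inter> cball (?P Y V) (\<sigma> * \<rho>)"
      using cs unfolding corkscrew_def by blast
    obtain a b where p: "p = ?P (k + a) b"
      using plane_pt_coords[OF fr \<rho>, of x p] that by (metis add_diff_cancel_left' diff_add_cancel add.commute)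
    have "p \<in> ball p s" using ps(1) by simp
    then have "p \<in> cball (?P Y V) (\<sigma> * \<rho>)" using ps(3) by blast
    then have near: "sqrt ((Y - (k + a))\<^sup>2 + (V - b)\<^sup>2) \<le> \<sigma>"
      using \<rho> by (simp add: p dist_plane_pt[OF fr \<rho>] mult.commute)
    define n where "n = sqrt (a\<^sup>2 + b\<^sup>2)"
    define m where "m = sqrt ((Y - k)\<^sup>2 + V\<^sup>2)"
    have n_near: "\<bar>n - m\<bar> \<le> \<sigma>"
    proof -
      have "\<bar>norm (Complex a b) - norm (Complex (Y - k) V)\<bar> \<le> norm (Complex a b - Complex (Y - k) V)"
        by (rule norm_triangle_ineq3)
      also have "norm (Complex a b - Complex (Y - k) V) = sqrt ((Y - (k + a))\<^sup>2 + (V - b)\<^sup>2)"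
        by (simp add: cmod_def power2_eq_square algebra_simps)
      finally show ?thesis using near by (simp add: cmod_def n_def m_def)
    qed
    have "V \<le> m" unfolding m_def by (rule real_le_rsqrt) simp
    then have "2 * t \<le> m" using V by linarith
    moreover have "m \<le> 2" unfolding m_def using Yk by (intro real_le_lsqrt) auto
    ultimately have m: "2 * t \<le> m" "m \<le> 2" by auto
    have "\<bar>V - b\<bar> = sqrt ((V - b)\<^sup>2)" by simp
    also have "\<dots> \<le> sqrt ((Y - (k + a))\<^sup>2 + (V - b)\<^sup>2)" by (intro real_sqrt_le_mono) simp
    finally have "\<bar>V - b\<bar> \<le> \<sigma>" using near by linarith
    then have b: "t \<le> b" using V \<sigma> t by linarith
    have n: "t \<le> n" "n + l \<le> 3" using n_near m \<sigma> l t d by linarith+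
    obtain r where r: "n \<le> r" "r \<le> n + l"
      "flat_circle (\<lambda>u v. ?P (k + u) v \<in> \<Omega>) (\<lambda>u v. ?P (k + u) v \<in> exterior \<Omega>) t r"
      using flat_denseD[OF flat n] by blast
    have n0: "0 < n" using n t by linarith
    \<comment> \<open>The centre of the corkscrew ball is pushed radially onto a flat circle. It
      moves by at most \<open>\<rho> * l < c * \<sigma> * \<rho> \<le> s\<close>, so it stays in the
      ball.\<close>
    define q where "q = r / n"
    have q: "1 \<le> q" "q * n = r" using r n0 by (auto simp: q_def)
    have n2: "n\<^sup>2 = a\<^sup>2 + b\<^sup>2" by (simp add: n_def)
    have "(q * a)\<^sup>2 + (q * b)\<^sup>2 = (q * n)\<^sup>2" by (simp add: power_mult_distrib n2 algebra_simps)
    then have on: "(q * a)\<^sup>2 + (q * b)\<^sup>2 = r\<^sup>2" by (simp add: q)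
    have "1 * b \<le> q * b" using q b t by (intro mult_right_mono) auto
    then have bq: "t \<le> q * b" using b by simp
    have "dist p (?P (k + q * a) (q * b)) = \<rho> * sqrt ((a - q * a)\<^sup>2 + (b - q * b)\<^sup>2)"
      by (simp add: p dist_plane_pt[OF fr \<rho>])
    also have "(a - q * a)\<^sup>2 + (b - q * b)\<^sup>2 = ((q - 1) * n)\<^sup>2"
      unfolding power_mult_distrib n2 by (simp add: power2_eq_square algebra_simps)
    also have "sqrt (((q - 1) * n)\<^sup>2) = r - n" using q n0 by (simp add: left_diff_distrib r)
    also have "\<rho> * (r - n) \<le> \<rho> * l" using r \<rho> by (intro mult_left_mono) auto
    also have "\<dots> < s"
    proof -
      have "\<rho> * l < \<rho> * (c * \<sigma>)" using l(2) \<rho> by (rule mult_strict_left_mono)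
      also have "\<dots> = c * (\<sigma> * \<rho>)" by simp
      finally show ?thesis using ps(2) by linarith
    qed
    finally have "?P (k + q * a) (q * b) \<in> S" using ps(3) by auto
    moreover have "\<bar>r - m\<bar> \<le> 2 * \<sigma>" using r n_near l by linarith
    moreover have "0 \<le> r" "r \<le> 3" using r n n0 by auto
    ultimately show ?thesis using on bq r(3) unfolding m_def by blast
  qed
  obtain r0 u0 v0 where r0: "\<bar>r0 - sqrt ((Y - 0)\<^sup>2 + V\<^sup>2)\<bar> \<le> 2 * \<sigma>" "0 \<le> r0" "r0 \<le> 3" "u0\<^sup>2 + v0\<^sup>2 = r0\<^sup>2" "t \<le> v0"
     "?P (0 + u0) v0 \<in> \<Omega>"
     "flat_circle (\<lambda>u v. ?P (0 + u) v \<in> \<Omega>) (\<lambda>u v. ?P (0 + u) v \<in> exterior \<Omega>) t r0"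
    using pick[OF cs(1) refl flat0] y(2) by auto
  obtain r1 u1 v1 where r1: "\<bar>r1 - sqrt ((Y - d)\<^sup>2 + V\<^sup>2)\<bar> \<le> 2 * \<sigma>" "0 \<le> r1" "r1 \<le> 3" "u1\<^sup>2 + v1\<^sup>2 = r1\<^sup>2" "t \<le> v1"
     "?P (d + u1) v1 \<in> exterior \<Omega>"
     "flat_circle (\<lambda>u v. ?P (d + u) v \<in> \<Omega>) (\<lambda>u v. ?P (d + u) v \<in> exterior \<Omega>) t r1"
    using pick[OF cs(2) fe flat1 y(3)] by blast
  \<comment> \<open>Abscissa of the crossing point of the two circles, \<open>w\<close> being its
    squared height.\<close>
  define u where "u = (r0\<^sup>2 - r1\<^sup>2 + d\<^sup>2) / (2 * d)"
  define w where "w = r0\<^sup>2 - u\<^sup>2"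
  have c0: "u\<^sup>2 + w = r0\<^sup>2" by (simp add: w_def)
  have "2 * d * u = r0\<^sup>2 - r1\<^sup>2 + d\<^sup>2" using d by (simp add: u_def)
  then have c1: "(u - d)\<^sup>2 + w = r1\<^sup>2" by (simp add: w_def power2_eq_square algebra_simps)
  have "V\<^sup>2 - 6 * (10 * \<sigma> / d) \<le> w"
  proof (rule bipolar_height[OF d, of "10 * \<sigma>" Y u])
    have "\<bar>Y\<bar>\<^sup>2 \<le> 2\<^sup>2" using y(2) zero_le_power2[of V] unfolding power2_abs by linarith
    then show "\<bar>Y\<bar> \<le> 2" by (rule power2_le_imp_le) simp
    have "sqrt (Y\<^sup>2 + V\<^sup>2) \<le> 2" "sqrt ((Y - d)\<^sup>2 + V\<^sup>2) \<le> 2" using y by (auto intro!: real_le_lsqrt)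
    then show "\<bar>u\<^sup>2 + w - (Y\<^sup>2 + V\<^sup>2)\<bar> \<le> 10 * \<sigma>" "\<bar>(u - d)\<^sup>2 + w - ((Y - d)\<^sup>2 + V\<^sup>2)\<bar> \<le> 10 * \<sigma>"
      using abs_diff_squares_le[OF r0(1-3)] abs_diff_squares_le[OF r1(1-3)] by (auto simp: c0 c1)
  qed (use \<sigma> in auto)
  moreover have "(2 * t)\<^sup>2 \<le> V\<^sup>2" using V t by (intro power_mono) auto
  ultimately have tw: "t\<^sup>2 \<le> w" using \<sigma>(4) by (simp add: power_mult_distrib)
  define v where "v = sqrt w"
  have "0 \<le> w" using tw zero_le_power2[of t] by linarith
  then have v: "v\<^sup>2 = w" "t \<le> v" using tw real_le_rsqrt by (auto simp: v_def)
  have frpt: "?P u v \<in> \<Omega> \<or> ?P u v \<in> exterior \<Omega>"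
    using r0(7)[unfolded flat_circle_def, rule_format, of u v] c0 v by simp
  have "?P u v \<notin> exterior \<Omega>"
    using flat_arc_one_side[OF op t r0(7) r0(4,5,6), of u v] c0 v by auto
  then have "?P (d + (u - d)) v \<in> \<Omega>" using frpt by simp
  then show False
    using flat_arc_one_side[OF op t r1(7) _ v(2) _ r1(4,5,6), of "u - d"] c1 v by auto
qed

section \<open>Smallness of the beta number\<close>

lemma split_circle_mono:
  assumes "split_circle A D \<kappa> r" "\<kappa> \<le> \<kappa>'"
  shows "split_circle A D \<kappa>' r"
proof -
  obtain a b where ab: "a\<^sup>2 + b\<^sup>2 = 1"
    "\<And>u v. u\<^sup>2 + v\<^sup>2 = r\<^sup>2 \<Longrightarrow> \<kappa> < a * u + b * v \<Longrightarrow> A u v"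
    "\<And>u v. u\<^sup>2 + v\<^sup>2 = r\<^sup>2 \<Longrightarrow> a * u + b * v < - \<kappa> \<Longrightarrow> D u v"
    using assms(1) unfolding split_circle_def by blast
  show ?thesis unfolding split_circle_def
  proof (rule exI[of _ a], rule exI[of _ b], intro conjI ab(1) allI impI)
    fix u v assume "u\<^sup>2 + v\<^sup>2 = r\<^sup>2" "\<kappa>' < a * u + b * v"
    then show "A u v" using ab(2) assms(2) by auto
  next
    fix u v assume "u\<^sup>2 + v\<^sup>2 = r\<^sup>2" "a * u + b * v < - \<kappa>'"
    then show "D u v" using ab(3) assms(2) by auto
  qed
qed

lemma split_circle_mirror:
  assumes "split_circle A D \<kappa> r"
  shows "split_circle (\<lambda>u. A (- u)) (\<lambda>u. D (- u)) \<kappa> r"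
proof -
  obtain a b where ab: "a\<^sup>2 + b\<^sup>2 = 1"
    "\<And>u v. u\<^sup>2 + v\<^sup>2 = r\<^sup>2 \<Longrightarrow> \<kappa> < a * u + b * v \<Longrightarrow> A u v"
    "\<And>u v. u\<^sup>2 + v\<^sup>2 = r\<^sup>2 \<Longrightarrow> a * u + b * v < - \<kappa> \<Longrightarrow> D u v"
    using assms(1) unfolding split_circle_def by blast
  show ?thesis unfolding split_circle_def
  proof (rule exI[of _ "- a"], rule exI[of _ b], intro conjI allI impI)
    show "(- a)\<^sup>2 + b\<^sup>2 = 1" using ab(1) by simp
  next
    fix u v assume "u\<^sup>2 + v\<^sup>2 = r\<^sup>2" "\<kappa> < - a * u + b * v"
    then show "A (- u) v" using ab(2)[of "- u" v] by auto
  next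
    fix u v assume "u\<^sup>2 + v\<^sup>2 = r\<^sup>2" "- a * u + b * v < - \<kappa>"
    then show "D (- u) v" using ab(3)[of "- u" v] by auto
  qed
qed

lemma good_radius_exists:
  assumes few: "emeasure lborel (bad_radii \<Omega> \<kappa> (7 * \<rho>) x) < ennreal (\<eta> * \<rho>)"
    and \<Omega>: "open \<Omega>" and \<rho>: "0 < \<rho>" and \<eta>: "0 < \<eta>" and a: "0 \<le> a" "a + \<eta> \<le> 5"
  obtains r where "a < r" "r < a + \<eta>" "half_split \<Omega> \<kappa> x (\<rho> * r)"
proof -
  have "\<not> {\<rho> * a<..<\<rho> * (a + \<eta>)} \<subseteq> bad_radii \<Omega> \<kappa> (7 * \<rho>) x"
  proof
    assume "{\<rho> * a<..<\<rho> * (a + \<eta>)} \<subseteq> bad_radii \<Omega> \<kappa> (7 * \<rho>) x"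
    then have "emeasure lborel {\<rho> * a<..<\<rho> * (a + \<eta>)} \<le> emeasure lborel (bad_radii \<Omega> \<kappa> (7 * \<rho>) x)"
      using bad_radii_measurable(1)[OF \<Omega>] by (intro emeasure_mono) auto
    moreover have "\<rho> * a \<le> \<rho> * (a + \<eta>)" using \<rho> \<eta> by simp
    moreover have "\<rho> * (a + \<eta>) - \<rho> * a = \<eta> * \<rho>" by (simp add: algebra_simps)
    ultimately show False using few by simp
  qed
  then obtain s where "s \<in> {\<rho> * a<..<\<rho> * (a + \<eta>)}" and s3: "s \<notin> bad_radii \<Omega> \<kappa> (7 * \<rho>) x"
    by blast
  then have s: "\<rho> * a < s" "s < \<rho> * (a + \<eta>)" by auto
  have "0 \<le> \<rho> * a" "\<rho> * (a + \<eta>) \<le> \<rho> * 5" using \<rho> a by (auto intro: mult_left_mono)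
  then have "0 < s" "s < 7 * \<rho>" using s \<rho> by linarith+
  then have "half_split \<Omega> \<kappa> x s" using s3 by (auto simp: bad_radii_def)
  moreover have "a < s / \<rho>" "s / \<rho> < a + \<eta>" using s \<rho> by (auto simp: field_simps)
  ultimately show ?thesis using that[of "s / \<rho>"] \<rho> by simp
qed

lemma split_circle_dense:
  assumes few: "emeasure lborel (bad_radii \<Omega> \<kappa> (7 * \<rho>) (plane_pt x \<rho> e f c 0)) < ennreal (\<eta> * \<rho>)"
    and \<Omega>: "open \<Omega>" and \<rho>: "0 < \<rho>" and \<eta>: "0 < \<eta>" and a: "0 \<le> a" "a + \<eta> \<le> 5"
    and fr: "frame e f" and \<kappa>: "0 < \<kappa>" "7 * \<kappa> \<le> \<kappa>'"
  shows "\<exists>r. a \<le> r \<and> r \<le> a + \<eta> \<and> split_circle (\<lambda>u v. plane_pt x \<rho> e f (c + u) v \<in> \<Omega>)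
    (\<lambda>u v. plane_pt x \<rho> e f (c + u) v \<in> exterior \<Omega>) \<kappa>' r"
proof -
  obtain r where r: "a < r" "r < a + \<eta>" "half_split \<Omega> \<kappa> (plane_pt x \<rho> e f c 0) (\<rho> * r)"
    using good_radius_exists[OF few \<Omega> \<rho> \<eta> a] .
  then show ?thesis
    using split_circle_mono[OF half_split_imp_split_circle[OF fr \<rho> _ _ \<kappa>(1) r(3)] \<kappa>(2)] a
    by (intro exI[of _ r]) auto
qed

lemma beta_infty_le:
  assumes L: "is_line L" "L \<inter> ball z \<rho> \<noteq> {}" and z: "z \<in> \<Gamma>" and \<rho>: "0 < \<rho>"
    and near: "\<And>y. y \<in> \<Gamma> \<inter> ball z \<rho> \<Longrightarrow> infdist y L \<le> \<epsilon> * \<rho>"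
  shows "beta_infty \<Gamma> z \<rho> \<le> \<epsilon>"
proof -
  define \<L> where "\<L> = {L. is_line L \<and> L \<inter> ball z \<rho> \<noteq> {}}"
  define S where "S = (\<lambda>L. SUP y \<in> \<Gamma> \<inter> ball z \<rho>. infdist y L)"
  have zB: "z \<in> \<Gamma> \<inter> ball z \<rho>" using z \<rho> by simp
  \<comment> \<open>A real supremum is informative only over a bounded set; boundedness comes from
    the line meeting the ball. The lower bound 0 then makes the infimum over lines
    meaningful.\<close>
  have "0 \<le> S M" if M: "M \<in> \<L>" for M
  proof -
    obtain p where p: "p \<in> M" using M by (auto simp: \<L>_def)
    have "infdist y M \<le> \<rho> + dist z p" if "y \<in> \<Gamma> \<inter> ball z \<rho>" for y
      using infdist_le[OF p, of y] dist_triangle[of y p z] that by (simp add: dist_commute)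
    then have "bdd_above ((\<lambda>y. infdist y M) ` (\<Gamma> \<inter> ball z \<rho>))" by (intro bdd_aboveI2) auto
    then have "infdist z M \<le> S M" unfolding S_def using zB by (intro cSUP_upper) auto
    then show ?thesis using infdist_nonneg[of z M] by linarith
  qed
  then have "bdd_below (S ` \<L>)" by (intro bdd_belowI2[of _ 0]) auto
  moreover have "L \<in> \<L>" using L by (simp add: \<L>_def)
  moreover have "S L \<le> \<epsilon> * \<rho>" unfolding S_def using zB near by (intro cSUP_least) auto
  ultimately have "(INF M\<in>\<L>. S M) \<le> \<epsilon> * \<rho>" by (rule cINF_lower2)
  then have "1 / \<rho> * (INF M\<in>\<L>. S M) \<le> 1 / \<rho> * (\<epsilon> * \<rho>)" using \<rho> by (intro mult_left_mono) auto
  then show ?thesis using \<rho> by (simp add: beta_infty_def S_def \<L>_def)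
qed

lemma is_line_affine_hull: "a \<noteq> b \<Longrightarrow> is_line (affine hull {a, b})"
  by (simp add: is_line_def aff_dim_2)

lemma flat_circle_mirror:
  assumes "flat_circle (\<lambda>u v. P (d - u) v \<in> \<Omega>) (\<lambda>u v. P (d - u) v \<in> \<Omega>') t r"
  shows "flat_circle (\<lambda>u v. P (d + u) v \<in> \<Omega>) (\<lambda>u v. P (d + u) v \<in> \<Omega>') t r"
  unfolding flat_circle_def
proof (intro allI impI)
  fix u v :: real assume "u\<^sup>2 + v\<^sup>2 = r\<^sup>2" "t \<le> \<bar>v\<bar>"
  then show "P (d + u) v \<in> \<Omega> \<or> P (d + u) v \<in> \<Omega>'"
    using assms[unfolded flat_circle_def, rule_format, of "- u" v] by simp
qed

text \<open>In the frame directed along the two centres and upwards to \<open>y\<close>, a point too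
  far from the line has height \<open>V \<ge> 2 * t\<close>, which the arguments for connected
  boundaries and for corkscrew sets exclude.\<close>

lemma frontier_near_line_if_few_bad_radii:
  fixes t d1 c :: real
  assumes t: "0 < t" "t \<le> 1" and d1: "0 < d1" and c: "0 < c"
  obtains \<kappa> \<eta> :: real where "0 < \<kappa>" "\<kappa> \<le> 1" "0 < \<eta>"
    "\<And>\<Omega> x x' y \<rho>. jordan_domain \<Omega> \<or> two_sided_corkscrew c \<Omega> \<Longrightarrow> 0 < \<rho> \<Longrightarrow>
      d1 * \<rho> \<le> dist x x' \<Longrightarrow> dist x x' \<le> t ^ 3 / 5000 * \<rho> \<Longrightarrow>
      x \<in> frontier \<Omega> \<Longrightarrow> x' \<in> frontier \<Omega> \<Longrightarrow> y \<in> frontier \<Omega> \<Longrightarrow>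
      dist y x \<le> 2 * \<rho> \<Longrightarrow> dist y x' \<le> 2 * \<rho> \<Longrightarrow>
      emeasure lborel (bad_radii \<Omega> \<kappa> (7 * \<rho>) x) < ennreal (\<eta> * \<rho>) \<Longrightarrow>
      emeasure lborel (bad_radii \<Omega> \<kappa> (7 * \<rho>) x') < ennreal (\<eta> * \<rho>) \<Longrightarrow>
      infdist y (affine hull {x, x'}) \<le> 2 * t * \<rho>"
proof -
  \<comment> \<open>The corkscrew scale, small against \<open>d1\<close> so that the two centres
    still determine heights. The mesh \<open>l\<close> below it is also less than
    \<open>c * \<sigma>\<close>, the room inside a corkscrew ball.\<close>
  define \<sigma> where "\<sigma> = Min {d1 / 20, t\<^sup>2 * d1 / 20, t / 4}"
  have \<sigma>: "0 < \<sigma>" "\<sigma> \<le> d1 / 20" "\<sigma> \<le> t\<^sup>2 * d1 / 20" "\<sigma> \<le> t / 4"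
    unfolding \<sigma>_def using t d1 by (subst Min_gr_iff; auto) (intro Min_le; simp)+
  define l where "l = min \<sigma> (c * \<sigma> / 2)"
  have "0 < c * \<sigma>" using c \<sigma> by simp
  moreover have "l \<le> c * \<sigma> / 2" by (simp add: l_def)
  ultimately have l: "l \<le> \<sigma>" "l < c * \<sigma>" "0 < l" using \<sigma>(1) by (simp_all add: l_def)
  show ?thesis
  proof (rule flat_circle_exists[OF t d1 l(3)], goal_cases)
    case (1 \<kappa>' \<eta>)
    note \<kappa>' = 1(1) and \<eta> = 1(2) and flat = 1(3)
    define \<kappa> where "\<kappa> = min (\<kappa>' / 7) 1"
    have \<kappa>: "0 < \<kappa>" "\<kappa> \<le> 1" "7 * \<kappa> \<le> \<kappa>'" using \<kappa>' by (auto simp: \<kappa>_def)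
    show ?thesis
    proof (rule that[OF \<kappa>(1,2) \<eta>], rule ccontr)
      fix \<Omega> x x' y \<rho>
      assume \<Omega>: "jordan_domain \<Omega> \<or> two_sided_corkscrew c \<Omega>" and \<rho>: "0 < \<rho>"
        and dist: "d1 * \<rho> \<le> dist x x'" "dist x x' \<le> t ^ 3 / 5000 * \<rho>"
        and \<Gamma>: "x \<in> frontier \<Omega>" "x' \<in> frontier \<Omega>" "y \<in> frontier \<Omega>"
        and yx: "dist y x \<le> 2 * \<rho>" "dist y x' \<le> 2 * \<rho>"
        and few: "emeasure lborel (bad_radii \<Omega> \<kappa> (7 * \<rho>) x) < ennreal (\<eta> * \<rho>)"
          "emeasure lborel (bad_radii \<Omega> \<kappa> (7 * \<rho>) x') < ennreal (\<eta> * \<rho>)"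
        and far: "\<not> infdist y (affine hull {x, x'}) \<le> 2 * t * \<rho>"
      have op: "open \<Omega>" using \<Omega> by (auto simp: jordan_domain_def two_sided_corkscrew_def)
      define d where "d = dist x x' / \<rho>"
      have d: "d1 \<le> d" "d \<le> t ^ 3 / 5000" using dist \<rho> by (auto simp: d_def field_simps)
      have d0: "0 < d" using d d1 by linarith
      have "t ^ 3 \<le> 1" using t by (simp add: power_le_one)
      then have d_le1: "d \<le> 1" using d by linarith
      define e where "e = (1 / (\<rho> * d)) *\<^sub>R (x' - x)"
      have dx: "\<rho> * d = dist x x'" "0 < \<rho> * d" using \<rho> d0 by (auto simp: d_def)
      have "norm e = 1" using dx by (simp add: e_def dist_norm norm_minus_commute)
      then obtain f where fr: "frame e f" and V0: "0 \<le> (y - x) \<bullet> f" by (rule frame_exists)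
      let ?P = "plane_pt x \<rho> e f"
      have P0: "?P 0 0 = x" by (simp add: plane_pt_def)
      have Pd: "?P d 0 = x'" using \<rho> d0 by (simp add: plane_pt_def e_def)
      define Y where "Y = (y - x) \<bullet> e / \<rho>"
      define V where "V = (y - x) \<bullet> f / \<rho>"
      have Py: "?P Y V = y" unfolding Y_def V_def by (rule plane_pt_coords[OF fr \<rho>])
      have V: "2 * t \<le> V"
      proof -
        have "?P Y 0 \<in> affine hull {x, x'}"
        proof -
          have "?P Y 0 = (1 - Y / d) *\<^sub>R x + (Y / d) *\<^sub>R x'"
            using \<rho> d0 by (simp add: plane_pt_def e_def algebra_simps)
          then show ?thesis unfolding affine_hull_2 by (intro CollectI exI[of _ "1 - Y / d"] exI[of _ "Y / d"]) auto
        qed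
        then have "infdist y (affine hull {x, x'}) \<le> dist y (?P Y 0)" by (rule infdist_le)
        also have "\<dots> = \<rho> * V"
        proof -
          have "0 \<le> V" using V0 \<rho> by (simp add: V_def)
          then show ?thesis using dist_plane_pt[OF fr \<rho>, of x Y V Y 0] unfolding Py by simp
        qed
        finally have "2 * t * \<rho> < V * \<rho>" using far by (simp add: mult.commute)
        then show ?thesis using \<rho> by simp
      qed
      have near: "Y\<^sup>2 + V\<^sup>2 \<le> 2\<^sup>2" "(Y - d)\<^sup>2 + V\<^sup>2 \<le> 2\<^sup>2"
      proof -
        have "\<rho> * sqrt (Y\<^sup>2 + V\<^sup>2) \<le> \<rho> * 2"
          using dist_plane_pt[OF fr \<rho>, of x Y V 0 0] yx(1) by (simp add: Py P0 mult.commute)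
        moreover have "\<rho> * sqrt ((Y - d)\<^sup>2 + V\<^sup>2) \<le> \<rho> * 2"
          using dist_plane_pt[OF fr \<rho>, of x Y V d 0] yx(2) by (simp add: Py Pd mult.commute)
        ultimately show "Y\<^sup>2 + V\<^sup>2 \<le> 2\<^sup>2" "(Y - d)\<^sup>2 + V\<^sup>2 \<le> 2\<^sup>2"
          using \<rho> by (auto dest: sqrt_le_D)
      qed
      have few': "emeasure lborel (bad_radii \<Omega> \<kappa> (7 * \<rho>) (?P 0 0)) < ennreal (\<eta> * \<rho>)"
        "emeasure lborel (bad_radii \<Omega> \<kappa> (7 * \<rho>) (?P d 0)) < ennreal (\<eta> * \<rho>)"
        unfolding P0 Pd by (rule few)+
      note dense0 = split_circle_dense[OF few'(1) op \<rho> \<eta> _ _ fr \<kappa>(1,3)]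
      note dense1 = split_circle_dense[OF few'(2) op \<rho> \<eta> _ _ fr \<kappa>(1,3)]
      have disj: "\<not> (p \<in> \<Omega> \<and> p \<in> exterior \<Omega>)" for p using exterior_disjoint(1) by blast
      have flat0: "flat_dense \<Omega> ?P t l 0" unfolding flat_dense_def
      proof (intro allI impI)
        fix a assume a: "t \<le> a" "a + l \<le> 3"
        show "\<exists>r. a \<le> r \<and> r \<le> a + l \<and>
            flat_circle (\<lambda>u v. ?P (0 + u) v \<in> \<Omega>) (\<lambda>u v. ?P (0 + u) v \<in> exterior \<Omega>) t r"
        proof (rule flat[OF d _ _ _ a])
          show "\<not> (?P (0 + u) v \<in> \<Omega> \<and> ?P (0 + u) v \<in> exterior \<Omega>)" for u v by (rule disj)
          fix b assume b: "0 \<le> b" "b + \<eta> \<le> 5"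
          show "\<exists>r. b \<le> r \<and> r \<le> b + \<eta> \<and>
              split_circle (\<lambda>u v. ?P (0 + u) v \<in> \<Omega>) (\<lambda>u v. ?P (0 + u) v \<in> exterior \<Omega>) \<kappa>' r"
            by (rule dense0[OF b])
          show "\<exists>r. b \<le> r \<and> r \<le> b + \<eta> \<and>
              split_circle (\<lambda>u v. ?P (0 + (d + u)) v \<in> \<Omega>) (\<lambda>u v. ?P (0 + (d + u)) v \<in> exterior \<Omega>) \<kappa>' r"
            using dense1[OF b] by simp
        qed
      qed
      have flat1: "flat_dense \<Omega> ?P t l d" unfolding flat_dense_def
      proof (intro allI impI)
        fix a assume a: "t \<le> a" "a + l \<le> 3"
        \<comment> \<open>The mirror map \<open>u \<mapsto> d - u\<close> exchanges the two centres,
          which yields flat circles about the second one from the result for the first.\<close>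
        have "\<exists>r. a \<le> r \<and> r \<le> a + l \<and>
            flat_circle (\<lambda>u v. ?P (d - u) v \<in> \<Omega>) (\<lambda>u v. ?P (d - u) v \<in> exterior \<Omega>) t r"
        proof (rule flat[OF d _ _ _ a])
          show "\<not> (?P (d - u) v \<in> \<Omega> \<and> ?P (d - u) v \<in> exterior \<Omega>)" for u v by (rule disj)
          fix b assume b: "0 \<le> b" "b + \<eta> \<le> 5"
          obtain r where r: "b \<le> r" "r \<le> b + \<eta>"
            "split_circle (\<lambda>u v. ?P (d + u) v \<in> \<Omega>) (\<lambda>u v. ?P (d + u) v \<in> exterior \<Omega>) \<kappa>' r"
            using dense1[OF b] by blast
          show "\<exists>r. b \<le> r \<and> r \<le> b + \<eta> \<and>
              split_circle (\<lambda>u v. ?P (d - u) v \<in> \<Omega>) (\<lambda>u v. ?P (d - u) v \<in> exterior \<Omega>) \<kappa>' r"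
            using r(1,2) split_circle_mirror[OF r(3)] by auto
          obtain r' where r': "b \<le> r'" "r' \<le> b + \<eta>"
            "split_circle (\<lambda>u v. ?P (0 + u) v \<in> \<Omega>) (\<lambda>u v. ?P (0 + u) v \<in> exterior \<Omega>) \<kappa>' r'"
            using dense0[OF b] by blast
          show "\<exists>r. b \<le> r \<and> r \<le> b + \<eta> \<and>
              split_circle (\<lambda>u v. ?P (d - (d + u)) v \<in> \<Omega>) (\<lambda>u v. ?P (d - (d + u)) v \<in> exterior \<Omega>) \<kappa>' r"
            using r'(1,2) split_circle_mirror[OF r'(3)] by auto
        qed
        then show "\<exists>r. a \<le> r \<and> r \<le> a + l \<and>
            flat_circle (\<lambda>u v. ?P (d + u) v \<in> \<Omega>) (\<lambda>u v. ?P (d + u) v \<in> exterior \<Omega>) t r"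
          using flat_circle_mirror[of ?P d] by blast
      qed
      have \<sigma>d: "20 * (\<sigma> / d) \<le> t\<^sup>2" "10 * \<sigma> \<le> d" "\<sigma> < d"
      proof -
        have "t\<^sup>2 * d1 \<le> t\<^sup>2 * d" using d by (intro mult_left_mono) auto
        then have "20 * \<sigma> \<le> t\<^sup>2 * d" using \<sigma>(3) by linarith
        then show "20 * (\<sigma> / d) \<le> t\<^sup>2" using d0 by (simp add: pos_divide_le_eq)
      qed (use \<sigma> d d0 in auto)
      have ld: "20 * (l / d) \<le> t\<^sup>2"
        using divide_right_mono[OF l(1), of d] d0 \<sigma>d(1) by linarith
      from \<Omega> show False
      proof
        assume "jordan_domain \<Omega>"
        then have "connected (frontier \<Omega>)"
          unfolding jordan_domain_def jordan_curve_def using connected_simple_path_image by metis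
        then show False
          using connected_frontier_near_line[OF op _ fr \<rho> flat0 flat1 t(1) d0 d_le1 l(3) _ ld _ _ _ near V]
            P0 Py \<Gamma> l(1) \<sigma>(4) \<sigma>d t by auto
      next
        assume cs: "two_sided_corkscrew c \<Omega>"
        show False
          using two_sided_corkscrew_near_line[OF cs c fr \<rho> flat0 flat1 t(1) d0 d_le1 \<sigma>(1) \<sigma>d(3) _ \<sigma>d(1,2) l(3,2,1) _ _ _ near V]
            P0 Pd Py \<Gamma> \<sigma>(4) t by auto
      qed
    qed
  qed
qed

lemma beta_infty_le_if_small_square_function:
  fixes \<theta> \<epsilon> c :: real
  assumes \<theta>: "0 < \<theta>" and \<epsilon>: "0 < \<epsilon>" and c: "0 < c"
  obtains \<delta> :: real where "0 < \<delta>" "\<delta> < 1"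
    "\<And>\<Omega> \<mu> z \<rho>. jordan_domain \<Omega> \<or> two_sided_corkscrew c \<Omega> \<Longrightarrow>
       locally_finite_borel \<mu> \<Longrightarrow> linear_growth 1 \<mu> \<Longrightarrow> supported_on \<mu> (frontier \<Omega>) \<Longrightarrow>
       z \<in> frontier \<Omega> \<Longrightarrow> 0 < \<rho> \<Longrightarrow> emeasure \<mu> (ball z \<rho>) \<ge> ennreal (\<theta> * \<rho>) \<Longrightarrow>
       (\<integral>\<^sup>+x \<in> ball z (7 * \<rho>).
          (\<integral>\<^sup>+r \<in> {0<..<7 * \<rho>}.
             ennreal (((eps_coeff \<Omega> x r)\<^sup>2 + (alpha_coeff \<Omega> x r)\<^sup>2) / r) \<partial>lborel) \<partial>\<mu>)
         \<le> ennreal \<delta> * emeasure \<mu> (ball z (7 * \<rho>)) \<Longrightarrow>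
       beta_infty (frontier \<Omega>) z \<rho> \<le> \<epsilon>"
proof -
  \<comment> \<open>The distance to the line is bounded by \<open>2 * t * \<rho>\<close>, hence the
    division by 2.\<close>
  define t where "t = min \<epsilon> 1 / 2"
  have t: "0 < t" "t \<le> 1" "2 * t \<le> \<epsilon>" using \<epsilon> by (auto simp: t_def)
  have t3: "0 < t ^ 3 / 5000" using t by simp
  have \<theta>2: "0 < \<theta> / 2" using \<theta> by simp
  show ?thesis
  proof (rule separated_pair_exists[OF \<theta>2 t3], goal_cases)
    case (1 d1)
    note d1 = 1(1) and pair = 1(2)
    show ?case
    proof (rule frontier_near_line_if_few_bad_radii[OF t(1,2) d1 c], goal_cases)
      case (1 \<kappa> \<eta>)
      note \<kappa> = 1(1,2) and \<eta> = 1(3) and near = 1(4)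
      define \<delta> where "\<delta> = min (1 / 2) (\<theta> * \<kappa>\<^sup>2 * \<eta> / 392)"
      have \<delta>: "0 < \<delta>" "\<delta> < 1" "392 * \<delta> \<le> \<theta> * \<kappa>\<^sup>2 * \<eta>" using \<theta> \<kappa> \<eta> by (auto simp: \<delta>_def)
      show ?thesis
      proof (rule that[OF \<delta>(1,2)])
        fix \<Omega> \<mu> z \<rho>
        assume \<Omega>: "jordan_domain \<Omega> \<or> two_sided_corkscrew c \<Omega>"
          and \<mu>: "locally_finite_borel \<mu>" "linear_growth 1 \<mu>" "supported_on \<mu> (frontier \<Omega>)"
          and z: "z \<in> frontier \<Omega>" and \<rho>: "0 < \<rho>" and big: "emeasure \<mu> (ball z \<rho>) \<ge> ennreal (\<theta> * \<rho>)"
          and small: "(\<integral>\<^sup>+x \<in> ball z (7 * \<rho>).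
              (\<integral>\<^sup>+r \<in> {0<..<7 * \<rho>}.
                 ennreal (((eps_coeff \<Omega> x r)\<^sup>2 + (alpha_coeff \<Omega> x r)\<^sup>2) / r) \<partial>lborel) \<partial>\<mu>)
             \<le> ennreal \<delta> * emeasure \<mu> (ball z (7 * \<rho>))"
        have op: "open \<Omega>" using \<Omega> by (auto simp: jordan_domain_def two_sided_corkscrew_def)
        have sets: "sets \<mu> = sets borel" using \<mu>(1) by (simp add: locally_finite_borel_def)
        define E where "E = {x \<in> ball z \<rho> \<inter> frontier \<Omega>.
          emeasure lborel (bad_radii \<Omega> \<kappa> (7 * \<rho>) x) < ennreal (\<eta> * \<rho>)}"
        have E: "E \<in> sets borel" "ennreal (\<theta> / 2 * \<rho>) \<le> emeasure \<mu> E"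
          unfolding E_def
          using good_centres_measure[OF op sets \<mu>(2,3) \<kappa> \<rho> \<eta> \<theta> less_imp_le[OF \<delta>(1)] \<delta>(3) big small] .
        have "E \<subseteq> ball z \<rho>" by (auto simp: E_def)
        from pair[OF \<mu>(2) sets E(1) this \<rho> E(2)]
        obtain x x' where xx: "x \<in> E" "x' \<in> E" "d1 * \<rho> \<le> dist x x'" "dist x x' \<le> t ^ 3 / 5000 * \<rho>" by blast
        have "x \<noteq> x'" using xx(3) mult_pos_pos[OF d1 \<rho>] by auto
        then have "is_line (affine hull {x, x'})" by (rule is_line_affine_hull)
        then show "beta_infty (frontier \<Omega>) z \<rho> \<le> \<epsilon>"
        proof (rule beta_infty_le[OF _ _ z \<rho>])
          have "x \<in> affine hull {x, x'}" by (simp add: hull_inc)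
          then show "affine hull {x, x'} \<inter> ball z \<rho> \<noteq> {}" using xx(1) by (auto simp: E_def)
          fix y assume y: "y \<in> frontier \<Omega> \<inter> ball z \<rho>"
          have "dist y p \<le> 2 * \<rho>" if "p \<in> E" for p
            using dist_triangle3[of y p z] y that by (simp add: E_def)
          then have "infdist y (affine hull {x, x'}) \<le> 2 * t * \<rho>"
            using near[OF \<Omega> \<rho> xx(3,4)] xx(1,2) y by (auto simp: E_def)
          also have "\<dots> \<le> \<epsilon> * \<rho>" using t(3) \<rho> by (intro mult_right_mono) auto
          finally show "infdist y (affine hull {x, x'}) \<le> \<epsilon> * \<rho>" .
        qed
      qed
    qed
  qed
qed

theorem lemma4p1:
  fixes \<theta> \<epsilon> :: real and \<D> :: "(real^2) set set"
  assumes "0 < \<theta>" and "\<theta> < 1" and "0 < \<epsilon>"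
    and "\<D> = {\<Omega>. jordan_domain \<Omega>} \<or> (\<exists>c>0. \<D> = {\<Omega>. two_sided_corkscrew c \<Omega>})"
  shows "\<exists>\<delta>::real. 0 < \<delta> \<and> \<delta> < 1 \<and>
    (\<forall>\<Omega> \<in> \<D>. \<forall>(\<mu> :: (real^2) measure) (z :: real^2) (\<rho> :: real).
       locally_finite_borel \<mu> \<longrightarrow> linear_growth 1 \<mu> \<longrightarrow> supported_on \<mu> (frontier \<Omega>) \<longrightarrow>
       z \<in> frontier \<Omega> \<longrightarrow> 0 < \<rho> \<longrightarrow>
       emeasure \<mu> (ball z \<rho>) \<ge> ennreal (\<theta> * \<rho>) \<longrightarrow>
       (\<integral>\<^sup>+x \<in> ball z (7 * \<rho>).
          (\<integral>\<^sup>+r \<in> {0<..<7 * \<rho>}.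
             ennreal (((eps_coeff \<Omega> x r)\<^sup>2 + (alpha_coeff \<Omega> x r)\<^sup>2) / r) \<partial>lborel) \<partial>\<mu>)
         \<le> ennreal \<delta> * emeasure \<mu> (ball z (7 * \<rho>)) \<longrightarrow>
       beta_infty (frontier \<Omega>) z \<rho> \<le> \<epsilon>)"
proof -
  \<comment> \<open>For Jordan domains any positive parameter serves; 1 is taken.\<close>
  obtain c where c: "0 < c" "\<And>\<Omega>. \<Omega> \<in> \<D> \<Longrightarrow> jordan_domain \<Omega> \<or> two_sided_corkscrew c \<Omega>"
    using assms(4) zero_less_one by blast
  show ?thesis
  proof (rule beta_infty_le_if_small_square_function[OF assms(1,3) c(1)], goal_cases)
    case (1 \<delta>)
    show ?case by (intro exI[of _ \<delta>] conjI ballI allI impI 1 c(2))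
  qed
qed

end
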